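(* Let $\gamma$ be a simple closed, smooth, strictly convex curve in the Euclidean plane $\mathbf{R}^2$, with length $P$, enclosed area $A$, and curvature $k(x)>0$ with minimum $k_{\min}=\min_x k(x)>0$. For the billiard inside $\gamma$, let $\delta\in[0,1]$ be the proportion (with respect to the invariant measure $\mu$) of the phase space not occupied by $m$-orbits. Then $$\delta\geq \frac{\pi(P^2-4\pi A)}{4P(P+\sqrt{4\pi A})}\geq \frac{\pi(P^2-4 \pi A) }{8 P^2},$$ and also $$\delta\geq \frac{(P^2-4 \pi A)\,k_{\min} }{8 P}.$$
   Context: Billiard setup: $x$ is an arclength parameter on the closed curve $\gamma$ (so $x\in\mathbf{R}/P\mathbf{Z}$). The phase space is $\Omega=\{(x,\varphi): x\in\mathbf{R}/P\mathbf{Z},\ \varphi\in(0,\pi)\}$, where $\varphi$ is the angle between the tangent to $\gamma$ at $\gamma(x)$ and a chord leaving $\gamma(x)$ into the domain bounded by $\gamma$. The billiard map $T:\Omega\to\Omega$, $T(x,\varphi)=(y,\psi)$, sends the ray leaving $\gamma(x)$ at angle $\varphi$ to its next hit point $\gamma(y)$ and the reflected angle $\psi$ (angle of reflection equals angle of incidence). $T$ preserves the measure $d\mu=\sin\varphi\,dx\,d\varphi$, and $\mu(\Omega)=2P$. Let $L(x,y)$ be the distance between $\gamma(x)$ and $\gamma(y)$. A billiard configuration is a sequence $\{x_n\}_{n\in\mathbf{Z}}$ of points of $\gamma$ such that consecutive points are consecutive bounce points of a billiard trajectory; it is an $m$-configuration if for every $M<N$ the second variation of the functional $\sum_{n=M}^{N-1}L(x_n,x_{n+1})$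 with respect to $x_{M+1},\dots,x_{N-1}$ (endpoints $x_M,x_N$ fixed) is negative definite. The corresponding orbits of $T$ in $\Omega$ are called $m$-orbits. Let $\mathcal{M}\subseteq\Omega$ be the (closed, $T$-invariant) set of all points lying on $m$-orbits, $\Delta=\Omega\setminus\mathcal{M}$, and $\delta=\mu(\Delta)/\mu(\Omega)$. *)

theory Defs
  imports "HOL-Analysis.Analysis"
begin

text \<open>The Euclidean plane is modelled by the type complex. A curve is a map
  real \<Rightarrow> complex, parametrized by arclength, P-periodic.\<close>

fun vderivs :: "nat \<Rightarrow> (real \<Rightarrow> complex) \<Rightarrow> real \<Rightarrow> complex" where
  "vderivs 0 f = f"
| "vderivs (Suc n) f = (\<lambda>x. vector_derivative (vderivs n f) (at x))"

definition smooth_curve :: "(real \<Rightarrow> complex) \<Rightarrow> bool" where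
  "smooth_curve g \<longleftrightarrow>
     (\<forall>n x. (vderivs n g has_vector_derivative vderivs (Suc n) g x) (at x))"

definition curve_image :: "(real \<Rightarrow> complex) \<Rightarrow> real \<Rightarrow> complex set" where
  "curve_image g P = g ` {0..P}"

text \<open>Curvature of an arclength-parametrized curve: norm of the second derivative.\<close>
definition curvature :: "(real \<Rightarrow> complex) \<Rightarrow> real \<Rightarrow> real" where
  "curvature g x = norm (vderivs 2 g x)"

definition strictly_convex_curve :: "(real \<Rightarrow> complex) \<Rightarrow> real \<Rightarrow> bool" where
  "strictly_convex_curve g P \<longleftrightarrow>
     (\<forall>a\<in>curve_image g P. \<forall>b\<in>curve_image g P. a \<noteq> b \<longrightarrow>
        open_segment a b \<subseteq> inside (curve_image g P))"

definition enclosed_area :: "(real \<Rightarrow> complex) \<Rightarrow> real \<Rightarrow> real" where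
  "enclosed_area g P = Sigma_Algebra.measure lebesgue (inside (curve_image g P))"

definition chordL :: "(real \<Rightarrow> complex) \<Rightarrow> real \<Rightarrow> real \<Rightarrow> real" where
  "chordL g x y = dist (g x) (g y)"

text \<open>One billiard step T(x,phi) = (y,psi) (points of the curve given by real
  representatives of parameters mod P). The ray leaves g x in unit direction d,
  making angle phi with the tangent and entering the domain; it travels inside the
  domain until it hits the curve at g y; the reflected direction is the mirror
  image of d in the tangent line at g y (angle of reflection = angle of incidence),
  and psi is its angle with the tangent at g y.\<close>
definition billiard_step ::
  "(real \<Rightarrow> complex) \<Rightarrow> real \<Rightarrow> real \<times> real \<Rightarrow> real \<times> real \<Rightarrow> bool" where
  "billiard_step g P p q \<longleftrightarrow>
     (let x = fst p; \<phi> = snd p; y = fst q; \<psi> = snd q;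
          tx = vderivs 1 g x; ty = vderivs 1 g y in
      0 < \<phi> \<and> \<phi> < pi \<and> 0 < \<psi> \<and> \<psi> < pi \<and>
      (\<exists>t>0. \<exists>d. norm d = 1 \<and> Re (cnj tx * d) = cos \<phi> \<and>
          (\<forall>s\<in>{0<..<t}. g x + of_real s * d \<in> inside (curve_image g P)) \<and>
          g y = g x + of_real t * d \<and>
          Re (cnj ty * (ty\<^sup>2 * cnj d)) = cos \<psi>))"

text \<open>m-configuration: the second variation of the length functional on every
  finite segment [M,N] (endpoints fixed) is negative definite.\<close>
definition m_configuration :: "(real \<Rightarrow> complex) \<Rightarrow> (int \<Rightarrow> real) \<Rightarrow> bool" where
  "m_configuration g xs \<longleftrightarrow>
     (\<forall>M N :: int. M < N \<longrightarrow>
       (\<forall>\<xi> :: int \<Rightarrow> real.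
          (\<forall>n. (n \<le> M \<or> N \<le> n) \<longrightarrow> \<xi> n = 0) \<and> (\<exists>n. \<xi> n \<noteq> 0) \<longrightarrow>
          deriv (deriv (\<lambda>e. \<Sum>n\<in>{M..<N}.
              chordL g (xs n + e * \<xi> n) (xs (n + 1) + e * \<xi> (n + 1)))) 0 < 0))"

definition phase_space :: "real \<Rightarrow> (real \<times> real) set" where
  "phase_space P = {(x, \<phi>). 0 \<le> x \<and> x < P \<and> 0 < \<phi> \<and> \<phi> < pi}"

definition m_orbit_set :: "(real \<Rightarrow> complex) \<Rightarrow> real \<Rightarrow> (real \<times> real) set" where
  "m_orbit_set g P = {p \<in> phase_space P. \<exists>s :: int \<Rightarrow> real \<times> real.
      s 0 = p \<and> (\<forall>n. billiard_step g P (s n) (s (n + 1))) \<and>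
      m_configuration g (fst \<circ> s)}"

definition billiard_mu :: "(real \<times> real) set \<Rightarrow> real" where
  "billiard_mu S = (LINT p:S|lborel. sin (snd p))"

definition delta_proportion :: "(real \<Rightarrow> complex) \<Rightarrow> real \<Rightarrow> real" where
  "delta_proportion g P =
     billiard_mu (phase_space P - m_orbit_set g P) / billiard_mu (phase_space P)"

end

(*
On an m-orbit the second variation is negative. Testing it on a long segment with a constant
variation field shows that the sum of (sin phi + sin psi)^2 / L - k sin phi - k' sin psi along the
segment is bounded above independently of its length; since the billiard map preserves mu, the
integral of this function over the set M of points on m-orbits is nonpositive.
With (sin phi + sin psi)^2 / L >= 2 l (sin phi + sin psi) - l^2 L this gives, for every l,
  integral over M of (4 l sin phi - l^2 L - 2 k sin phi) dmu <= 0.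
Over the whole phase space the integrals of sin phi, L and k sin phi are pi P / 2, at most 2 pi A
and at most pi^2. Hence 2 pi P l - 2 pi A l^2 - 2 pi^2 is at most the integral of
(4 l - 2 k) sin phi over the complement of M, and the two bounds follow with
l = sqrt (pi / A) and l = 2 pi / P.

The chord integral comes from L = (g y - g z) . d - (g x - g z) . d, where d is the direction of
the chord from g x to g y: by invariance of mu both terms become integrals over a single bounce point.
*)
theory Submission
  imports Defs
begin

text \<open>The choices of l come from the disc. On a disc of radius r every chord satisfies sin phi
  + sin psi = L / r, so the completed square behind the bound 2 l u - l^2 L vanishes for l = 1 / r.
  Both sqrt (pi / A) and 2 pi / P equal 1 / r there. In general the first value maximizes the bound
  obtained by estimating 4 l - 2 k by 4 l on the complement of M; the second turns 2 pi P l - 2 pi A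
  l^2 - 2 pi^2 into 2 pi^2 (P^2 - 4 pi A) / P^2. The passage from bounded sums to the integral is
  elementary: by invariance N times the integral over M is the integral of a sum along N steps,
  hence stays below a constant for all N. Two matters shape the rest. M is defined by negativity on
  uncountably many real variation fields, and its measurability has to be proved before anything can
  be integrated over it. And a point of the curve has many real parameters modulo P, while the curve
  may run in either direction; hence the congruence lemmas, the reduction \<open>red\<close> and the
  sign \<sigma>.\<close>

section \<open>Preliminaries on integration and elementary inequalities\<close>

text \<open>Meant for substitutions that are regular only inside the interval, such as a chord angle
  or its cotangent, whose formulas degenerate at the ends. The interval is exhausted by compact
  ones, and continuity from below of the two measures with densities passes to the limit.\<close>

lemma nn_integral_substitution_open_interval:
  fixes f :: "real \<Rightarrow> ennreal" and h h' :: "real \<Rightarrow> real"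
  assumes f[measurable]: "f \<in> borel_measurable borel"
    and h[measurable]: "h \<in> borel_measurable borel" and h'[measurable]: "h' \<in> borel_measurable borel"
    and der: "\<And>x. a < x \<Longrightarrow> x < b \<Longrightarrow> (h has_real_derivative h' x) (at x)"
    and cont: "continuous_on {a<..<b} h'"
    and pos: "\<And>x. a < x \<Longrightarrow> x < b \<Longrightarrow> 0 < h' x"
    and "a < b"
  shows "(\<integral>\<^sup>+x. f x * indicator (h ` {a<..<b}) x \<partial>lborel) =
         (\<integral>\<^sup>+x. f (h x) * ennreal (h' x) * indicator {a<..<b} x \<partial>lborel)"
proof -
  \<comment> \<open>The summand 3 ensures \<open>u n < v n\<close> already for
    \<open>n = 0\<close>.\<close>
  define u where "u n = a + (b - a) / (real n + 3)" for n
  define v where "v n = b - (b - a) / (real n + 3)" for n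
  have d0: "0 < (b - a) / (real n + 3)" "(b - a) / (real n + 3) < (b - a) / 2" for n
  proof -
    show "0 < (b - a) / (real n + 3)" using \<open>a < b\<close> by simp
    show "(b - a) / (real n + 3) < (b - a) / 2"
      using \<open>a < b\<close> by (intro divide_strict_left_mono mult_pos_pos) auto
  qed
  have uv: "a < u n" "u n < v n" "v n < b" for n
  proof -
    define d where "d = (b - a) / (real n + 3)"
    have "0 < d" "d < (b - a) / 2" using d0[of n] by (simp_all only: d_def)
    then show "a < u n" "u n < v n" "v n < b"
      unfolding u_def v_def d_def[symmetric] by (simp_all add: field_simps)
  qed
  have lim0: "(\<lambda>n. (b - a) / (real n + 3)) \<longlonglongrightarrow> 0"
    using LIMSEQ_ignore_initial_segment[OF lim_const_over_n[of "b - a"], of 3] by simp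
  have dec: "(b - a) / (real n + 3) \<le> (b - a) / (real m + 3)" if "m \<le> n" for m n
    using that \<open>a < b\<close> by (intro divide_left_mono) auto
  have Un: "(\<Union>n. {u n..v n}) = {a<..<b}"
  proof (intro equalityI subsetI)
    fix x assume "x \<in> {a<..<b}"
    then have "0 < min (x - a) (b - x)" by auto
    from order_tendstoD(2)[OF lim0 this] obtain n where "(b - a) / (real n + 3) < min (x - a) (b - x)"
      by (auto simp: eventually_sequentially)
    then show "x \<in> (\<Union>n. {u n..v n})" by (auto simp: u_def v_def intro!: exI[of _ n])
  next
    fix x assume "x \<in> (\<Union>n. {u n..v n})"
    then obtain n where "x \<in> {u n..v n}" by blast
    with uv[of n] show "x \<in> {a<..<b}" by auto
  qed
  have cont_h: "continuous_on {a<..<b} h"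
    using der by (intro continuous_at_imp_continuous_on ballI) (auto intro: DERIV_isCont)
  have mono: "h x < h y" if "a < x" "x < y" "y < b" for x y
  proof (rule DERIV_pos_imp_increasing[OF that(2)])
    fix z assume "x \<le> z" "z \<le> y"
    with that have "a < z" "z < b" by auto
    then show "\<exists>y. DERIV h z :> y \<and> 0 < y" using der pos by blast
  qed
  have img: "h ` {u n..v n} = {h (u n)..h (v n)}" for n
  proof (intro equalityI subsetI)
    fix z assume "z \<in> h ` {u n..v n}"
    then obtain x where "x \<in> {u n..v n}" "z = h x" by blast
    then show "z \<in> {h (u n)..h (v n)}"
      using mono[of "u n" x] mono[of x "v n"] uv[of n] by (cases "x = u n"; cases "x = v n") force+
  next
    fix z assume z: "z \<in> {h (u n)..h (v n)}"
    have "continuous_on {u n..v n} h"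
      using cont_h by (rule continuous_on_subset) (use uv[of n] in auto)
    then obtain x where "u n \<le> x" "x \<le> v n" "h x = z"
      using IVT'[of h "u n" z "v n"] z uv(2)[of n] by auto
    then show "z \<in> h ` {u n..v n}" by auto
  qed
  have himg: "h ` {a<..<b} = (\<Union>n. {h (u n)..h (v n)})"
    unfolding Un[symmetric] image_UN img ..
  have step: "emeasure (density lborel f) {h (u n)..h (v n)} =
      emeasure (density lborel (\<lambda>x. f (h x) * ennreal (h' x))) {u n..v n}" for n
  proof -
    have "(\<integral>\<^sup>+x. f x * indicator {h (u n)..h (v n)} x \<partial>lborel) =
             (\<integral>\<^sup>+x. f (h x) * h' x * indicator {u n..v n} x \<partial>lborel)"
      using uv[of n] by (intro nn_integral_substitution_aux f der less_imp_le[OF pos]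
        continuous_on_subset[OF cont]) auto
    then show ?thesis by (subst (1 2) emeasure_density) auto
  qed
  have inc: "incseq (\<lambda>n. {u n..v n})"
  proof (intro incseq_SucI subsetI)
    fix n x assume "x \<in> {u n..v n}"
    then show "x \<in> {u (Suc n)..v (Suc n)}"
      using dec[of n "Suc n"] unfolding u_def v_def atLeastAtMost_iff by linarith
  qed
  have inc2: "incseq (\<lambda>n. {h (u n)..h (v n)})"
    using inc unfolding img[symmetric] incseq_def by (blast intro: image_mono)
  have "emeasure (density lborel f) (h ` {a<..<b}) =
      emeasure (density lborel (\<lambda>x. f (h x) * ennreal (h' x))) {a<..<b}"
    unfolding himg unfolding Un[symmetric]
    by (subst (1 2) SUP_emeasure_incseq[symmetric]) (auto simp: step inc inc2)
  moreover have "h ` {a<..<b} \<in> sets borel" unfolding himg by auto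
  ultimately show ?thesis by (simp add: emeasure_density)
qed

text \<open>Chord angles at \<open>x\<close> are parametrized by the endpoint in (x, x + P), whereas
  the phase space uses [0, P).\<close>

lemma integral_shift_period:
  fixes h :: "real \<Rightarrow> ennreal"
  assumes [measurable]: "h \<in> borel_measurable borel" and per: "\<And>x. h (x + P) = h x"
    and x: "0 \<le> x" "x \<le> P"
  shows "(\<integral>\<^sup>+y. h y * indicator {x<..<x+P} y \<partial>lborel) = (\<integral>\<^sup>+y. h y * indicator {0..<P} y \<partial>lborel)"
proof -
  have "(\<integral>\<^sup>+y. h y * indicator {x<..<x+P} y \<partial>lborel) = (\<integral>\<^sup>+y. h y * indicator {x<..<P} y + h y * indicator {P..<x+P} y \<partial>lborel)"
    by (rule nn_integral_cong_AE, rule AE_I[of _ _ "{P}"]) (use x in \<open>auto simp: indicator_def\<close>)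
  also have "\<dots> = (\<integral>\<^sup>+y. h y * indicator {x<..<P} y \<partial>lborel) + (\<integral>\<^sup>+y. h y * indicator {P..<x+P} y \<partial>lborel)"
    by (rule nn_integral_add) auto
  also have "(\<integral>\<^sup>+y. h y * indicator {P..<x+P} y \<partial>lborel) = (\<integral>\<^sup>+y. h (P + 1 * y) * indicator {P..<x+P} (P + 1 * y) \<partial>lborel)"
    by (subst nn_integral_real_affine[of _ 1 P]) auto
  also have "\<dots> = (\<integral>\<^sup>+y. h y * indicator {0..<x} y \<partial>lborel)"
    using per by (intro nn_integral_cong) (auto simp: indicator_def add.commute)
  also have "(\<integral>\<^sup>+y. h y * indicator {x<..<P} y \<partial>lborel) + \<dots> = (\<integral>\<^sup>+y. h y * indicator {x<..<P} y + h y * indicator {0..<x} y \<partial>lborel)"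
    by (rule nn_integral_add[symmetric]) auto
  also have "\<dots> = (\<integral>\<^sup>+y. h y * indicator {0..<P} y \<partial>lborel)"
    by (rule nn_integral_cong_AE, rule AE_I[of _ _ "{x}"]) (use x in \<open>auto simp: indicator_def\<close>)
  finally show ?thesis .
qed

text \<open>Both measures agree on boxes. This carries areas over to pairs of reals, where Fubini
  applies.\<close>

lemma lborel_complex:
  "lborel = distr (lborel :: (real \<times> real) measure) borel (\<lambda>p. Complex (fst p) (snd p))"
proof (rule lborel_eqI)
  have [measurable]: "(\<lambda>p. Complex (fst p) (snd p)) \<in> borel_measurable borel"
    unfolding complex_eq_iff
    by (intro borel_measurable_continuous_onI) (auto intro!: continuous_intros simp: Complex_eq)
  fix l u :: complex
  assume le: "\<And>b. b \<in> Basis \<Longrightarrow> l \<bullet> b \<le> u \<bullet> b"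
  have "emeasure (distr (lborel :: (real \<times> real) measure) borel (\<lambda>p. Complex (fst p) (snd p))) (box l u)
    = emeasure (lborel :: (real \<times> real) measure) ((\<lambda>p. Complex (fst p) (snd p)) -` box l u)"
    by (subst emeasure_distr) auto
  also have "(\<lambda>p. Complex (fst p) (snd p)) -` box l u = box (Re l, Im l) (Re u, Im u)"
    by (auto simp: box_def Basis_complex_def inner_complex_def Basis_prod_def)
  also have "emeasure lborel \<dots> = (\<Prod>b\<in>Basis. ((Re u, Im u) - (Re l, Im l)) \<bullet> b)"
    using le[of 1] le[of \<i>] by (subst emeasure_lborel_box) (auto simp: Basis_complex_def Basis_prod_def inner_complex_def)
  also have "\<dots> = (\<Prod>b\<in>Basis. (u - l) \<bullet> b)"
    by (simp add: Basis_complex_def Basis_prod_def inner_complex_def complex_eq_iff mult.commute)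
  finally show "emeasure (distr (lborel :: (real \<times> real) measure) borel (\<lambda>p. Complex (fst p) (snd p))) (box l u)
     = (\<Prod>b\<in>Basis. (u - l) \<bullet> b)" .
qed auto

lemma emeasure_complex_slices:
  assumes [measurable]: "S \<in> sets borel"
  shows "emeasure lborel S = (\<integral>\<^sup>+b. \<integral>\<^sup>+a. indicator S (Complex a b) \<partial>lborel \<partial>lborel)"
proof -
  have meas: "(\<lambda>p. Complex (fst p) (snd p)) \<in> borel_measurable borel"
    by (intro borel_measurable_continuous_onI) (auto intro!: continuous_intros simp: Complex_eq)
  then have [measurable]: "(\<lambda>p. Complex (fst p) (snd p)) \<in> borel_measurable (lborel \<Otimes>\<^sub>M lborel)"
    by (simp add: lborel_prod)
  have "emeasure lborel S = (\<integral>\<^sup>+w. indicator S w \<partial>(distr lborel borel (\<lambda>p. Complex (fst p) (snd p))))"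
    by (simp flip: lborel_complex)
  also have "\<dots> = (\<integral>\<^sup>+p. indicator S (Complex (fst p) (snd p)) \<partial>(lborel \<Otimes>\<^sub>M lborel))"
    using meas by (subst nn_integral_distr) (auto simp: lborel_prod)
  also have "\<dots> = (\<integral>\<^sup>+b. \<integral>\<^sup>+a. indicator S (Complex a b) \<partial>lborel \<partial>lborel)"
    using lborel_pair.nn_integral_snd[of "\<lambda>p. indicator S (Complex (fst p) (snd p))"] by simp
  finally show ?thesis .
qed

lemma nn_integral_id_interval:
  assumes "0 \<le> H" shows "(\<integral>\<^sup>+b. ennreal b * indicator {0<..<H} b \<partial>lborel) = ennreal (H\<^sup>2 / 2)"
proof -
  have "(\<integral>\<^sup>+b. ennreal b * indicator {0<..<H} b \<partial>lborel) = (\<integral>\<^sup>+b. ennreal b * indicator {0..H} b \<partial>lborel)"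
    by (rule nn_integral_cong_AE, rule AE_I[of _ _ "{H}"]) (auto simp: indicator_def)
  also have "\<dots> = ennreal (H\<^sup>2 / 2 - 0\<^sup>2 / 2)"
    using assms by (intro nn_integral_FTC_Icc) (auto intro!: derivative_eq_intros)
  finally show ?thesis by simp
qed

lemma integral_sin_0_pi: "integral {0..pi} sin = 2"
proof -
  have "(sin has_integral (- cos pi - (- cos 0))) {0..pi}"
    by (rule fundamental_theorem_of_calculus)
       (auto intro!: derivative_eq_intros simp: has_real_derivative_iff_has_vector_derivative[symmetric])
  then show ?thesis by (simp add: integral_unique)
qed

lemma integral_sin2_0_pi: "integral {0..pi} (\<lambda>\<phi>. sin \<phi> * sin \<phi>) = pi / 2"
proof -
  have "((\<lambda>\<phi>. sin \<phi> * sin \<phi>) has_integral ((pi - sin pi * cos pi) / 2 - (0 - sin 0 * cos 0) / 2)) {0..pi}"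
  proof (rule fundamental_theorem_of_calculus)
    fix x :: real
    have "((\<lambda>\<phi>. (\<phi> - sin \<phi> * cos \<phi>) / 2) has_real_derivative (1 - (cos x * cos x - sin x * sin x)) / 2) (at x within {0..pi})"
      by (auto intro!: derivative_eq_intros)
    moreover have "(1 - (cos x * cos x - sin x * sin x)) / 2 = sin x * sin x"
      using sin_cos_squared_add[of x] by (simp add: power2_eq_square field_simps)
    ultimately show "((\<lambda>\<phi>. (\<phi> - sin \<phi> * cos \<phi>) / 2) has_vector_derivative sin x * sin x) (at x within {0..pi})"
      by (simp add: has_real_derivative_iff_has_vector_derivative[symmetric])
  qed auto
  then show ?thesis by (simp add: integral_unique)
qed

lemma integral_cos_sin_0_pi: "integral {0..pi} (\<lambda>\<phi>. cos \<phi> * sin \<phi>) = 0"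
proof -
  have "((\<lambda>\<phi>. cos \<phi> * sin \<phi>) has_integral ((sin pi)\<^sup>2 / 2 - (sin 0)\<^sup>2 / 2)) {0..pi}"
    by (rule fundamental_theorem_of_calculus)
       (auto intro!: derivative_eq_intros simp: has_real_derivative_iff_has_vector_derivative[symmetric])
  then show ?thesis by (simp add: integral_unique)
qed

text \<open>For small \<open>e\<close> with the sign of \<open>b\<close> the linear term would
  dominate and be positive.\<close>

lemma quadratic_nonpos_imp_linear_coeff_0:
  fixes b c :: real
  assumes "\<And>e. 2 * e * b + e\<^sup>2 * c \<le> 0"
  shows "b = 0"
proof (rule ccontr)
  assume "b \<noteq> 0"
  define e where "e = b / (1 + \<bar>c\<bar>)"
  have b: "b = e * (1 + \<bar>c\<bar>)" by (simp add: e_def)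
  with \<open>b \<noteq> 0\<close> have "0 < e\<^sup>2" by auto
  then have "0 < e\<^sup>2 * (2 * (1 + \<bar>c\<bar>) + c)" by (intro mult_pos_pos) auto
  also have "\<dots> = 2 * e * b + e\<^sup>2 * c" unfolding b by (simp add: power2_eq_square algebra_simps)
  finally show False using assms[of e] by simp
qed

text \<open>With s = sqrt a the difference of the two sides is pi (P - s)^2 / (8 P^2), a square,
  whatever the sign of P^2 - a.\<close>

lemma bound_comparison:
  fixes P a :: real
  assumes "0 < P" "0 \<le> a"
  shows "pi * (P\<^sup>2 - a) / (8 * P\<^sup>2) \<le> pi * (P\<^sup>2 - a) / (4 * P * (P + sqrt a))"
proof -
  define s where "s = sqrt a"
  have s: "0 \<le> s" "a = s * s" using assms by (auto simp: s_def)
  have "pi * (P\<^sup>2 - a) / (4 * P * (P + s)) = pi * (P - s) / (4 * P)"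
  proof -
    have "P\<^sup>2 - a = (P - s) * (P + s)" using s by (simp add: power2_eq_square algebra_simps)
    then show ?thesis using assms s by simp
  qed
  moreover have "pi * (P - s) / (4 * P) - pi * (P\<^sup>2 - a) / (8 * P\<^sup>2) = pi * (P - s)\<^sup>2 / (8 * P\<^sup>2)"
    using assms(1) unfolding s(2) by (simp add: field_simps power2_eq_square)
  moreover have "0 \<le> pi * (P - s)\<^sup>2 / (8 * P\<^sup>2)" by simp
  ultimately show ?thesis unfolding s_def by linarith
qed

section \<open>Convex ovals\<close>

text \<open>If a point \<open>q\<close> of a segment were outside, then walking from each end of the
  segment towards \<open>q\<close> would meet the frontier, so \<open>q\<close> would lie between
  two points \<open>c\<close> and \<open>e\<close> of the curve. But the whole segment from
  \<open>c\<close> to \<open>e\<close> belongs to the region.\<close>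

lemma convex_curve_Un_inside:
  fixes C :: "complex set"
  assumes C: "compact C" and front: "frontier (inside C) = C"
    and seg: "\<And>a b. a \<in> C \<Longrightarrow> b \<in> C \<Longrightarrow> a \<noteq> b \<Longrightarrow> open_segment a b \<subseteq> inside C"
  shows "convex (C \<union> inside C)"
proof -
  let ?K = "C \<union> inside C"
  have closed: "closed ?K"
    using front closure_Un_frontier[of "inside C"] by (metis closed_closure sup_commute)
  have frK: "frontier ?K \<subseteq> C"
  proof -
    have "?K = closure (inside C)" using front closure_Un_frontier[of "inside C"] by auto
    then show ?thesis using front interior_mono[OF closure_subset[of "inside C"]] by (auto simp: frontier_def)
  qed
  have ends: "closed_segment c e \<subseteq> ?K" if "c \<in> C" "e \<in> C" for c e
    using that seg[of c e] by (cases "c = e") (auto simp: closed_segment_eq_open)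
  show ?thesis
    unfolding convex_contains_segment
  proof (intro ballI subsetI, rule ccontr)
    fix a b q assume a: "a \<in> ?K" and b: "b \<in> ?K" and q: "q \<in> closed_segment a b" "q \<notin> ?K"
    have reach: "\<exists>c\<in>C. c \<in> closed_segment p q" if "p \<in> ?K" for p
    proof -
      have "closed_segment p q \<inter> frontier ?K \<noteq> {}"
        using that q(2) by (intro connected_Int_frontier) auto
      then show ?thesis using frK by auto
    qed
    obtain c e where ce: "c \<in> C" "e \<in> C" "c \<in> closed_segment a q" "e \<in> closed_segment b q"
      using reach[OF a] reach[OF b] by blast
    have "q \<in> closed_segment c e"
    proof -
      obtain u where u: "0 \<le> u" "u \<le> 1" "q = (1 - u) *\<^sub>R a + u *\<^sub>R b"
        using q(1) by (auto simp: in_segment)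
      obtain v where v: "0 \<le> v" "v \<le> 1" "c = (1 - v) *\<^sub>R a + v *\<^sub>R q"
        using ce(3) by (auto simp: in_segment)
      obtain w where w: "0 \<le> w" "w \<le> 1" "e = (1 - w) *\<^sub>R b + w *\<^sub>R q"
        using ce(4) by (auto simp: in_segment)
      have c': "c - q = ((1 - v) * u) *\<^sub>R (a - b)" and e': "e - q = ((1 - w) * (1 - u)) *\<^sub>R (b - a)"
        unfolding v(3) w(3) u(3) by (auto simp: algebra_simps scaleR_conv_of_real)
      \<comment> \<open>\<open>c\<close> and \<open>e\<close> lie on opposite sides of
        \<open>q\<close>, at distances proportional to \<alpha> and \<beta>; weighting them
        crosswise gives back \<open>q\<close>.\<close>
      define \<alpha> \<beta> where "\<alpha> = (1 - v) * u" and "\<beta> = (1 - w) * (1 - u)"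
      have nn: "0 \<le> \<alpha>" "0 \<le> \<beta>" using u v w by (auto simp: \<alpha>_def \<beta>_def)
      show ?thesis
      proof (cases "\<alpha> + \<beta> = 0")
        case True
        then have "\<alpha> = 0" using nn by linarith
        then have "c - q = 0" unfolding c' \<alpha>_def[symmetric] by simp
        then show ?thesis by simp
      next
        case False
        have "\<beta> *\<^sub>R (c - q) + \<alpha> *\<^sub>R (e - q) = 0"
          unfolding c' e' \<alpha>_def[symmetric] \<beta>_def[symmetric] by (simp add: algebra_simps)
        then have eq: "(\<alpha> + \<beta>) *\<^sub>R q = \<beta> *\<^sub>R c + \<alpha> *\<^sub>R e" by (simp add: algebra_simps)
        have "q = (1 / (\<alpha> + \<beta>)) *\<^sub>R ((\<alpha> + \<beta>) *\<^sub>R q)" using False by simp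
        also have "\<dots> = (1 - \<alpha> / (\<alpha> + \<beta>)) *\<^sub>R c + (\<alpha> / (\<alpha> + \<beta>)) *\<^sub>R e"
          unfolding eq using False by (simp add: scaleR_right_distrib diff_divide_eq_iff)
        finally show ?thesis using nn False unfolding in_segment
          by (intro exI[of _ "\<alpha> / (\<alpha> + \<beta>)"]) (auto simp: divide_simps)
      qed
    qed
    then show False using ends[OF ce(1,2)] q(2) by blast
  qed
qed

text \<open>\<open>\<sigma> = 1\<close> for a counterclockwise and \<open>\<sigma> = -1\<close> for a clockwise parametrization. The assumption
  \<open>side\<close> says that the curve lies strictly on the inner side of each of its tangents.\<close>
locale convex_oval =
  fixes g t :: "real \<Rightarrow> complex" and k :: "real \<Rightarrow> real" and \<sigma> P :: real
  assumes P_pos: "0 < P"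
    and g_deriv: "\<And>x. (g has_vector_derivative t x) (at x)"
    and t_deriv: "\<And>x. (t has_vector_derivative of_real (\<sigma> * k x) * \<i> * t x) (at x)"
    and norm_t: "\<And>x. norm (t x) = 1"
    and k_cont: "continuous_on UNIV k"
    and k_pos: "\<And>x. 0 < k x"
    and sigma: "\<sigma> * \<sigma> = 1"
    and g_per: "\<And>x. g (x + P) = g x"
    and inj_g: "inj_on g {0..<P}"
    and side: "\<And>x y. g x \<noteq> g y \<Longrightarrow> 0 < \<sigma> * Im (cnj (t x) * (g y - g x))"
    and chord_inside: "\<And>x y. g x \<noteq> g y \<Longrightarrow> open_segment (g x) (g y) \<subseteq> inside (g ` {0..P})"

text \<open>The signed curvature is continuous and never zero, so its sign is a constant \<sigma>.
  For \<open>side\<close>, the closed region is convex and has a supporting line at each curve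
  point; the first derivative shows that this line is the tangent, the second derivative tells on
  which side the region lies.\<close>

lemma convex_ovalI:
  fixes \<gamma> :: "real \<Rightarrow> complex" and P :: real
  assumes P_pos: "P > 0"
    and smooth: "smooth_curve \<gamma>"
    and periodic: "\<forall>x. \<gamma> (x + P) = \<gamma> x"
    and simple: "inj_on \<gamma> {0..<P}"
    and arclength: "\<forall>x. norm (vderivs 1 \<gamma> x) = 1"
    and strictly_convex: "strictly_convex_curve \<gamma> P"
    and curv_pos: "\<forall>x. curvature \<gamma> x > 0"
  obtains \<sigma> where "convex_oval \<gamma> (vderivs 1 \<gamma>) (curvature \<gamma>) \<sigma> P"
proof -
  define t a where "t = vderivs 1 \<gamma>" and "a = vderivs 2 \<gamma>"
  have g': "(\<gamma> has_vector_derivative t x) (at x)" for x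
    using smooth[unfolded smooth_curve_def, rule_format, of 0 x] by (simp add: t_def)
  have t': "(t has_vector_derivative a x) (at x)" for x
    using smooth[unfolded smooth_curve_def, rule_format, of 1 x] by (simp add: t_def a_def numeral_2_eq_2)
  have a': "(a has_vector_derivative vderivs 3 \<gamma> x) (at x)" for x
    using smooth[unfolded smooth_curve_def, rule_format, of 2 x]
    by (simp add: t_def a_def numeral_2_eq_2 numeral_3_eq_3)
  have cont: "continuous_on S \<gamma>" "continuous_on S t" "continuous_on S a" for S
    using g' t' a' by (blast intro: continuous_on_subset[of UNIV] continuous_at_imp_continuous_on has_vector_derivative_continuous)+
  have nt: "norm (t x) = 1" for x using arclength by (simp add: t_def)
  have ct: "cnj (t x) * t x = 1" for x
    using nt[of x] by (simp add: mult.commute complex_norm_square[symmetric])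
  define \<kappa> where "\<kappa> x = Im (cnj (t x) * a x)" for x
  have re0: "Re (cnj (t x) * a x) = 0" for x
  proof -
    have "((\<lambda>x. Re (cnj (t x) * t x)) has_vector_derivative Re (cnj (a x) * t x + cnj (t x) * a x)) (at x)"
      by (intro bounded_linear.has_vector_derivative[OF bounded_linear_Re])
         (auto intro!: derivative_eq_intros t')
    moreover have "((\<lambda>x. Re (cnj (t x) * t x)) has_vector_derivative 0) (at x)"
      by (simp add: ct)
    ultimately have "Re (cnj (a x) * t x + cnj (t x) * a x) = 0"
      by (rule vector_derivative_unique_at)
    then show ?thesis by (simp add: algebra_simps)
  qed
  have cta: "cnj (t x) * a x = of_real (\<kappa> x) * \<i>" for x
    by (rule complex_eqI) (auto simp: re0[simplified] \<kappa>_def)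
  have a_eq: "a x = of_real (\<kappa> x) * \<i> * t x" for x
  proof -
    have "a x = (cnj (t x) * t x) * a x" by (simp add: ct)
    also have "\<dots> = (cnj (t x) * a x) * t x" by (simp add: mult_ac)
    finally show ?thesis unfolding cta .
  qed
  have k_eq: "curvature \<gamma> x = \<bar>\<kappa> x\<bar>" for x
    unfolding curvature_def a_def[symmetric] a_eq by (simp add: norm_mult nt)
  have \<kappa>0: "\<kappa> x \<noteq> 0" for x using curv_pos[rule_format, of x] by (simp add: k_eq)
  have \<kappa>c: "continuous_on UNIV \<kappa>" unfolding \<kappa>_def by (intro continuous_intros cont)
  define \<sigma> where "\<sigma> = sgn (\<kappa> 0)"
  have ss: "\<sigma> * \<sigma> = 1" using \<kappa>0[of 0] by (auto simp: \<sigma>_def sgn_if)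
  have sk: "\<sigma> * curvature \<gamma> x = \<kappa> x" for x
  proof -
    have conn: "connected (\<kappa> ` UNIV)" by (intro connected_continuous_image \<kappa>c connected_UNIV)
    have "\<not> (\<kappa> 0 < 0 \<and> 0 < \<kappa> x)" "\<not> (\<kappa> x < 0 \<and> 0 < \<kappa> 0)"
      using connectedD_interval[OF conn, of "\<kappa> 0" "\<kappa> x" 0] connectedD_interval[OF conn, of "\<kappa> x" "\<kappa> 0" 0] \<kappa>0
      by (auto simp: image_iff) metis+
    then show ?thesis using \<kappa>0[of 0] \<kappa>0[of x] by (auto simp: \<sigma>_def k_eq sgn_if abs_if)
  qed
  define C where "C = \<gamma> ` {0..P}"
  \<comment> \<open>The curve as a loop on [0, 1], to which the Jordan curve theorem
    applies.\<close>
  define c where "c s = \<gamma> (P * s)" for s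
  have "(*) P ` {0..1} = {0..P}" using P_pos by (simp add: image_mult_atLeastAtMost)
  then have C_eq: "path_image c = C"
    by (simp add: path_image_def c_def C_def image_image[of \<gamma> "(*) P", symmetric])
  have closed: "\<gamma> 0 = \<gamma> P" using periodic[rule_format, of 0] by simp
  have "simple_path c"
  proof -
    have "x = y \<or> x = 0 \<and> y = 1 \<or> x = 1 \<and> y = 0"
      if "x \<in> {0..1}" "y \<in> {0..1}" "c x = c y" for x y :: real
    proof (rule ccontr)
      assume neg: "\<not> ?thesis"
      define x' y' where "x' = (if x = 1 then 0 else x)" and "y' = (if y = 1 then 0 else y)"
      have "P * x' \<in> {0..<P}" "P * y' \<in> {0..<P}" "\<gamma> (P * x') = \<gamma> (P * y')"
        using that P_pos closed by (auto simp: x'_def y'_def c_def)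
      then have "P * x' = P * y'" using simple by (auto dest: inj_onD)
      then show False using neg P_pos by (auto simp: x'_def y'_def split: if_splits)
    qed
    moreover have "path c" unfolding path_def c_def
      by (intro continuous_on_compose2[OF cont(1)[of UNIV]] continuous_intros) auto
    ultimately show ?thesis unfolding simple_path_def loop_free_def by auto
  qed
  moreover have "pathfinish c = pathstart c" using closed by (simp add: pathfinish_def pathstart_def c_def)
  ultimately have J: "open (inside C)" "inside C \<noteq> {}" "frontier (inside C) = C" "frontier (outside C) = C"
      "inside C \<inter> outside C = {}" "inside C \<union> outside C = - C"
    using Jordan_inside_outside[of c] unfolding C_eq by auto
  have compC: "compact C" unfolding C_def by (intro compact_continuous_image cont compact_Icc)
  have chord: "open_segment p q \<subseteq> inside C" if "p \<in> C" "q \<in> C" "p \<noteq> q" for p q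
    using strictly_convex that unfolding strictly_convex_curve_def curve_image_def C_def by blast
  have memC: "\<gamma> x \<in> C" for x
  proof -
    have step: "\<gamma> (y + P * of_int n) = \<gamma> y" for y n
    proof (induction n rule: int_induct[where k = 0])
      case (step1 i) then show ?case using periodic[rule_format, of "y + P * of_int i"] by (simp add: algebra_simps)
    next
      case (step2 i) then show ?case using periodic[rule_format, of "y + P * of_int (i - 1)"] by (simp add: algebra_simps)
    qed simp
    define n where "n = \<lfloor>x / P\<rfloor>"
    have "of_int n \<le> x / P" "x / P < of_int n + 1" unfolding n_def by linarith+
    then have "x - P * of_int n \<in> {0..P}" using P_pos by (auto simp: field_simps)
    then have "\<gamma> (x - P * of_int n) \<in> C" by (auto simp: C_def)
    then show ?thesis using step[of "x - P * of_int n" n] by simp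
  qed
  define K where "K = C \<union> inside C"
  have convK: "convex K" unfolding K_def by (rule convex_curve_Un_inside[OF compC J(3) chord])
  have intK: "inside C \<subseteq> interior K"
    using J(1) by (auto simp: K_def intro: interior_maximal[THEN subsetD, of "inside C"])
  \<comment> \<open>Every curve point is also a limit of outside points, since the curve is the
    frontier of both components.\<close>
  have C_notint: "p \<notin> interior K" if "p \<in> C" for p
  proof
    assume p: "p \<in> interior K"
    have "p \<in> closure (outside C)" using that J(4) by (auto simp: frontier_def)
    then have "interior K \<inter> outside C \<noteq> {}"
      using p by (metis disjoint_iff open_Int_closure_eq_empty open_interior)
    then show False using interior_subset[of K] J(5) outside_no_overlap[of C] unfolding K_def by blast
  qed
  have side: "0 < \<sigma> * Im (cnj (t x) * (\<gamma> y - \<gamma> x))" if ne: "\<gamma> x \<noteq> \<gamma> y" for x y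
  proof -
    have relint: "rel_interior K = interior K"
      using intK J(2) by (intro rel_interior_nonempty_interior) auto
    have xcl: "\<gamma> x \<in> closure K" using memC[of x] closure_subset[of K] by (auto simp: K_def)
    have xnot: "\<gamma> x \<notin> rel_interior K" using C_notint[OF memC] by (simp add: relint)
    \<comment> \<open>\<open>v\<close> is an inner normal of a supporting line at
      \<open>\<gamma> x\<close>; the inequality is strict at interior points of the region, which
      later makes \<open>side\<close> strict.\<close>
    obtain v where v0: "v \<noteq> 0" and v1': "\<And>z. z \<in> closure K \<Longrightarrow> v \<bullet> \<gamma> x \<le> v \<bullet> z"
      and v2: "\<And>z. z \<in> rel_interior K \<Longrightarrow> v \<bullet> \<gamma> x < v \<bullet> z"
      by (rule supporting_hyperplane_relative_frontier[OF convK xcl xnot]) (rule that)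
    have v1: "v \<bullet> \<gamma> x \<le> v \<bullet> z" if "z \<in> K" for z
      using v1' that closure_subset[of K] by blast
    note v2 = v2[unfolded relint]
    define f where "f z = v \<bullet> (\<gamma> z - \<gamma> x)" for z
    have f0: "0 \<le> f z" for z using v1[of "\<gamma> z"] memC[of z] by (simp add: f_def K_def inner_diff_right)
    have fx: "f x = 0" by (simp add: f_def)
    have f': "(f has_real_derivative (v \<bullet> t z)) (at z)" for z
      unfolding f_def has_real_derivative_iff_has_vector_derivative
      by (intro bounded_linear.has_vector_derivative[OF bounded_linear_inner_right])
         (auto intro!: derivative_eq_intros g')
    have vt: "v \<bullet> t x = 0"
      by (rule DERIV_local_min[OF f', of 1]) (use f0 fx in auto)
    have f'': "((\<lambda>z. v \<bullet> t z) has_real_derivative (v \<bullet> a z)) (at z)" for z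
      unfolding has_real_derivative_iff_has_vector_derivative
      by (intro bounded_linear.has_vector_derivative[OF bounded_linear_inner_right] t')
    \<comment> \<open>Otherwise \<open>f\<close> would decrease just to the right of
      \<open>x\<close>, below its minimum \<open>f x = 0\<close>.\<close>
    have va: "0 \<le> v \<bullet> a x"
    proof (rule ccontr)
      assume "\<not> 0 \<le> v \<bullet> a x"
      then obtain e where e: "e > 0" "\<And>h. 0 < h \<Longrightarrow> h < e \<Longrightarrow> v \<bullet> t (x + h) < 0"
        using DERIV_neg_dec_right[OF f''[of x]] vt by auto
      have "f (x + e / 2) < f x"
      proof (rule DERIV_neg_imp_decreasing_open[where f = f])
        show "x < x + e / 2" using e by simp
        fix z assume z: "x < z" "z < x + e / 2"
        then have "v \<bullet> t z < 0" using e(1) e(2)[of "z - x"] by simp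
        then show "\<exists>y. DERIV f z :> y \<and> y < 0" using f' by blast
      qed (use f' in \<open>auto intro!: continuous_at_imp_continuous_on DERIV_isCont\<close>)
      then show False using f0[of "x + e/2"] fx by simp
    qed
    define b where "b = Im (cnj (t x) * v)"
    have v_eq: "v = of_real b * \<i> * t x"
    proof -
      have "Re (cnj (t x) * v) = 0" using vt by (simp add: inner_complex_def mult.commute)
      then have 1: "cnj (t x) * v = of_real b * \<i>" by (intro complex_eqI) (auto simp: b_def)
      have "v = (cnj (t x) * t x) * v" by (simp add: ct)
      also have "\<dots> = (cnj (t x) * v) * t x" by (simp add: mult_ac)
      finally show ?thesis unfolding 1 .
    qed
    have inner_it: "(of_real p * \<i> * t x) \<bullet> z = p * Im (cnj (t x) * z)" for p z
      by (simp add: inner_complex_def algebra_simps)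
    have "v \<bullet> a x = b * \<kappa> x" by (simp add: v_eq inner_it \<kappa>_def)
    moreover have "b \<noteq> 0" using v0 v_eq by auto
    ultimately have "0 < b * \<kappa> x" using va \<kappa>0[of x] by (simp add: order_less_le)
    \<comment> \<open>\<open>b\<close> has the sign of the curvature, so \<open>v\<close> is a
      positive multiple of the normal selected by \<sigma>.\<close>
    then have bs: "b = \<bar>b\<bar> * \<sigma>"
      using sk[of x] \<kappa>0[of 0] curv_pos[rule_format, of x]
      by (auto simp: \<sigma>_def sgn_if abs_if zero_less_mult_iff split: if_splits)
    \<comment> \<open>\<open>\<gamma> y\<close> itself is only a boundary point; the midpoint of the
      chord is interior, and its strict inequality doubles to one for
      \<open>\<gamma> y\<close>.\<close>
    define m where "m = midpoint (\<gamma> x) (\<gamma> y)"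
    have "m \<in> open_segment (\<gamma> x) (\<gamma> y)" using ne by (simp add: m_def)
    then have "m \<in> interior K" using chord[OF memC memC ne] intK by blast
    from v2[OF this] have "0 < v \<bullet> (m - \<gamma> x)" by (simp add: inner_diff_right)
    also have "m - \<gamma> x = (1/2) *\<^sub>R (\<gamma> y - \<gamma> x)" by (simp add: m_def midpoint_def algebra_simps scaleR_conv_of_real)
    finally have "0 < v \<bullet> (\<gamma> y - \<gamma> x)" by simp
    then have "0 < \<bar>b\<bar> * (\<sigma> * Im (cnj (t x) * (\<gamma> y - \<gamma> x)))"
      unfolding v_eq inner_it using bs by (metis mult.assoc)
    then show ?thesis by (simp add: zero_less_mult_iff)
  qed
  have kc: "continuous_on UNIV (curvature \<gamma>)"
    unfolding k_eq[abs_def] by (intro continuous_intros \<kappa>c)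
  have "convex_oval \<gamma> t (curvature \<gamma>) \<sigma> P"
    by unfold_locales
      (use P_pos g' t' a_eq nt curv_pos ss sk kc periodic simple side chord memC in \<open>auto simp: C_def[symmetric]\<close>)
  then show thesis using that t_def by auto
qed

context convex_oval
begin

text \<open>Components of the chord from \<open>g x\<close> to \<open>g y\<close> along the tangent and the inner normal at \<open>g x\<close>.\<close>
definition along :: "real \<Rightarrow> real \<Rightarrow> real" where
  "along x y = Re (cnj (t x) * (g y - g x))"

definition height :: "real \<Rightarrow> real \<Rightarrow> real" where
  "height x y = \<sigma> * Im (cnj (t x) * (g y - g x))"

text \<open>The angle between the tangent at \<open>g x\<close> and the chord to \<open>g y\<close>,
  computed from its cotangent. In this form it lies in (0, pi) for all arguments: for coinciding
  points the division by zero gives pi / 2.\<close>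

definition angle :: "real \<Rightarrow> real \<Rightarrow> real" where
  "angle x y = pi / 2 - arctan (along x y / height x y)"

lemma t_components: "Re (t x) * Re (t x) + Im (t x) * Im (t x) = 1"
  using norm_t[of x] by (simp add: cmod_def power2_eq_square)

lemma along_height_norm: "(along x y)\<^sup>2 + (height x y)\<^sup>2 = (chordL g x y)\<^sup>2"
proof -
  let ?w = "cnj (t x) * (g y - g x)"
  have "(along x y)\<^sup>2 + (height x y)\<^sup>2 = (Re ?w)\<^sup>2 + (\<sigma> * \<sigma>) * (Im ?w)\<^sup>2"
    by (simp only: along_def height_def power2_eq_square mult_ac)
  also have "\<dots> = (norm ?w)\<^sup>2" by (simp only: sigma cmod_power2)
  also have "norm ?w = chordL g x y"
    by (simp only: norm_mult complex_mod_cnj norm_t chordL_def dist_norm norm_minus_commute)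
  finally show ?thesis .
qed

lemma height_pos: "g x \<noteq> g y \<Longrightarrow> 0 < height x y"
  unfolding height_def by (rule side)

lemma height_eq_0: "g x = g y \<Longrightarrow> height x y = 0"
  by (simp add: height_def)

lemma height_nonneg: "0 \<le> height x y"
  using height_pos height_eq_0 by (metis less_eq_real_def)

lemma chord_pos: "g x \<noteq> g y \<Longrightarrow> 0 < chordL g x y"
  by (simp add: chordL_def)

lemma chord_commute: "chordL g x y = chordL g y x"
  by (simp add: chordL_def dist_commute)

lemma angle_bounds: "0 < angle x y" "angle x y < pi"
  using arctan_bounded[of "along x y / height x y"] by (auto simp: angle_def)

lemma sin_cos_angle:
  assumes "g x \<noteq> g y"
  shows "sin (angle x y) = height x y / chordL g x y" "cos (angle x y) = along x y / chordL g x y"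
proof -
  define A B L where "A = along x y" and "B = height x y" and "L = chordL g x y"
  have pos: "0 < B" "0 < L" using height_pos[OF assms] chord_pos[OF assms] by (auto simp: B_def L_def)
  have "A\<^sup>2 + B\<^sup>2 = L\<^sup>2" unfolding A_def B_def L_def by (rule along_height_norm)
  then have "(L / B)\<^sup>2 = 1 + (A / B)\<^sup>2" using pos by (simp add: field_simps)
  then have sq: "sqrt (1 + (A / B)\<^sup>2) = L / B" using pos by (intro real_sqrt_unique) auto
  have "sin (angle x y) = cos (arctan (A / B))" "cos (angle x y) = sin (arctan (A / B))"
    by (simp_all add: angle_def A_def B_def sin_diff cos_diff)
  then show "sin (angle x y) = height x y / chordL g x y" "cos (angle x y) = along x y / chordL g x y"
    using pos unfolding cos_arctan sin_arctan sq by (simp_all add: A_def B_def L_def)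
qed

section \<open>Periodicity and representatives modulo P\<close>

lemma shift_deriv: "((\<lambda>x. x + P) has_vector_derivative 1) (at x)"
  by (auto intro!: derivative_eq_intros)

lemma t_per: "t (x + P) = t x"
proof -
  have "((\<lambda>x. g (x + P)) has_vector_derivative t (x + P)) (at x)"
    using vector_diff_chain_at[OF shift_deriv g_deriv, of x] by (simp add: o_def)
  then show ?thesis unfolding g_per using g_deriv vector_derivative_unique_at by blast
qed

lemma k_per: "k (x + P) = k x"
proof -
  have "((\<lambda>x. t (x + P)) has_vector_derivative of_real (\<sigma> * k (x + P)) * \<i> * t (x + P)) (at x)"
    using vector_diff_chain_at[OF shift_deriv t_deriv, of x] by (simp add: o_def)
  then have "of_real (\<sigma> * k (x + P)) * \<i> * t x = of_real (\<sigma> * k x) * \<i> * t x"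
    unfolding t_per using t_deriv vector_derivative_unique_at by blast
  moreover have "t x \<noteq> 0" "\<sigma> \<noteq> 0" using norm_t[of x] sigma by auto
  ultimately show ?thesis by simp
qed

lemma periodic_int:
  assumes "\<And>x. f (x + P) = f x"
  shows "f (x + of_int n * P) = f x"
proof (induction n rule: int_induct[where k = 0])
  case (step1 i) then show ?case using assms[of "x + of_int i * P"] by (simp add: algebra_simps)
next
  case (step2 i) then show ?case using assms[of "x + of_int (i - 1) * P"] by (simp add: algebra_simps)
qed simp

definition red :: "real \<Rightarrow> real" where
  "red x = x - of_int \<lfloor>x / P\<rfloor> * P"

lemma red_bounds: "0 \<le> red x" "red x < P"
proof -
  have "of_int \<lfloor>x / P\<rfloor> \<le> x / P" "x / P < of_int \<lfloor>x / P\<rfloor> + 1" by linarith+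
  then show "0 \<le> red x" "red x < P"
    unfolding red_def pos_le_divide_eq[OF P_pos] pos_divide_less_eq[OF P_pos] by (auto simp: algebra_simps)
qed

lemma red_id: "0 \<le> x \<Longrightarrow> x < P \<Longrightarrow> red x = x"
  using P_pos by (simp add: red_def floor_eq_iff[of "x / P" 0, THEN iffD2])

lemma periodic_red:
  assumes "\<And>x. f (x + P) = f x" shows "f (red x) = f x"
  using periodic_int[of f x "- \<lfloor>x / P\<rfloor>"] assms by (simp add: red_def)

lemmas g_red = periodic_red[of g, OF g_per]
  and t_red = periodic_red[of t, OF t_per]
  and k_red = periodic_red[of k, OF k_per]

lemma g_eq_imp_red: "g x = g y \<Longrightarrow> red x = red y"
  using inj_onD[OF inj_g, of "red x" "red y"] red_bounds by (simp add: g_red)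

lemma g_eq_imp: assumes "g x = g y" shows "t x = t y" "k x = k y"
  using g_eq_imp_red[OF assms] t_red[of x] t_red[of y] k_red[of x] k_red[of y] by simp_all

lemma g_neq: assumes "x < y" "y < x + P" shows "g x \<noteq> g y"
proof
  assume "g x = g y"
  then have "x - of_int \<lfloor>x / P\<rfloor> * P = y - of_int \<lfloor>y / P\<rfloor> * P"
    using g_eq_imp_red[of x y] by (simp only: red_def)
  then have eq: "y - x = of_int (\<lfloor>y / P\<rfloor> - \<lfloor>x / P\<rfloor>) * P" by (simp add: algebra_simps)
  define n where "n = \<lfloor>y / P\<rfloor> - \<lfloor>x / P\<rfloor>"
  have "0 < of_int n * P" "of_int n * P < 1 * P" using assms eq unfolding n_def by linarith+
  then have "0 < n" "n < 1" using P_pos by (auto simp: zero_less_mult_iff)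
  then show False by simp
qed

text \<open>Since \<open>g\<close> is injective on a period, equal points have parameters that
  differ by a multiple of \<open>P\<close>, hence equal tangents. Representatives may therefore be
  exchanged freely.\<close>

lemma g_cong:
  assumes "g x = g x'" "g y = g y'"
  shows "along x y = along x' y'" "height x y = height x' y'" "chordL g x y = chordL g x' y'"
    "angle x y = angle x' y'"
  using assms g_eq_imp[OF assms(1)] by (simp_all add: along_def height_def chordL_def angle_def)

lemma cont_g: "continuous_on S g" and cont_t: "continuous_on S t"
  using g_deriv t_deriv by (blast intro: continuous_at_imp_continuous_on has_vector_derivative_continuous)+

lemma measurable_curve [measurable]:
  "g \<in> borel_measurable borel" "t \<in> borel_measurable borel" "k \<in> borel_measurable borel"
  using cont_g cont_t k_cont by (auto intro: borel_measurable_continuous_onI)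

lemma measurable_pairs [measurable (raw)]:
  assumes [measurable]: "u \<in> borel_measurable M" "v \<in> borel_measurable M"
  shows "(\<lambda>p. along (u p) (v p)) \<in> borel_measurable M"
    "(\<lambda>p. height (u p) (v p)) \<in> borel_measurable M"
    "(\<lambda>p. chordL g (u p) (v p)) \<in> borel_measurable M"
    "(\<lambda>p. angle (u p) (v p)) \<in> borel_measurable M"
proof -
  have arc[measurable]: "arctan \<in> borel_measurable borel"
    by (intro borel_measurable_continuous_onI continuous_intros)
  have cj[measurable]: "cnj \<in> borel_measurable borel"
    by (intro borel_measurable_continuous_onI continuous_intros)
  show *[measurable]: "(\<lambda>p. along (u p) (v p)) \<in> borel_measurable M"
    unfolding along_def by measurable
  show **[measurable]: "(\<lambda>p. height (u p) (v p)) \<in> borel_measurable M"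
    unfolding height_def by measurable
  show "(\<lambda>p. chordL g (u p) (v p)) \<in> borel_measurable M"
    unfolding chordL_def by measurable
  show "(\<lambda>p. angle (u p) (v p)) \<in> borel_measurable M"
    unfolding angle_def by measurable
qed

section \<open>The chord angle as a coordinate on the curve\<close>

lemma Re_deriv: "(f has_vector_derivative f') F \<Longrightarrow> ((\<lambda>x. Re (f x)) has_vector_derivative Re f') F"
  and Im_deriv: "(f has_vector_derivative f') F \<Longrightarrow> ((\<lambda>x. Im (f x)) has_vector_derivative Im f') F"
  by (rule bounded_linear.has_vector_derivative[OF bounded_linear_Re] bounded_linear.has_vector_derivative[OF bounded_linear_Im]; assumption)+

lemma along_deriv: "((\<lambda>y. along x y) has_real_derivative Re (cnj (t x) * t y)) (at y)"
  unfolding along_def has_real_derivative_iff_has_vector_derivative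
  by (intro Re_deriv) (auto intro!: derivative_eq_intros g_deriv)

lemma height_deriv: "((\<lambda>y. height x y) has_real_derivative \<sigma> * Im (cnj (t x) * t y)) (at y)"
proof -
  have "((\<lambda>y. Im (cnj (t x) * (g y - g x))) has_real_derivative Im (cnj (t x) * t y)) (at y)"
    unfolding has_real_derivative_iff_has_vector_derivative
    by (intro Im_deriv) (auto intro!: derivative_eq_intros g_deriv)
  then show ?thesis unfolding height_def by (rule DERIV_cmult)
qed

text \<open>The turning rate of a chord is the speed of its free end normal to the chord, which is
  sin (angle y x) = \<open>height y x\<close> / L, divided by its length L.\<close>

lemma angle_deriv:
  assumes "g x \<noteq> g y"
  shows "((\<lambda>y. angle x y) has_real_derivative height y x / (chordL g x y)\<^sup>2) (at y)"
proof -
  define A B A' B' L where "A = along x y" and "B = height x y" and "A' = Re (cnj (t x) * t y)"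
    and "B' = \<sigma> * Im (cnj (t x) * t y)" and "L = chordL g x y"
  have pos: "0 < B" "0 < L" using height_pos[OF assms] chord_pos[OF assms] by (auto simp: B_def L_def)
  have "A\<^sup>2 + B\<^sup>2 = L\<^sup>2" unfolding A_def B_def L_def by (rule along_height_norm)
  then have sq: "B * B + A * A = L * L" by (simp add: power2_eq_square)
  have "((\<lambda>y. angle x y) has_real_derivative - (inverse (1 + (A / B)\<^sup>2) * ((A' * B - A * B') / (B * B)))) (at y)"
    unfolding angle_def
    by (rule derivative_eq_intros along_deriv height_deriv refl)+
       (use pos in \<open>auto simp: A_def B_def A'_def B'_def\<close>)
  also have "- (inverse (1 + (A / B)\<^sup>2) * ((A' * B - A * B') / (B * B))) = (A * B' - A' * B) / (B * B + A * A)"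
    using pos by (simp add: divide_simps power2_eq_square)
  \<comment> \<open>The numerator is a cross product expressed in the frame of \<open>t x\<close>;
    as \<open>t x\<close> is a unit vector, it may be evaluated in the standard frame.\<close>
  also have "A * B' - A' * B = height y x"
  proof -
    have "A * B' - A' * B = \<sigma> * (Re (t x) * Re (t x) + Im (t x) * Im (t x)) * (Re (g y - g x) * Im (t y) - Im (g y - g x) * Re (t y))"
      unfolding A_def B_def A'_def B'_def along_def height_def by (simp add: algebra_simps)
    then show ?thesis unfolding t_components height_def by (simp add: algebra_simps)
  qed
  finally show ?thesis unfolding sq by (simp add: L_def power2_eq_square)
qed

lemma angle_mono: assumes "x < y" "y < z" "z < x + P" shows "angle x y < angle x z"
proof (rule DERIV_pos_imp_increasing[OF assms(2)])
  fix w assume "y \<le> w" "w \<le> z"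
  with assms have ne: "g x \<noteq> g w" by (intro g_neq) auto
  then show "\<exists>v. (angle x has_real_derivative v) (at w) \<and> 0 < v"
    using angle_deriv[OF ne] height_pos[of w x] chord_pos[OF ne]
    by (intro exI[of _ "height w x / (chordL g x w)\<^sup>2"] conjI) auto
qed

text \<open>\<open>F y\<close> is L sin (angle x y - \<phi>), and unlike the angle it is smooth at
  the ends of the period. It vanishes at both ends with slope - sin \<phi> < 0, so it is negative
  just after the left end, positive just before the right end, and has a zero between them.\<close>

lemma angle_surj:
  assumes "0 < \<phi>" "\<phi> < pi"
  shows "\<exists>y. x < y \<and> y < x + P \<and> angle x y = \<phi>"
proof -
  define F where "F y = cos \<phi> * height x y - sin \<phi> * along x y" for y
  have F': "(F has_real_derivative cos \<phi> * (\<sigma> * Im (cnj (t x) * t y)) - sin \<phi> * Re (cnj (t x) * t y)) (at y)" for y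
    unfolding F_def by (auto intro!: derivative_eq_intros along_deriv height_deriv)
  have s: "0 < sin \<phi>" using assms by (intro sin_gt_zero)
  have ct: "cnj (t x) * t x = 1"
    unfolding mult.commute[of "cnj (t x)"] complex_norm_square[symmetric] norm_t by simp
  have d1: "(F has_real_derivative - sin \<phi>) (at x)" "(F has_real_derivative - sin \<phi>) (at (x + P))"
    using F'[of x] F'[of "x + P"] by (simp_all only: t_per ct) auto
  have z: "F x = 0" "F (x + P) = 0" by (auto simp: F_def along_def height_def g_per)
  obtain d where d: "0 < d" "\<And>h. 0 < h \<Longrightarrow> h < d \<Longrightarrow> F (x + h) < 0"
    using DERIV_neg_dec_right[OF d1(1)] s z by auto
  obtain e where e: "0 < e" "\<And>h. 0 < h \<Longrightarrow> h < e \<Longrightarrow> 0 < F (x + P - h)"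
    using DERIV_neg_dec_left[OF d1(2)] s z by auto
  \<comment> \<open>Dividing by 3 gives at once \<open>h < d\<close>, \<open>h < e\<close> and
    \<open>2 * h < P\<close>.\<close>
  define h where "h = min (min d e) P / 3"
  have h: "0 < h" "h < d" "h < e" "x + h < x + P - h"
    using d(1) e(1) P_pos by (auto simp: h_def min_def)
  have "continuous_on {x+h..x+P-h} F"
    using F' by (auto intro!: continuous_at_imp_continuous_on DERIV_isCont)
  then obtain y where y: "x + h \<le> y" "y \<le> x + P - h" "F y = 0"
    using IVT'[of F "x + h" 0 "x + P - h"] d(2)[of h] e(2)[of h] h by force
  then have xy: "x < y" "y < x + P" using h by auto
  then have ne: "g x \<noteq> g y" by (rule g_neq)
  have "sin (angle x y - \<phi>) = F y / chordL g x y"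
    by (simp add: sin_diff sin_cos_angle[OF ne] F_def diff_divide_distrib mult.commute)
  then have "sin (angle x y - \<phi>) = 0" using y by simp
  moreover have "\<bar>angle x y - \<phi>\<bar> < pi" using angle_bounds[of x y] assms by linarith
  ultimately have "angle x y = \<phi>" using sin_eq_0_pi[of "angle x y - \<phi>"] by (auto simp: abs_less_iff)
  with xy show ?thesis by blast
qed

lemma angle_image: "angle x ` {x<..<x+P} = {0<..<pi}"
proof (intro equalityI subsetI)
  fix \<phi> assume "\<phi> \<in> {0<..<pi}"
  then obtain y where "x < y \<and> y < x + P \<and> angle x y = \<phi>" using angle_surj[of \<phi> x] by auto
  then show "\<phi> \<in> angle x ` {x<..<x+P}" by auto
qed (use angle_bounds in auto)

text \<open>The next bounce point, as the parameter in \<open>(x, x + P)\<close>; the value outside \<open>0 < \<phi> < pi\<close> is junk.\<close>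
definition hit :: "real \<Rightarrow> real \<Rightarrow> real" where
  "hit x \<phi> = (if 0 < \<phi> \<and> \<phi> < pi then (THE y. x < y \<and> y < x + P \<and> angle x y = \<phi>) else x)"

lemma hit_angle: assumes "x < y" "y < x + P" shows "hit x (angle x y) = y"
proof -
  have "(THE z. x < z \<and> z < x + P \<and> angle x z = angle x y) = y"
  proof (rule the_equality)
    fix z assume z: "x < z \<and> z < x + P \<and> angle x z = angle x y"
    show "z = y"
    proof (rule ccontr)
      assume "z \<noteq> y"
      then consider "z < y" | "y < z" by linarith
      then show False using assms z angle_mono[of x z y] angle_mono[of x y z] by cases auto
    qed
  qed (use assms in auto)
  then show ?thesis using angle_bounds[of x y] by (simp add: hit_def)
qed

lemma hitD:
  assumes "0 < \<phi>" "\<phi> < pi"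
  shows "x < hit x \<phi>" "hit x \<phi> < x + P" "angle x (hit x \<phi>) = \<phi>" "g x \<noteq> g (hit x \<phi>)"
proof -
  obtain y where y: "x < y" "y < x + P" "angle x y = \<phi>" using angle_surj[OF assms] by blast
  then have "hit x \<phi> = y" using hit_angle by blast
  with y show "x < hit x \<phi>" "hit x \<phi> < x + P" "angle x (hit x \<phi>) = \<phi>" "g x \<noteq> g (hit x \<phi>)"
    using g_neq by auto
qed

text \<open>Monotonicity of the angle turns the sublevel sets of the implicitly defined
  \<open>hit\<close> into conditions on the explicit function \<open>angle\<close>; this is what
  makes \<open>hit\<close> measurable.\<close>

lemma hit_le_iff:
  assumes "0 < \<phi>" "\<phi> < pi"
  shows "hit x \<phi> \<le> c \<longleftrightarrow> x + P \<le> c \<or> (x < c \<and> c < x + P \<and> \<phi> \<le> angle x c)"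
  using hitD[OF assms, of x] angle_mono[of x "hit x \<phi>" c] angle_mono[of x c "hit x \<phi>"]
  by (cases c "hit x \<phi>" rule: linorder_cases) (auto simp: not_le)

lemma measurable_hit [measurable (raw)]:
  assumes [measurable]: "u \<in> borel_measurable M" "v \<in> borel_measurable M"
  shows "(\<lambda>p. hit (u p) (v p)) \<in> borel_measurable M"
proof (rule borel_measurableI_le)
  fix c
  have pointwise: "(hit x \<phi> \<le> c) = (if 0 < \<phi> \<and> \<phi> < pi
      then x + P \<le> c \<or> (x < c \<and> c < x + P \<and> \<phi> \<le> angle x c) else x \<le> c)" for x \<phi>
  proof (cases "0 < \<phi> \<and> \<phi> < pi")
    case True then show ?thesis by (simp only: hit_le_iff if_True simp_thms)
  next
    case False then show ?thesis by (simp only: hit_def if_False)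
  qed
  show "{p \<in> space M. hit (u p) (v p) \<le> c} \<in> sets M"
    unfolding pointwise by measurable
qed


section \<open>The billiard step in terms of angles\<close>

lemma vderivs_g: "vderivs 1 g = t"
  using g_deriv by (auto simp: vector_derivative_at)

text \<open>Reflection in the tangent keeps the tangential component of the direction, so \<psi> is
  the angle of the incoming direction at \<open>g y\<close>. \<open>angle y x\<close> is measured
  with the chord pointing back to \<open>g x\<close>, hence the supplement. Conversely the open
  chord lies inside, so the ray cannot hit the curve earlier.\<close>

lemma billiard_step_iff:
  "billiard_step g P (x, \<phi>) (y, \<psi>) \<longleftrightarrow> g x \<noteq> g y \<and> \<phi> = angle x y \<and> \<psi> = pi - angle y x"
proof -
  have tt: "t y * cnj (t y) = 1" for y
    by (rule complex_eqI) (simp_all add: t_components)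
  have refl: "Re (cnj (t y) * ((t y)\<^sup>2 * cnj d)) = Re (cnj (t y) * d)" for y d
  proof -
    have "cnj (t y) * ((t y)\<^sup>2 * cnj d) = (t y * cnj (t y)) * (t y * cnj d)" by (simp only: power2_eq_square mult_ac)
    also have "\<dots> = t y * cnj d" by (simp only: tt mult_1_left)
    finally have eq: "cnj (t y) * ((t y)\<^sup>2 * cnj d) = t y * cnj d" .
    show ?thesis unfolding eq by simp
  qed
  show ?thesis
  proof
    assume "billiard_step g P (x, \<phi>) (y, \<psi>)"
    then obtain r d where b: "0 < \<phi>" "\<phi> < pi" "0 < \<psi>" "\<psi> < pi" "r > 0" "norm d = 1"
      "Re (cnj (t x) * d) = cos \<phi>" "g y = g x + of_real r * d" "Re (cnj (t y) * d) = cos \<psi>"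
      unfolding billiard_step_def Let_def vderivs_g refl by auto
    have ne: "g x \<noteq> g y" using b by auto
    have r: "chordL g x y = r" using b by (simp add: chordL_def dist_norm norm_minus_commute norm_mult)
    have v: "g y - g x = of_real r * d" using b by simp
    have "along x y = r * Re (cnj (t x) * d)" unfolding along_def v by (simp add: algebra_simps)
    then have "cos (angle x y) = cos \<phi>" using b by (simp add: sin_cos_angle[OF ne] r)
    then have 1: "\<phi> = angle x y" using cos_inj_pi[of "angle x y" \<phi>] angle_bounds[of x y] b by auto
    have v': "g x - g y = - of_real r * d" using b by simp
    have "along y x = - r * Re (cnj (t y) * d)" unfolding along_def v' by (simp add: algebra_simps)
    then have "cos (angle y x) = - cos \<psi>" using b sin_cos_angle(2)[OF ne[symmetric]] by (simp add: r chord_commute[of y x])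
    then have "cos (pi - angle y x) = cos \<psi>" by simp
    then have "\<psi> = pi - angle y x" using cos_inj_pi[of "pi - angle y x" \<psi>] angle_bounds[of y x] b by auto
    with 1 ne show "g x \<noteq> g y \<and> \<phi> = angle x y \<and> \<psi> = pi - angle y x" by blast
  next
    assume "g x \<noteq> g y \<and> \<phi> = angle x y \<and> \<psi> = pi - angle y x"
    then have ne: "g x \<noteq> g y" and a: "\<phi> = angle x y" "\<psi> = pi - angle y x" by auto
    define r where "r = chordL g x y"
    define d where "d = (g y - g x) / of_real r"
    have r: "0 < r" using chord_pos[OF ne] by (simp add: r_def)
    have nd: "norm d = 1" using r by (simp add: d_def norm_divide r_def chordL_def dist_norm norm_minus_commute)
    have gy: "g y = g x + of_real r * d" using r by (simp add: d_def)
    have c1: "Re (cnj (t x) * d) = cos \<phi>"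
      using r by (simp add: a sin_cos_angle[OF ne] d_def along_def r_def Re_divide_of_real[symmetric] del: Re_divide_of_real)
    have c2: "Re (cnj (t y) * d) = cos \<psi>"
    proof -
      have "cos \<psi> = - along y x / r" using sin_cos_angle(2)[OF ne[symmetric]] by (simp add: a r_def chord_commute[of y x])
      also have "- along y x = Re (cnj (t y) * (g y - g x))" by (simp add: along_def algebra_simps)
      also have "\<dots> / r = Re (cnj (t y) * d)" unfolding d_def by (simp add: Re_divide_of_real[symmetric] del: Re_divide_of_real)
      finally show ?thesis by simp
    qed
    have seg: "g x + of_real s * d \<in> inside (curve_image g P)" if "s \<in> {0<..<r}" for s
    proof -
      have "g x + of_real s * d = (1 - s / r) *\<^sub>R g x + (s / r) *\<^sub>R g y"
        using r by (simp add: gy scaleR_conv_of_real field_simps)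
      moreover have "0 < s / r" "s / r < 1" using that r by auto
      ultimately have "g x + of_real s * d \<in> open_segment (g x) (g y)"
        using ne by (auto simp: in_segment)
      then show ?thesis using chord_inside[OF ne] by (auto simp: curve_image_def)
    qed
    show "billiard_step g P (x, \<phi>) (y, \<psi>)"
      unfolding billiard_step_def Let_def vderivs_g refl fst_conv snd_conv
      using angle_bounds[of x y] angle_bounds[of y x] r nd c1 c2 seg gy by (auto simp: a)
  qed
qed


text \<open>If the tangent turned by more than \<open>2 pi\<close> along one period, two distinct points of the curve
  would have the same oriented tangent, and each would lie strictly on the inner side of the other.\<close>
lemma total_curvature_le:
  "integral {0..P} k \<le> 2 * pi"
proof (rule ccontr)
  assume neg: "\<not> ?thesis"
  define K where "K x = integral {0..x} k" for x
  have ck: "continuous_on {0..P} k" using k_cont by (rule continuous_on_subset) auto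
  have K': "(K has_vector_derivative k x) (at x within {0..P})" if "x \<in> {0..P}" for x
    unfolding K_def using integral_has_vector_derivative[OF ck that] .
  have cK: "continuous_on {0..P} K"
    unfolding continuous_on_eq_continuous_within by (intro ballI has_vector_derivative_continuous[OF K'])
  obtain z where z: "0 \<le> z" "z \<le> P" "K z = 2 * pi"
    using IVT'[of K 0 "2 * pi" P] neg P_pos cK by (auto simp: K_def)
  have "z \<noteq> 0" "z \<noteq> P" using z(3) neg by (auto simp: K_def)
  with z have z': "0 < z" "z < P" by auto
  \<comment> \<open>The exponential is the integrating factor of the equation for \<open>t\<close>,
    so \<open>f\<close> is constant; at \<open>z\<close>, where the total turning is exactly 2 pi,
    the factor is 1 and the tangent is that at 0.\<close>
  define f where "f x = t x * exp (- (of_real (\<sigma> * K x) * \<i>))" for x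
  have f': "(f has_derivative (\<lambda>_. 0)) (at x within {0..P})" if "x \<in> {0..P}" for x
  proof -
    have inner: "((\<lambda>x. - (of_real (\<sigma> * K x) * \<i>)) has_vector_derivative - (of_real (\<sigma> * k x) * \<i>)) (at x within {0..P})"
      using K'[OF that] by (auto intro!: derivative_eq_intros simp: has_real_derivative_iff_has_vector_derivative)
    have "((\<lambda>x. exp (- (of_real (\<sigma> * K x) * \<i>))) has_vector_derivative
        - (of_real (\<sigma> * k x) * \<i>) * exp (- (of_real (\<sigma> * K x) * \<i>))) (at x within {0..P})"
      using field_vector_diff_chain_within[OF inner DERIV_subset[OF DERIV_exp]] by (simp add: o_def)
    then have "(f has_vector_derivative t x * (- (of_real (\<sigma> * k x) * \<i>) * exp (- (of_real (\<sigma> * K x) * \<i>)))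
       + of_real (\<sigma> * k x) * \<i> * t x * exp (- (of_real (\<sigma> * K x) * \<i>))) (at x within {0..P})"
      unfolding f_def by (intro has_vector_derivative_mult has_vector_derivative_at_within[OF t_deriv])
    then have "(f has_vector_derivative 0) (at x within {0..P})" by (simp add: mult_ac)
    then show ?thesis by (simp add: has_vector_derivative_def)
  qed
  obtain c where c: "\<And>x. x \<in> {0..P} \<Longrightarrow> f x = c"
    using has_derivative_zero_constant[OF convex_real_interval(5) f'] by blast
  have e1: "exp (- (of_real (\<sigma> * (2 * pi)) * \<i>)) = (1 :: complex)"
  proof -
    have "\<sigma> = 1 \<or> \<sigma> = -1" using sigma by (simp add: square_eq_1_iff)
    then show ?thesis
      using exp_two_pi_i exp_minus[of "2 * of_real pi * \<i>"] by (auto simp: mult_ac)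
  qed
  have "f z = t z" using e1 unfolding f_def z(3) by simp
  moreover have "f 0 = t 0" by (simp add: f_def K_def)
  ultimately have tz: "t z = t 0" using c[of z] c[of 0] z P_pos by simp
  have ne: "g 0 \<noteq> g z" using g_neq[of 0 z] z' by simp
  have "0 < height 0 z" "0 < height z 0" using height_pos ne by auto
  moreover have "height z 0 = - height 0 z" by (simp add: height_def tz algebra_simps)
  ultimately show False by simp
qed


section \<open>The second variation of the length\<close>

text \<open>The second derivative at \<open>e = 0\<close> of the length of the chord between the
  parameters \<open>x + e * \<xi>\<close> and \<open>y + e * \<eta>\<close>. Both angles are
  measured from the chord leaving its own endpoint, so the mixed coefficient is positive.\<close>

definition second_var :: "real \<Rightarrow> real \<Rightarrow> real \<Rightarrow> real \<Rightarrow> real" where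
  "second_var x y \<xi> \<eta> = (\<xi> * sin (angle x y) + \<eta> * sin (angle y x))\<^sup>2 / chordL g x y
     - \<xi>\<^sup>2 * k x * sin (angle x y) - \<eta>\<^sup>2 * k y * sin (angle y x)"

lemma g_affine_deriv:
  "((\<lambda>e. g (z + e * \<zeta>)) has_vector_derivative of_real \<zeta> * t (z + e * \<zeta>)) (at e)"
proof -
  have "((\<lambda>e. z + e * \<zeta>) has_vector_derivative \<zeta>) (at e)"
    by (auto intro!: derivative_eq_intros)
  from vector_diff_chain_at[OF this g_deriv] show ?thesis by (simp add: o_def scaleR_conv_of_real)
qed

lemma chord_along_deriv:
  fixes x y \<xi> \<eta> :: real
  defines "D \<equiv> \<lambda>e. g (y + e * \<eta>) - g (x + e * \<xi>)"
    and "D' \<equiv> \<lambda>e. of_real \<eta> * t (y + e * \<eta>) - of_real \<xi> * t (x + e * \<xi>)"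
  assumes ne: "g (x + e * \<xi>) \<noteq> g (y + e * \<eta>)"
  shows "((\<lambda>e. chordL g (x + e * \<xi>) (y + e * \<eta>)) has_real_derivative
     (Re (D e) * Re (D' e) + Im (D e) * Im (D' e)) / chordL g (x + e * \<xi>) (y + e * \<eta>)) (at e)"
proof -
  have Dd: "(D has_vector_derivative D' e) (at e)"
    unfolding D_def D'_def by (intro has_vector_derivative_diff g_affine_deriv)
  have re: "((\<lambda>e. Re (D e)) has_real_derivative Re (D' e)) (at e)"
    and im: "((\<lambda>e. Im (D e)) has_real_derivative Im (D' e)) (at e)"
    unfolding has_real_derivative_iff_has_vector_derivative by (intro Re_deriv Im_deriv Dd)+
  have ch: "chordL g (x + e * \<xi>) (y + e * \<eta>) = sqrt ((Re (D e))\<^sup>2 + (Im (D e))\<^sup>2)" for e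
    by (simp add: chordL_def dist_commute[of "g (x + e * \<xi>)"] dist_norm D_def cmod_def power2_commute)
  have pos: "0 < (Re (D e))\<^sup>2 + (Im (D e))\<^sup>2"
  proof -
    have "D e \<noteq> 0" using ne by (simp add: D_def)
    then show ?thesis by (simp add: complex_neq_0[symmetric])
  qed
  have q: "((\<lambda>e. (Re (D e))\<^sup>2 + (Im (D e))\<^sup>2) has_real_derivative
      2 * (Re (D e) * Re (D' e) + Im (D e) * Im (D' e))) (at e)"
    by (rule DERIV_cong[OF DERIV_add[OF DERIV_power[OF re, of 2] DERIV_power[OF im, of 2]]]) simp
  have "((\<lambda>e. sqrt ((Re (D e))\<^sup>2 + (Im (D e))\<^sup>2)) has_real_derivative
      inverse (sqrt ((Re (D e))\<^sup>2 + (Im (D e))\<^sup>2)) / 2 * (2 * (Re (D e) * Re (D' e) + Im (D e) * Im (D' e)))) (at e)"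
    using DERIV_real_sqrt[OF pos] q by (rule DERIV_chain2)
  then have d1: "((\<lambda>e. chordL g (x + e * \<xi>) (y + e * \<eta>)) has_real_derivative
      inverse (sqrt ((Re (D e))\<^sup>2 + (Im (D e))\<^sup>2)) / 2 * (2 * (Re (D e) * Re (D' e) + Im (D e) * Im (D' e)))) (at e)"
    by (simp only: ch)
  have "inverse s / 2 * (2 * n) = n / s" for s n :: real by (simp add: field_simps)
  with d1 show ?thesis by (simp only: ch)
qed

text \<open>For L = |D| one has L'' = (|D'|^2 - (L')^2) / L + <D, D''> / L. The first part is the
  squared speed normal to the chord over L and gives the square in \<open>second_var\<close>; the
  second contains the accelerations and gives the curvature terms.\<close>

lemma chord_second_deriv:
  fixes x y \<xi> \<eta> :: real
  defines "D \<equiv> \<lambda>e. g (y + e * \<eta>) - g (x + e * \<xi>)"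
    and "D' \<equiv> \<lambda>e. of_real \<eta> * t (y + e * \<eta>) - of_real \<xi> * t (x + e * \<xi>)"
  assumes ne: "g x \<noteq> g y"
  shows "((\<lambda>e. (Re (D e) * Re (D' e) + Im (D e) * Im (D' e)) / chordL g (x + e * \<xi>) (y + e * \<eta>))
     has_real_derivative second_var x y \<xi> \<eta>) (at 0)"
proof -
  define h where "h e = chordL g (x + e * \<xi>) (y + e * \<eta>)" for e
  have td: "((\<lambda>e. of_real \<zeta> * t (z + e * \<zeta>)) has_vector_derivative
      of_real \<zeta> * (of_real \<zeta> * (of_real (\<sigma> * k (z + e * \<zeta>)) * \<i> * t (z + e * \<zeta>)))) (at e)" for z \<zeta> e
  proof -
    have "((\<lambda>e. z + e * \<zeta>) has_vector_derivative \<zeta>) (at e)"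
      by (auto intro!: derivative_eq_intros)
    from vector_diff_chain_at[OF this t_deriv]
    have "((\<lambda>e. t (z + e * \<zeta>)) has_vector_derivative
        of_real \<zeta> * (of_real (\<sigma> * k (z + e * \<zeta>)) * \<i> * t (z + e * \<zeta>))) (at e)"
      by (simp add: o_def scaleR_conv_of_real)
    then show ?thesis by (rule has_vector_derivative_mult_right)
  qed
  define D2 where "D2 = of_real \<eta> * (of_real \<eta> * (of_real (\<sigma> * k y) * \<i> * t y))
    - of_real \<xi> * (of_real \<xi> * (of_real (\<sigma> * k x) * \<i> * t x))"
  have Dd: "(D has_vector_derivative D' 0) (at 0)"
    unfolding D_def D'_def by (intro has_vector_derivative_diff g_affine_deriv)
  have D'd: "(D' has_vector_derivative D2) (at 0)"
    using has_vector_derivative_diff[OF td[of \<eta> y 0] td[of \<xi> x 0]] by (simp add: D'_def D2_def)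
  have re: "((\<lambda>e. Re (D e)) has_real_derivative Re (D' 0)) (at 0)"
    and im: "((\<lambda>e. Im (D e)) has_real_derivative Im (D' 0)) (at 0)"
    and re': "((\<lambda>e. Re (D' e)) has_real_derivative Re D2) (at 0)"
    and im': "((\<lambda>e. Im (D' e)) has_real_derivative Im D2) (at 0)"
    unfolding has_real_derivative_iff_has_vector_derivative by (intro Re_deriv Im_deriv Dd D'd)+
  define N where "N = Re (D 0) * Re (D' 0) + Im (D 0) * Im (D' 0)"
  have hd: "(h has_real_derivative N / h 0) (at 0)"
    using chord_along_deriv[of x 0 \<xi> y \<eta>] ne by (simp add: h_def[abs_def] N_def D_def D'_def)
  define L where "L = chordL g x y"
  have L: "0 < L" "h 0 = L" using chord_pos[OF ne] by (auto simp: L_def h_def)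
  define E where "E = (Re (D' 0))\<^sup>2 + (Im (D' 0))\<^sup>2"
  define F where "F = Re (D 0) * Re D2 + Im (D 0) * Im D2"
  have "((\<lambda>e. (Re (D e) * Re (D' e) + Im (D e) * Im (D' e)) / h e)
     has_real_derivative ((E + F) * L - N * (N / L)) / (L * L)) (at 0)"
    by (rule derivative_eq_intros re im re' im' hd refl)+
       (use L in \<open>auto simp: E_def F_def N_def power2_eq_square algebra_simps\<close>)
  also have "((E + F) * L - N * (N / L)) / (L * L) = second_var x y \<xi> \<eta>"
  proof -
    define B B' where "B = height x y" and "B' = height y x"
    have s: "sin (angle x y) = B / L" "sin (angle y x) = B' / L"
      using sin_cos_angle(1)[OF ne] sin_cos_angle(1)[OF ne[symmetric]]
      by (simp_all add: L_def B_def B'_def chord_commute)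
    have D0: "D 0 = g y - g x" by (simp add: D_def)
    have D'0: "D' 0 = of_real \<eta> * t y - of_real \<xi> * t x" by (simp add: D'_def)
    have L2: "L * L = (Re (D 0))\<^sup>2 + (Im (D 0))\<^sup>2"
    proof -
      have "L = norm (D 0)" by (simp add: L_def chordL_def dist_norm D0 norm_minus_commute)
      then show ?thesis by (simp add: power2_eq_square[symmetric] cmod_power2)
    qed
    \<comment> \<open>The cross product of the chord vector and its velocity. By Lagrange's identity
      |D|^2 |D'|^2 exceeds the squared inner product \<open>N\<close> by the square of
      \<open>c\<close>, which up to the sign \<sigma> is a combination of heights.\<close>
    define c where "c = Re (D 0) * Im (D' 0) - Im (D 0) * Re (D' 0)"
    have c: "\<sigma> * c = \<xi> * B + \<eta> * B'"
      by (simp add: c_def D0 D'0 B_def B'_def height_def algebra_simps)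
    have "E * (L * L) = N\<^sup>2 + c\<^sup>2"
      unfolding E_def L2 N_def c_def by (simp add: power2_eq_square algebra_simps)
    also have "c\<^sup>2 = (\<sigma> * \<sigma>) * c\<^sup>2" by (simp add: sigma)
    also have "\<dots> = (\<sigma> * c)\<^sup>2" by (simp add: power2_eq_square)
    finally have E: "E * (L * L) = N\<^sup>2 + (\<xi> * B + \<eta> * B')\<^sup>2" unfolding c .
    have F: "F = - \<xi>\<^sup>2 * k x * B - \<eta>\<^sup>2 * k y * B'"
      by (simp add: F_def D0 D2_def B_def B'_def height_def power2_eq_square algebra_simps)
    have "((E + F) * L - N * (N / L)) / (L * L) = (E * (L * L) - N\<^sup>2) / (L * L * L) + F / L"
      using L by (simp add: field_simps power2_eq_square)
    also have "\<dots> = second_var x y \<xi> \<eta>"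
      unfolding E F second_var_def s L_def[symmetric] using L
      by (simp add: field_simps power2_eq_square)
    finally show ?thesis .
  qed
  finally show ?thesis by (simp add: h_def)
qed

text \<open>The outer \<open>deriv\<close> needs the first derivative on a whole neighbourhood of 0.
  It exists there because finitely many chords stay nondegenerate for small
  \<open>e\<close>.\<close>

lemma second_variation:
  fixes xs :: "int \<Rightarrow> real" and \<xi> :: "int \<Rightarrow> real"
  assumes ne: "\<And>n. g (xs n) \<noteq> g (xs (n + 1))"
  shows "deriv (deriv (\<lambda>e. \<Sum>n\<in>{M..<N}. chordL g (xs n + e * \<xi> n) (xs (n + 1) + e * \<xi> (n + 1)))) 0
    = (\<Sum>n\<in>{M..<N}. second_var (xs n) (xs (n + 1)) (\<xi> n) (\<xi> (n + 1)))"
proof -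
  define D where "D n e = g (xs (n + 1) + e * \<xi> (n + 1)) - g (xs n + e * \<xi> n)" for n e
  define D' where "D' n e = of_real (\<xi> (n + 1)) * t (xs (n + 1) + e * \<xi> (n + 1)) - of_real (\<xi> n) * t (xs n + e * \<xi> n)" for n e
  define h where "h n e = chordL g (xs n + e * \<xi> n) (xs (n + 1) + e * \<xi> (n + 1))" for n e
  define h1 where "h1 n e = (Re (D n e) * Re (D' n e) + Im (D n e) * Im (D' n e)) / h n e" for n e
  have "\<forall>\<^sub>F e in nhds 0. D n e \<noteq> 0" for n
  proof -
    have "continuous_on UNIV (D n)"
      unfolding D_def by (intro continuous_intros continuous_on_compose2[OF cont_g[of UNIV]]) auto
    then have "open {e. D n e \<noteq> 0}"
      by (intro open_Collect_neq) (auto intro: continuous_on_const)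
    moreover have "0 \<in> {e. D n e \<noteq> 0}" using ne[of n] by (simp add: D_def)
    ultimately show ?thesis using eventually_nhds by blast
  qed
  then have "\<forall>\<^sub>F e in nhds 0. \<forall>n\<in>{M..<N}. D n e \<noteq> 0"
    by (intro eventually_ball_finite) auto
  then have "\<forall>\<^sub>F e in nhds 0. deriv (\<lambda>e. \<Sum>n\<in>{M..<N}. h n e) e = (\<Sum>n\<in>{M..<N}. h1 n e)"
  proof eventually_elim
    case (elim e)
    have "((\<lambda>e. \<Sum>n\<in>{M..<N}. h n e) has_real_derivative (\<Sum>n\<in>{M..<N}. h1 n e)) (at e)"
    proof (rule DERIV_sum)
      fix n assume "n \<in> {M..<N}"
      then have "D n e \<noteq> 0" using elim by blast
      then have "g (xs n + e * \<xi> n) \<noteq> g (xs (n + 1) + e * \<xi> (n + 1))" by (auto simp: D_def)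
      from chord_along_deriv[OF this] show "(h n has_real_derivative h1 n e) (at e)"
        by (simp add: h_def[abs_def] h1_def D_def D'_def)
    qed
    then show ?case by (rule DERIV_imp_deriv)
  qed
  then have "deriv (deriv (\<lambda>e. \<Sum>n\<in>{M..<N}. h n e)) 0 = deriv (\<lambda>e. \<Sum>n\<in>{M..<N}. h1 n e) 0"
    by (intro deriv_cong_ev) auto
  also have "((\<lambda>e. \<Sum>n\<in>{M..<N}. h1 n e) has_real_derivative
      (\<Sum>n\<in>{M..<N}. second_var (xs n) (xs (n + 1)) (\<xi> n) (\<xi> (n + 1)))) (at 0)"
    unfolding h1_def h_def D_def D'_def
    by (intro DERIV_sum chord_second_deriv ne)
  then have "deriv (\<lambda>e. \<Sum>n\<in>{M..<N}. h1 n e) 0 = (\<Sum>n\<in>{M..<N}. second_var (xs n) (xs (n + 1)) (\<xi> n) (\<xi> (n + 1)))"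
    by (rule DERIV_imp_deriv)
  finally show ?thesis by (simp add: h_def)
qed

definition quad_form :: "(int \<Rightarrow> real) \<Rightarrow> int \<Rightarrow> int \<Rightarrow> (int \<Rightarrow> real) \<Rightarrow> real" where
  "quad_form xs M N \<xi> = (\<Sum>n\<in>{M..<N}. second_var (xs n) (xs (n + 1)) (\<xi> n) (\<xi> (n + 1)))"

lemma m_configuration_quad_form:
  assumes "\<And>n. g (xs n) \<noteq> g (xs (n + 1))"
  shows "m_configuration g xs \<longleftrightarrow> (\<forall>M N \<xi>. M < N \<longrightarrow> (\<forall>n. n \<le> M \<or> N \<le> n \<longrightarrow> \<xi> n = 0) \<longrightarrow>
    (\<exists>n. \<xi> n \<noteq> 0) \<longrightarrow> quad_form xs M N \<xi> < 0)"
  unfolding m_configuration_def second_variation[of xs, OF assms] quad_form_def by blast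

lemma second_var_scale: "second_var x y (c * \<xi>) (c * \<eta>) = c\<^sup>2 * second_var x y \<xi> \<eta>"
proof -
  have lin: "c * \<xi> * sin (angle x y) + c * \<eta> * sin (angle y x) = c * (\<xi> * sin (angle x y) + \<eta> * sin (angle y x))"
    by (simp add: algebra_simps)
  show ?thesis unfolding second_var_def lin power_mult_distrib by (simp add: algebra_simps)
qed

lemma second_var_0: "second_var x y 0 0 = 0"
  by (simp add: second_var_def)

lemma quad_form_enlarge:
  assumes "M' \<le> M" "N \<le> N'" "\<And>n. n \<le> M \<or> N \<le> n \<Longrightarrow> \<xi> n = 0"
  shows "quad_form xs M' N' \<xi> = quad_form xs M N \<xi>"
  unfolding quad_form_def
  by (rule sum.mono_neutral_right) (use assms in \<open>auto simp: second_var_0\<close>)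

text \<open>An integer list read as a sequence supported strictly between - m and m; lists are taken
  because they form a countable type. Beyond the end of a short list the entries are still some
  integers, which is harmless since all of them give admissible test vectors.\<close>

definition test_seq :: "nat \<Rightarrow> int list \<Rightarrow> int \<Rightarrow> real" where
  "test_seq m l n = (if - int m < n \<and> n < int m then of_int (l ! nat (n + int m)) else 0)"

text \<open>Semidefiniteness on all segments already gives definiteness: a null vector can be prolonged by one
  entry to a vector on which the form is positive, because the mixed second derivative of the chord
  length does not vanish. By homogeneity and continuity it suffices to test countably many integer vectors,
  which makes the condition measurable.\<close>
lemma m_configuration_iff_test_seq:
  assumes ne: "\<And>n. g (xs n) \<noteq> g (xs (n + 1))"
  shows "m_configuration g xs \<longleftrightarrow> (\<forall>m l. quad_form xs (- int m) (int m) (test_seq m l) \<le> 0)"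
proof
  assume m: "m_configuration g xs"
  show "\<forall>m l. quad_form xs (- int m) (int m) (test_seq m l) \<le> 0"
  proof (intro allI)
    fix m l
    show "quad_form xs (- int m) (int m) (test_seq m l) \<le> 0"
    proof (cases "\<exists>n. test_seq m l n \<noteq> 0")
      case True
      then have "- int m < int m" by (auto simp: test_seq_def split: if_splits)
      moreover have "\<forall>n. n \<le> - int m \<or> int m \<le> n \<longrightarrow> test_seq m l n = 0" by (auto simp: test_seq_def)
      ultimately show ?thesis using m True unfolding m_configuration_quad_form[of xs, OF ne] by (blast intro: less_imp_le)
    qed (auto simp: quad_form_def second_var_0)
  qed
next
  assume t: "\<forall>m l. quad_form xs (- int m) (int m) (test_seq m l) \<le> 0"
  have semi: "quad_form xs (- int m) (int m) \<xi> \<le> 0"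
    if supp: "\<And>n. n \<le> - int m \<or> int m \<le> n \<Longrightarrow> \<xi> n = 0" for m \<xi>
  proof -
    \<comment> \<open>Rational approximations with common denominator j + 1; they keep the support
      of \<xi> and are multiples of integer test vectors.\<close>
    define \<zeta> where "\<zeta> j n = of_int \<lfloor>real (Suc j) * \<xi> n\<rfloor> / real (Suc j)" for j n
    have lim: "(\<lambda>j. \<zeta> j n) \<longlonglongrightarrow> \<xi> n" for n
    proof (rule tendsto_sandwich)
      have "(\<lambda>j. \<xi> n - 1 / real (Suc j)) \<longlonglongrightarrow> \<xi> n - 0"
        by (intro tendsto_intros LIMSEQ_Suc[OF lim_1_over_n])
      then show "(\<lambda>j. \<xi> n - 1 / real (Suc j)) \<longlonglongrightarrow> \<xi> n" by simp
      show "\<forall>\<^sub>F j in sequentially. \<xi> n - 1 / real (Suc j) \<le> \<zeta> j n"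
      proof (intro always_eventually allI)
        fix j
        have "real (Suc j) * \<xi> n - 1 \<le> of_int \<lfloor>real (Suc j) * \<xi> n\<rfloor>" by linarith
        then have "(real (Suc j) * \<xi> n - 1) / real (Suc j) \<le> \<zeta> j n"
          unfolding \<zeta>_def by (intro divide_right_mono) auto
        then show "\<xi> n - 1 / real (Suc j) \<le> \<zeta> j n" by (simp add: diff_divide_distrib)
      qed
      show "\<forall>\<^sub>F j in sequentially. \<zeta> j n \<le> \<xi> n"
      proof (intro always_eventually allI)
        fix j
        have "\<zeta> j n \<le> (real (Suc j) * \<xi> n) / real (Suc j)"
          unfolding \<zeta>_def by (intro divide_right_mono) auto
        then show "\<zeta> j n \<le> \<xi> n" by simp
      qed
    qed auto
    have nonpos: "quad_form xs (- int m) (int m) (\<zeta> j) \<le> 0" for j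
    proof -
      define l where "l = map (\<lambda>i. \<lfloor>real (Suc j) * \<xi> (int i - int m)\<rfloor>) [0..<2 * m]"
      have eq: "\<zeta> j n = (1 / real (Suc j)) * test_seq m l n" for n
      proof (cases "- int m < n \<and> n < int m")
        case True
        then have "nat (n + int m) < 2 * m" by auto
        then have "l ! nat (n + int m) = \<lfloor>real (Suc j) * \<xi> n\<rfloor>" using True by (simp add: l_def)
        then show ?thesis using True by (simp add: \<zeta>_def test_seq_def)
      next
        case False
        then show ?thesis using supp[of n] by (auto simp: \<zeta>_def test_seq_def)
      qed
      have "quad_form xs (- int m) (int m) (\<zeta> j) = (1 / real (Suc j))\<^sup>2 * quad_form xs (- int m) (int m) (test_seq m l)"
        unfolding quad_form_def eq second_var_scale sum_distrib_left ..
      also have "\<dots> \<le> 0" using t by (intro mult_nonneg_nonpos) auto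
      finally show ?thesis .
    qed
    have "(\<lambda>j. quad_form xs (- int m) (int m) (\<zeta> j)) \<longlonglongrightarrow> quad_form xs (- int m) (int m) \<xi>"
      unfolding quad_form_def second_var_def divide_inverse by (intro tendsto_intros lim)
    then show ?thesis using nonpos by (intro LIMSEQ_le_const2) auto
  qed
  show "m_configuration g xs"
    unfolding m_configuration_quad_form[of xs, OF ne]
  proof (intro allI impI, rule ccontr)
    fix M N :: int and \<xi> assume "M < N" and supp: "\<forall>n. n \<le> M \<or> N \<le> n \<longrightarrow> \<xi> n = 0"
      and nz: "\<exists>n. \<xi> n \<noteq> 0" and "\<not> quad_form xs M N \<xi> < 0"
    then have nonneg: "0 \<le> quad_form xs M N \<xi>" by simp
    have fin: "finite {n. \<xi> n \<noteq> 0}"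
      by (rule finite_subset[of _ "{M..N}"]) (use supp in \<open>auto, metis linear, metis linear\<close>)
    \<comment> \<open>The entry after the last nonzero one is the one to be varied.\<close>
    define j where "j = Max {n. \<xi> n \<noteq> 0}"
    have j: "\<xi> j \<noteq> 0" "\<And>n. j < n \<Longrightarrow> \<xi> n = 0"
      using Max_in[OF fin] Max_ge[OF fin] nz unfolding j_def by (auto simp: not_le[symmetric])
    have jN: "M < j" "j < N" using j(1) supp by (meson not_le)+
    \<comment> \<open>Large enough that the symmetric segment contains the chords \<open>j\<close>
      and \<open>j + 1\<close> and leaves room for the new entry at \<open>j + 1\<close>.\<close>
    define m where "m = nat (\<bar>M\<bar> + \<bar>N\<bar> + 2)"
    have m: "- int m < M" "N + 1 < int m" by (auto simp: m_def)
    define s s' L where "s = sin (angle (xs j) (xs (j + 1)))" and "s' = sin (angle (xs (j + 1)) (xs j))"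
      and "L = chordL g (xs j) (xs (j + 1))"
    have pos: "0 < s" "0 < s'" "0 < L"
      using ne[of j] angle_bounds by (auto simp: s_def s'_def L_def intro!: sin_gt_zero chord_pos)
    define C where "C = s'\<^sup>2 / L - k (xs (j + 1)) * s' + second_var (xs (j + 1)) (xs (j + 1 + 1)) 1 0"
    \<comment> \<open>Changing entry \<open>j + 1\<close> from 0 to \<open>e\<close> affects only
      the chords \<open>j\<close> and \<open>j + 1\<close>. The term linear in \<open>e\<close> is
      the mixed term of chord \<open>j\<close>; since the form was nonnegative before the change and
      is nonpositive after it, that term must vanish.\<close>
    have "2 * e * (s * s' * \<xi> j / L) + e\<^sup>2 * C \<le> 0" for e
    proof -
      define \<eta> where "\<eta> = \<xi>(j + 1 := e)"
      let ?f = "\<lambda>n. second_var (xs n) (xs (n + 1)) (\<eta> n) (\<eta> (n + 1)) - second_var (xs n) (xs (n + 1)) (\<xi> n) (\<xi> (n + 1))"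
      have "quad_form xs (- int m) (int m) \<eta> - quad_form xs (- int m) (int m) \<xi> = sum ?f {- int m..<int m}"
        unfolding quad_form_def by (rule sum_subtractf[symmetric])
      also have "\<dots> = sum ?f {j, j + 1}"
        by (rule sum.mono_neutral_right) (use jN m in \<open>auto simp: \<eta>_def\<close>)
      also have "\<dots> = ?f j + ?f (j + 1)" by simp
      also have "?f j = second_var (xs j) (xs (j + 1)) (\<xi> j) e - second_var (xs j) (xs (j + 1)) (\<xi> j) 0"
        using j(2)[of "j + 1"] by (simp add: \<eta>_def)
      also have "\<dots> = 2 * e * (s * s' * \<xi> j / L) + e\<^sup>2 * (s'\<^sup>2 / L - k (xs (j + 1)) * s')"
        using pos unfolding second_var_def s_def[symmetric] s'_def[symmetric] L_def[symmetric]
        by (simp add: field_simps power2_eq_square)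
      also have "?f (j + 1) = e\<^sup>2 * second_var (xs (j + 1)) (xs (j + 1 + 1)) 1 0"
        using j(2)[of "j + 1"] j(2)[of "j + 2"] second_var_scale[of "xs (j + 1)" "xs (j + 2)" e 1 0]
        by (simp add: \<eta>_def second_var_0 add.commute[of 2 j])
      finally have "quad_form xs (- int m) (int m) \<eta> - quad_form xs (- int m) (int m) \<xi> = 2 * e * (s * s' * \<xi> j / L) + e\<^sup>2 * C"
        by (simp add: C_def algebra_simps)
      moreover have "quad_form xs (- int m) (int m) \<eta> \<le> 0"
        by (rule semi) (use supp m jN in \<open>auto simp: \<eta>_def\<close>)
      moreover have "quad_form xs (- int m) (int m) \<xi> = quad_form xs M N \<xi>"
        by (rule quad_form_enlarge) (use supp m in auto)
      ultimately show ?thesis using nonneg by linarith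
    qed
    then have "s * s' * \<xi> j / L = 0" by (rule quadratic_nonpos_imp_linear_coeff_0)
    then show False using pos j(1) by simp
  qed
qed


section \<open>The billiard map\<close>

definition billiard_map :: "real \<times> real \<Rightarrow> real \<times> real" where
  "billiard_map p = (red (hit (fst p) (snd p)), pi - angle (hit (fst p) (snd p)) (fst p))"

text \<open>Time reversal: the ray that retraces the incoming path leaves under the supplementary
  angle. Conjugating the billiard map with it yields the inverse map.\<close>

definition flip :: "real \<times> real \<Rightarrow> real \<times> real" where
  "flip p = (fst p, pi - snd p)"

definition inv_map :: "real \<times> real \<Rightarrow> real \<times> real" where
  "inv_map p = flip (billiard_map (flip p))"

definition orb :: "real \<times> real \<Rightarrow> int \<Rightarrow> real \<times> real" where
  "orb p n = (if 0 \<le> n then (billiard_map ^^ nat n) p else (inv_map ^^ nat (- n)) p)"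

abbreviation \<Omega> :: "(real \<times> real) set" where "\<Omega> \<equiv> phase_space P"

lemma phase_space_iff: "p \<in> \<Omega> \<longleftrightarrow> 0 \<le> fst p \<and> fst p < P \<and> 0 < snd p \<and> snd p < pi"
  by (cases p) (auto simp: phase_space_def)

lemma flip_phase_space: "p \<in> \<Omega> \<Longrightarrow> flip p \<in> \<Omega>"
  by (auto simp: phase_space_iff flip_def)

lemma flip_flip: "flip (flip p) = p"
  by (simp add: flip_def)

lemma billiard_map_phase_space: "billiard_map p \<in> \<Omega>"
  using red_bounds angle_bounds by (auto simp: phase_space_iff billiard_map_def)

lemma step_iff:
  "billiard_step g P p q \<longleftrightarrow> g (fst p) \<noteq> g (fst q) \<and> snd p = angle (fst p) (fst q) \<and> snd q = pi - angle (fst q) (fst p)"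
  using billiard_step_iff[of "fst p" "snd p" "fst q" "snd q"] by simp

lemma step_billiard_map: "p \<in> \<Omega> \<Longrightarrow> billiard_step g P p (billiard_map p)"
  using hitD[of "snd p" "fst p"] g_cong[of "fst p" "fst p" "hit (fst p) (snd p)" "red (hit (fst p) (snd p))"]
    g_cong[of "hit (fst p) (snd p)" "red (hit (fst p) (snd p))" "fst p" "fst p"]
  by (simp add: step_iff billiard_map_def g_red phase_space_iff)

lemma step_unique:
  assumes "p \<in> \<Omega>" "q \<in> \<Omega>" "billiard_step g P p q"
  shows "q = billiard_map p"
proof -
  \<comment> \<open>\<open>z\<close> is the representative of \<open>y\<close> modulo
    \<open>P\<close> in [x, x + P), where \<open>hit\<close> looks for the endpoint.\<close>
  define x y z where "x = fst p" and "y = fst q" and "z = x + red (y - x)"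
  have s: "g x \<noteq> g y" "snd p = angle x y" "snd q = pi - angle y x"
    using assms(3) by (auto simp: step_iff x_def y_def)
  have "g z = g y"
    using periodic_int[of g y "- \<lfloor>(y - x) / P\<rfloor>", OF g_per] by (simp add: z_def red_def)
  moreover have "z \<noteq> x" using s(1) \<open>g z = g y\<close> by auto
  ultimately have z: "g z = g y" "x < z" "z < x + P"
    using red_bounds[of "y - x"] by (auto simp: z_def)
  have "hit x (angle x y) = z"
    using hit_angle[OF z(2,3)] g_cong(4)[of x x z y] z(1) by simp
  moreover have "red z = y"
    using g_eq_imp_red[OF z(1)] red_id[of y] assms(2) by (simp add: phase_space_iff y_def)
  moreover have "angle z x = angle y x" using g_cong(4)[of z y x x] z(1) by simp
  ultimately show ?thesis
    using s by (simp add: billiard_map_def x_def[symmetric] y_def prod_eq_iff)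
qed

lemma step_flip: "billiard_step g P p q \<Longrightarrow> billiard_step g P (flip q) (flip p)"
  by (auto simp: step_iff flip_def)

lemma billiard_map_inv_map: assumes "p \<in> \<Omega>" shows "billiard_map (inv_map p) = p"
proof -
  have "billiard_step g P (flip (billiard_map (flip p))) (flip (flip p))"
    by (intro step_flip step_billiard_map flip_phase_space assms)
  then have "flip (flip p) = billiard_map (flip (billiard_map (flip p)))"
    using assms by (intro step_unique flip_phase_space billiard_map_phase_space)
  then show ?thesis by (simp add: inv_map_def flip_flip)
qed

lemma inv_map_billiard_map: assumes "p \<in> \<Omega>" shows "inv_map (billiard_map p) = p"
proof -
  have "billiard_step g P (flip (billiard_map p)) (flip p)"
    by (intro step_flip step_billiard_map assms)
  then have "flip p = billiard_map (flip (billiard_map p))"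
    using assms by (intro step_unique flip_phase_space billiard_map_phase_space)
  then show ?thesis using flip_flip[of p] by (simp add: inv_map_def)
qed

lemma inv_map_phase_space: "inv_map p \<in> \<Omega>"
  by (simp add: inv_map_def flip_phase_space billiard_map_phase_space)

lemma orb_phase_space: assumes "p \<in> \<Omega>" shows "orb p n \<in> \<Omega>"
proof -
  have "(billiard_map ^^ m) p \<in> \<Omega>" "(inv_map ^^ m) p \<in> \<Omega>" for m
    using assms by (cases m; simp add: billiard_map_phase_space inv_map_phase_space)+
  then show ?thesis by (simp add: orb_def)
qed

lemma orb_0: "orb p 0 = p"
  by (simp add: orb_def)

lemma orb_Suc: assumes "p \<in> \<Omega>" shows "orb p (n + 1) = billiard_map (orb p n)"
proof (cases "0 \<le> n")
  case True
  then have "nat (n + 1) = Suc (nat n)" by simp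
  with True show ?thesis by (simp add: orb_def)
next
  case False
  define m where "m = nat (- n - 1)"
  have m: "n = - int (Suc m)" using False by (simp add: m_def)
  have "orb p n = inv_map (orb p (n + 1))"
    by (cases "m = 0") (auto simp: orb_def m nat_add_distrib)
  then show ?thesis using billiard_map_inv_map[OF orb_phase_space[OF assms, of "n + 1"]] by simp
qed

lemma orb_unique:
  assumes "p \<in> \<Omega>" "u 0 = p" "\<And>n. u n \<in> \<Omega>" "\<And>n. u (n + 1) = billiard_map (u n)"
  shows "u n = orb p n"
proof (induction n rule: int_induct[where k = 0])
  case base then show ?case using assms by (simp add: orb_0)
next
  case (step1 i) then show ?case using assms(4)[of i] orb_Suc[OF assms(1), of i] by simp
next
  case (step2 i)
  have "u (i - 1) = inv_map (billiard_map (u (i - 1)))" using assms(3) by (simp add: inv_map_billiard_map)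
  also have "billiard_map (u (i - 1)) = billiard_map (orb p (i - 1))"
    using assms(4)[of "i - 1"] orb_Suc[OF assms(1), of "i - 1"] step2 by simp
  also have "inv_map \<dots> = orb p (i - 1)" by (intro inv_map_billiard_map orb_phase_space assms)
  finally show ?case .
qed

lemma orb_step: "p \<in> \<Omega> \<Longrightarrow> billiard_step g P (orb p n) (orb p (n + 1))"
  unfolding orb_Suc by (intro step_billiard_map orb_phase_space)

lemma orb_neq: "p \<in> \<Omega> \<Longrightarrow> g (fst (orb p n)) \<noteq> g (fst (orb p (n + 1)))"
  using orb_step by (simp add: step_iff)

lemma second_var_cong:
  assumes "g x = g x'" "g y = g y'" shows "second_var x y = second_var x' y'"
  using g_cong[OF assms] g_cong[OF assms(2,1)] g_eq_imp[OF assms(1)] g_eq_imp[OF assms(2)]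
  by (simp add: second_var_def fun_eq_iff)

lemma m_configuration_cong:
  assumes ne: "\<And>n. g (xs n) \<noteq> g (xs (n + 1))" and eq: "\<And>n. g (xs n) = g (ys n)"
  shows "m_configuration g xs \<longleftrightarrow> m_configuration g ys"
proof -
  have "second_var (xs n) (xs (n + 1)) = second_var (ys n) (ys (n + 1))" for n
    by (intro second_var_cong eq)
  then have "quad_form xs = quad_form ys" by (simp add: quad_form_def fun_eq_iff)
  moreover have ne': "g (ys n) \<noteq> g (ys (n + 1))" for n using ne[of n] by (simp add: eq)
  ultimately show ?thesis
    unfolding m_configuration_quad_form[of xs, OF ne] m_configuration_quad_form[of ys, OF ne'] by simp
qed

text \<open>The definition admits any sequence of real representatives. Reduced modulo
  \<open>P\<close>, such a sequence is forced to be the orbit of its initial point, and the second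
  variation depends only on the points of the curve.\<close>

lemma m_orbit_set_iff:
  "p \<in> m_orbit_set g P \<longleftrightarrow> p \<in> \<Omega> \<and> m_configuration g (\<lambda>n. fst (orb p n))"
proof
  assume "p \<in> m_orbit_set g P"
  then obtain s where p: "p \<in> \<Omega>" and s: "s 0 = p" "\<And>n. billiard_step g P (s n) (s (n + 1))"
    "m_configuration g (fst \<circ> s)"
    by (auto simp: m_orbit_set_def)
  define u where "u n = (red (fst (s n)), snd (s n))" for n
  have "u n \<in> \<Omega>" for n
    using s(2)[of n] red_bounds angle_bounds by (auto simp: phase_space_iff u_def step_iff)
  moreover have "billiard_step g P (u n) (u (n + 1))" for n
    using s(2)[of n] g_cong[of "red (fst (s n))" "fst (s n)" "red (fst (s (n + 1)))" "fst (s (n + 1))"]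
      g_cong[of "red (fst (s (n + 1)))" "fst (s (n + 1))" "red (fst (s n))" "fst (s n)"]
    by (simp add: step_iff u_def g_red)
  moreover have "u 0 = p" using p s(1) by (simp add: u_def phase_space_iff red_id prod_eq_iff)
  ultimately have u: "u n = orb p n" for n
    using p by (intro orb_unique step_unique) auto
  have "m_configuration g (\<lambda>n. fst (s n)) \<longleftrightarrow> m_configuration g (\<lambda>n. fst (orb p n))"
  proof (rule m_configuration_cong)
    show "g (fst (s n)) \<noteq> g (fst (s (n + 1)))" for n using s(2) by (simp add: step_iff)
    show "g (fst (s n)) = g (fst (orb p n))" for n using g_red by (simp add: u[symmetric] u_def)
  qed
  then show "p \<in> \<Omega> \<and> m_configuration g (\<lambda>n. fst (orb p n))" using s(3) p by (simp add: o_def)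
next
  assume "p \<in> \<Omega> \<and> m_configuration g (\<lambda>n. fst (orb p n))"
  then show "p \<in> m_orbit_set g P"
    unfolding m_orbit_set_def o_def using orb_step[of p] orb_0[of p] by blast
qed

lemma m_configuration_shift:
  assumes "m_configuration g xs" shows "m_configuration g (\<lambda>n. xs (n + c))"
  unfolding m_configuration_def
proof (intro allI impI)
  fix M N :: int and \<xi> :: "int \<Rightarrow> real"
  assume "M < N" and \<xi>: "(\<forall>n. n \<le> M \<or> N \<le> n \<longrightarrow> \<xi> n = 0) \<and> (\<exists>n. \<xi> n \<noteq> 0)"
  define \<zeta> where "\<zeta> n = \<xi> (n - c)" for n
  have "(\<forall>n. n \<le> M + c \<or> N + c \<le> n \<longrightarrow> \<zeta> n = 0)"
    using \<xi> by (auto simp: \<zeta>_def)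
  moreover obtain n where "\<xi> n \<noteq> 0" using \<xi> by blast
  then have "\<zeta> (n + c) \<noteq> 0" by (simp add: \<zeta>_def)
  ultimately have "deriv (deriv (\<lambda>e. \<Sum>n\<in>{M + c..<N + c}. chordL g (xs n + e * \<zeta> n) (xs (n + 1) + e * \<zeta> (n + 1)))) 0 < 0"
    using assms \<open>M < N\<close> unfolding m_configuration_def by (meson add_less_cancel_right)
  also have "(\<lambda>e. \<Sum>n\<in>{M + c..<N + c}. chordL g (xs n + e * \<zeta> n) (xs (n + 1) + e * \<zeta> (n + 1)))
    = (\<lambda>e. \<Sum>n\<in>{M..<N}. chordL g (xs (n + c) + e * \<xi> n) (xs (n + 1 + c) + e * \<xi> (n + 1)))"
    by (rule ext, rule sum.reindex_bij_witness[of _ "\<lambda>n. n + c" "\<lambda>n. n - c"])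
       (auto simp: \<zeta>_def algebra_simps)
  finally show "deriv (deriv (\<lambda>e. \<Sum>n\<in>{M..<N}. chordL g (xs (n + c) + e * \<xi> n) (xs (n + 1 + c) + e * \<xi> (n + 1)))) 0 < 0" .
qed

lemma m_orbit_set_invariant:
  assumes p: "p \<in> \<Omega>"
  shows "billiard_map p \<in> m_orbit_set g P \<longleftrightarrow> p \<in> m_orbit_set g P"
proof -
  have orb: "orb (billiard_map p) n = orb p (n + 1)" for n
  proof (rule orb_unique[symmetric, of _ "\<lambda>n. orb p (n + 1)"])
    show "orb p (n + 1 + 1) = billiard_map (orb p (n + 1))" for n by (rule orb_Suc[OF p])
    show "orb p (0 + 1) = billiard_map p" using orb_Suc[OF p, of 0] by (simp add: orb_0)
  qed (simp_all add: p billiard_map_phase_space orb_phase_space)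
  show ?thesis
    unfolding m_orbit_set_iff orb
    using p billiard_map_phase_space m_configuration_shift[of "\<lambda>n. fst (orb p n)" 1]
      m_configuration_shift[of "\<lambda>n. fst (orb p (n + 1))" "- 1"] by auto
qed

section \<open>Measurability of the set of m-orbits\<close>

lemma measurable_red [measurable]: "red \<in> borel_measurable borel"
  unfolding red_def by measurable

lemma measurable_billiard_map [measurable]:
  "billiard_map \<in> borel \<Otimes>\<^sub>M borel \<rightarrow>\<^sub>M borel \<Otimes>\<^sub>M borel"
  unfolding billiard_map_def by measurable

lemma measurable_inv_map [measurable]:
  "inv_map \<in> borel \<Otimes>\<^sub>M borel \<rightarrow>\<^sub>M borel \<Otimes>\<^sub>M borel"
  unfolding inv_map_def flip_def by measurable

lemma measurable_orb [measurable]: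
  "(\<lambda>p. orb p n) \<in> borel \<Otimes>\<^sub>M borel \<rightarrow>\<^sub>M borel \<Otimes>\<^sub>M borel"
proof -
  have [measurable]: "f ^^ m \<in> M \<rightarrow>\<^sub>M M" if [measurable]: "f \<in> M \<rightarrow>\<^sub>M M" for f m and M :: "(real \<times> real) measure"
    by (induction m) auto
  show ?thesis unfolding orb_def by measurable
qed

lemma sets_phase_space [measurable]: "\<Omega> \<in> sets (borel \<Otimes>\<^sub>M borel)"
proof -
  have "\<Omega> = {p \<in> space (borel \<Otimes>\<^sub>M borel). 0 \<le> fst p \<and> fst p < P \<and> 0 < snd p \<and> snd p < pi}"
    by (auto simp: phase_space_iff space_pair_measure)
  also have "\<dots> \<in> sets (borel \<Otimes>\<^sub>M borel)" by measurable
  finally show ?thesis .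
qed

text \<open>Integer test vectors present the set as a countable intersection of measurable
  conditions on finite orbit segments. Without measurability \<open>billiard_mu\<close> of the
  complement would be the default value 0 of the integral, and the bounds would say nothing about
  m-orbits.\<close>

lemma sets_m_orbit_set [measurable]: "m_orbit_set g P \<in> sets (borel \<Otimes>\<^sub>M borel)"
proof -
  have [measurable]: "(\<lambda>p. quad_form (\<lambda>n. fst (orb p n)) M N \<xi>) \<in> borel_measurable (borel \<Otimes>\<^sub>M borel)" for M N \<xi>
    unfolding quad_form_def second_var_def by measurable
  have "m_orbit_set g P = \<Omega> \<inter> (\<Inter>m. \<Inter>l. {p \<in> space (borel \<Otimes>\<^sub>M borel).
      quad_form (\<lambda>n. fst (orb p n)) (- int m) (int m) (test_seq m l) \<le> 0})"
    using m_configuration_iff_test_seq[of "\<lambda>n. fst (orb _ n)", OF orb_neq]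
    by (auto simp: m_orbit_set_iff space_pair_measure)
  also have "\<dots> \<in> sets (borel \<Otimes>\<^sub>M borel)"
  proof -
    have U: "UNIV \<in> sets (borel \<Otimes>\<^sub>M borel :: (real \<times> real) measure)"
      using sets.top[of "borel \<Otimes>\<^sub>M borel :: (real \<times> real) measure"] by (simp add: space_pair_measure)
    show ?thesis
      by (intro sets.Int sets_phase_space sets.countable_INT'' U countableI_type) measurable
  qed
  finally show ?thesis .
qed


section \<open>The invariant measure\<close>

text \<open>This is sin \<phi> times the derivative of \<phi> = \<open>angle x y\<close> in
  \<open>y\<close>, and at the same time the mixed second derivative of L, the generating function
  of the billiard map.\<close>

definition weight :: "real \<Rightarrow> real \<Rightarrow> real" where
  "weight x y = height x y * height y x / (chordL g x y) ^ 3"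

lemma weight_commute: "weight x y = weight y x"
  by (simp add: weight_def chord_commute[of y x])

lemma weight_cong: "g x = g x' \<Longrightarrow> g y = g y' \<Longrightarrow> weight x y = weight x' y'"
  using g_cong[of x x' y y'] g_cong[of y y' x x'] by (simp add: weight_def)

lemma measurable_weight [measurable (raw)]:
  assumes [measurable]: "u \<in> borel_measurable M" "v \<in> borel_measurable M"
  shows "(\<lambda>p. weight (u p) (v p)) \<in> borel_measurable M"
  unfolding weight_def by measurable

lemma cont_height: "continuous_on S (\<lambda>y. height y x)" "continuous_on S (\<lambda>y. chordL g x y)"
  unfolding height_def chordL_def by (intro continuous_intros cont_g cont_t)+

text \<open>In the coordinates \<open>(x, y)\<close> the invariant measure has the density \<open>weight\<close>, which is symmetric:
  this is why the billiard map preserves the measure.\<close>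
lemma nn_integral_angle_to_point:
  fixes h :: "real \<Rightarrow> ennreal"
  assumes [measurable]: "h \<in> borel_measurable borel" and per: "\<And>y. h (y + P) = h y"
    and x: "0 \<le> x" "x \<le> P"
  shows "(\<integral>\<^sup>+\<phi>. h (hit x \<phi>) * ennreal (sin \<phi>) * indicator {0<..<pi} \<phi> \<partial>lborel) =
    (\<integral>\<^sup>+y. h y * ennreal (weight x y) * indicator {0..<P} y \<partial>lborel)"
proof -
  let ?d = "\<lambda>y. height y x / (chordL g x y)\<^sup>2"
  have ne: "g x \<noteq> g y" if "x < y" "y < x + P" for y using that by (rule g_neq)
  have "(\<integral>\<^sup>+\<phi>. h (hit x \<phi>) * ennreal (sin \<phi>) * indicator (angle x ` {x<..<x+P}) \<phi> \<partial>lborel)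
    = (\<integral>\<^sup>+y. h (hit x (angle x y)) * ennreal (sin (angle x y)) * ennreal (?d y) * indicator {x<..<x+P} y \<partial>lborel)"
  proof (rule nn_integral_substitution_open_interval)
    show "continuous_on {x<..<x + P} ?d"
      using ne by (intro continuous_intros cont_height) (auto simp: chordL_def)
    fix y assume y: "x < y" "y < x + P"
    show "(angle x has_real_derivative ?d y) (at y)" by (rule angle_deriv[OF ne[OF y]])
    show "0 < ?d y" using height_pos[of y x] chord_pos[OF ne[OF y]] ne[OF y] by simp
  qed (measurable, use P_pos in simp)
  also have "\<dots> = (\<integral>\<^sup>+y. h y * ennreal (weight x y) * indicator {x<..<x+P} y \<partial>lborel)"
  proof (intro nn_integral_cong)
    fix y
    show "h (hit x (angle x y)) * ennreal (sin (angle x y)) * ennreal (?d y) * indicator {x<..<x+P} y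
      = h y * ennreal (weight x y) * indicator {x<..<x+P} y"
    proof (cases "y \<in> {x<..<x+P}")
      case True
      then have y: "x < y" "y < x + P" by auto
      have "sin (angle x y) * ?d y = weight x y"
        using chord_pos[OF ne[OF y]] by (simp add: sin_cos_angle[OF ne[OF y]] weight_def field_simps power2_eq_square power3_eq_cube)
      then have "ennreal (sin (angle x y)) * ennreal (?d y) = ennreal (weight x y)"
        using height_nonneg[of y x] angle_bounds[of x y]
        by (subst ennreal_mult[symmetric]) (auto intro!: sin_gt_zero less_imp_le)
      then show ?thesis by (simp add: hit_angle[OF y] mult.assoc)
    qed simp
  qed
  also have "\<dots> = (\<integral>\<^sup>+y. h y * ennreal (weight x y) * indicator {0..<P} y \<partial>lborel)"
    by (rule integral_shift_period) (use x per weight_cong[of x x "_ + P" "_"] in \<open>auto simp: g_per\<close>)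
  finally show ?thesis unfolding angle_image .
qed

definition mu :: "(real \<times> real) measure" where
  "mu = density (lborel \<Otimes>\<^sub>M lborel) (\<lambda>p. ennreal (indicator \<Omega> p * sin (snd p)))"

lemma sets_mu [measurable_cong]: "sets mu = sets (borel \<Otimes>\<^sub>M borel)"
  by (simp add: mu_def cong: sets_pair_measure_cong)

lemma measurable_phase_space_lborel [measurable]: "\<Omega> \<in> sets (lborel \<Otimes>\<^sub>M lborel)"
  using sets_phase_space by (simp cong: sets_pair_measure_cong)

lemma AE_mu: "AE p in mu. p \<in> \<Omega>"
  unfolding mu_def by (subst AE_density) (auto simp: indicator_def)

lemma sin_nonneg_phase_space: "p \<in> \<Omega> \<Longrightarrow> 0 \<le> sin (snd p)"
  by (auto simp: phase_space_iff intro!: sin_ge_zero)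

lemma nn_integral_mu:
  assumes [measurable]: "F \<in> borel_measurable (borel \<Otimes>\<^sub>M borel)"
  shows "(\<integral>\<^sup>+p. F p \<partial>mu) = (\<integral>\<^sup>+x. (\<integral>\<^sup>+\<phi>. F (x, \<phi>) * ennreal (sin \<phi>) * indicator {0<..<pi} \<phi> \<partial>lborel) * indicator {0..<P} x \<partial>lborel)"
proof -
  have sets_eq: "sets (lborel \<Otimes>\<^sub>M lborel) = sets (borel \<Otimes>\<^sub>M borel :: (real \<times> real) measure)"
    by (intro sets_pair_measure_cong) auto
  have [measurable]: "F \<in> borel_measurable (lborel \<Otimes>\<^sub>M lborel)"
    using assms by (simp cong: measurable_cong_sets add: sets_eq)
  have "(\<integral>\<^sup>+p. F p \<partial>mu) = (\<integral>\<^sup>+p. ennreal (indicator \<Omega> p * sin (snd p)) * F p \<partial>(lborel \<Otimes>\<^sub>M lborel))"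
    unfolding mu_def by (intro nn_integral_density) measurable
  also have "\<dots> = (\<integral>\<^sup>+x. \<integral>\<^sup>+\<phi>. ennreal (indicator \<Omega> (x, \<phi>) * sin \<phi>) * F (x, \<phi>) \<partial>lborel \<partial>lborel)"
    using lborel.nn_integral_fst[of "\<lambda>p. ennreal (indicator \<Omega> p * sin (snd p)) * F p" lborel, symmetric] by simp
  also have "\<dots> = (\<integral>\<^sup>+x. (\<integral>\<^sup>+\<phi>. F (x, \<phi>) * ennreal (sin \<phi>) * indicator {0<..<pi} \<phi> \<partial>lborel) * indicator {0..<P} x \<partial>lborel)"
    by (intro nn_integral_cong, subst nn_integral_multc[symmetric], measurable)
       (intro nn_integral_cong, auto simp: phase_space_iff indicator_def mult.commute)
  finally show ?thesis .
qed

text \<open>In endpoint coordinates the map sends (x, angle x y) to (y, pi - angle y x), that is, it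
  exchanges the two ends of the chord. Symmetry of \<open>weight\<close> and Fubini allow the
  exchange; going back to angles at \<open>y\<close> leaves the substitution of pi - \<phi> for
  \<phi>, which preserves sin \<phi>.\<close>

lemma nn_integral_mu_billiard_map:
  assumes F[measurable]: "F \<in> borel_measurable (borel \<Otimes>\<^sub>M borel)"
  shows "(\<integral>\<^sup>+p. F (billiard_map p) \<partial>mu) = (\<integral>\<^sup>+p. F p \<partial>mu)"
proof -
  have "(\<integral>\<^sup>+p. F (billiard_map p) \<partial>mu) =
      (\<integral>\<^sup>+x. (\<integral>\<^sup>+y. F (red y, pi - angle y x) * ennreal (weight x y) * indicator {0..<P} y \<partial>lborel) * indicator {0..<P} x \<partial>lborel)"
  proof (subst nn_integral_mu, measurable, intro nn_integral_cong)
    fix x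
    have "(\<integral>\<^sup>+\<phi>. F (red (hit x \<phi>), pi - angle (hit x \<phi>) x) * ennreal (sin \<phi>) * indicator {0<..<pi} \<phi> \<partial>lborel) =
      (\<integral>\<^sup>+y. F (red y, pi - angle y x) * ennreal (weight x y) * indicator {0..<P} y \<partial>lborel)" if "x \<in> {0..<P}"
      by (rule nn_integral_angle_to_point[where h = "\<lambda>y. F (red y, pi - angle y x)"])
         (use that g_cong(4)[OF g_per refl] g_eq_imp_red[OF g_per] in auto)
    then show "(\<integral>\<^sup>+\<phi>. F (billiard_map (x, \<phi>)) * ennreal (sin \<phi>) * indicator {0<..<pi} \<phi> \<partial>lborel) * indicator {0..<P} x
      = (\<integral>\<^sup>+y. F (red y, pi - angle y x) * ennreal (weight x y) * indicator {0..<P} y \<partial>lborel) * indicator {0..<P} x"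
      by (auto simp: billiard_map_def indicator_def)
  qed
  also have "\<dots> = (\<integral>\<^sup>+x. (\<integral>\<^sup>+y. F (y, pi - angle y x) * ennreal (weight x y) * indicator {0..<P} y * indicator {0..<P} x \<partial>lborel) \<partial>lborel)"
    by (intro nn_integral_cong, subst nn_integral_multc[symmetric], measurable)
       (intro nn_integral_cong, auto simp: indicator_def red_id)
  also have "\<dots> = (\<integral>\<^sup>+y. (\<integral>\<^sup>+x. F (y, pi - angle y x) * ennreal (weight x y) * indicator {0..<P} y * indicator {0..<P} x \<partial>lborel) \<partial>lborel)"
    by (rule lborel_pair.Fubini') measurable
  also have "\<dots> = (\<integral>\<^sup>+y. (\<integral>\<^sup>+x. F (y, pi - angle y x) * ennreal (weight y x) * indicator {0..<P} x \<partial>lborel) * indicator {0..<P} y \<partial>lborel)"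
    by (intro nn_integral_cong, subst nn_integral_multc[symmetric], measurable)
       (intro nn_integral_cong, auto simp: indicator_def weight_commute)
  also have "\<dots> = (\<integral>\<^sup>+y. (\<integral>\<^sup>+\<phi>. F (y, \<phi>) * ennreal (sin \<phi>) * indicator {0<..<pi} \<phi> \<partial>lborel) * indicator {0..<P} y \<partial>lborel)"
  proof (intro nn_integral_cong)
    fix y
    have "(\<integral>\<^sup>+x. F (y, pi - angle y x) * ennreal (weight y x) * indicator {0..<P} x \<partial>lborel)
      = (\<integral>\<^sup>+\<phi>. F (y, \<phi>) * ennreal (sin \<phi>) * indicator {0<..<pi} \<phi> \<partial>lborel)" if y: "y \<in> {0..<P}"
    proof -
      have "(\<integral>\<^sup>+x. F (y, pi - angle y x) * ennreal (weight y x) * indicator {0..<P} x \<partial>lborel)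
        = (\<integral>\<^sup>+\<phi>. F (y, pi - angle y (hit y \<phi>)) * ennreal (sin \<phi>) * indicator {0<..<pi} \<phi> \<partial>lborel)"
        by (rule nn_integral_angle_to_point[symmetric, where h = "\<lambda>x. F (y, pi - angle y x)"])
           (use y g_cong(4)[OF refl g_per] in auto)
      also have "\<dots> = (\<integral>\<^sup>+\<phi>. F (y, pi - \<phi>) * ennreal (sin \<phi>) * indicator {0<..<pi} \<phi> \<partial>lborel)"
        by (intro nn_integral_cong) (auto simp: indicator_def hitD(3))
      also have "\<dots> = (\<integral>\<^sup>+\<phi>. F (y, pi - (pi + (-1) * \<phi>)) * ennreal (sin (pi + (-1) * \<phi>)) * indicator {0<..<pi} (pi + (-1) * \<phi>) \<partial>lborel)"
        by (subst nn_integral_real_affine[of _ "-1" pi]) auto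
      also have "\<dots> = (\<integral>\<^sup>+\<phi>. F (y, \<phi>) * ennreal (sin \<phi>) * indicator {0<..<pi} \<phi> \<partial>lborel)"
        by (intro nn_integral_cong) (auto simp: indicator_def)
      finally show ?thesis .
    qed
    then show "(\<integral>\<^sup>+x. F (y, pi - angle y x) * ennreal (weight y x) * indicator {0..<P} x \<partial>lborel) * indicator {0..<P} y
      = (\<integral>\<^sup>+\<phi>. F (y, \<phi>) * ennreal (sin \<phi>) * indicator {0<..<pi} \<phi> \<partial>lborel) * indicator {0..<P} y"
      by (auto simp: indicator_def)
  qed
  also have "\<dots> = (\<integral>\<^sup>+p. F p \<partial>mu)" by (rule nn_integral_mu[symmetric]) measurable
  finally show ?thesis .
qed

lemma distr_billiard_map: "distr mu mu billiard_map = mu"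
proof (rule measure_eqI)
  fix A assume "A \<in> sets (distr mu mu billiard_map)"
  then have [measurable]: "A \<in> sets (borel \<Otimes>\<^sub>M borel)" by (simp add: sets_mu)
  have T: "billiard_map \<in> mu \<rightarrow>\<^sub>M mu"
    using measurable_billiard_map by (simp cong: measurable_cong_sets add: sets_mu)
  have "emeasure (distr mu mu billiard_map) A = (\<integral>\<^sup>+p. indicator A p \<partial>(distr mu mu billiard_map))"
    by (simp add: sets_mu)
  also have "\<dots> = (\<integral>\<^sup>+p. indicator A (billiard_map p) \<partial>mu)"
    by (rule nn_integral_distr[OF T]) (simp add: sets_mu)
  also have "\<dots> = (\<integral>\<^sup>+p. indicator A p \<partial>mu)" by (rule nn_integral_mu_billiard_map) measurable
  also have "\<dots> = emeasure mu A" by (simp add: sets_mu)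
  finally show "emeasure (distr mu mu billiard_map) A = emeasure mu A" .
qed simp

lemma integral_mu_billiard_map:
  fixes F :: "real \<times> real \<Rightarrow> real"
  assumes "F \<in> borel_measurable (borel \<Otimes>\<^sub>M borel)"
  shows "(\<integral>p. F (billiard_map p) \<partial>mu) = (\<integral>p. F p \<partial>mu)"
proof -
  have T: "billiard_map \<in> mu \<rightarrow>\<^sub>M mu"
    using measurable_billiard_map by (simp cong: measurable_cong_sets add: sets_mu)
  have F: "F \<in> borel_measurable mu" using assms by (simp cong: measurable_cong_sets add: sets_mu)
  show ?thesis using integral_distr[OF T F] unfolding distr_billiard_map by simp
qed


section \<open>Bounds and integrals over the phase space\<close>

lemma periodic_bounded:
  fixes f :: "real \<Rightarrow> 'a::real_normed_vector"
  assumes "continuous_on UNIV f" "\<And>x. f (x + P) = f x"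
  obtains B where "0 < B" "\<And>x. norm (f x) \<le> B"
proof -
  have "bounded (f ` {0..P})"
    by (intro compact_imp_bounded compact_continuous_image continuous_on_subset[OF assms(1)]) auto
  then obtain B where B: "0 < B" "\<And>x. x \<in> {0..P} \<Longrightarrow> norm (f x) \<le> B"
    unfolding bounded_pos by auto
  have "norm (f x) \<le> B" for x
    using B(2)[of "red x"] red_bounds[of x] periodic_red[of f, OF assms(2)] by simp
  with B(1) show thesis by (rule that)
qed

lemma chord_bounded: obtains B where "0 < B" "\<And>x y. chordL g x y \<le> B"
proof -
  obtain B where B: "0 < B" "\<And>x. norm (g x) \<le> B" using periodic_bounded[OF cont_g g_per] by blast
  have "chordL g x y \<le> 2 * B" for x y
    using B(2)[of x] B(2)[of y] norm_triangle_ineq4[of "g x" "g y"] by (simp add: chordL_def dist_norm)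
  with B(1) show thesis by (intro that[of "2 * B"]) auto
qed

lemma finite_measure_mu: "finite_measure mu"
proof
  have "emeasure mu (space mu) = (\<integral>\<^sup>+p. 1 \<partial>mu)" by simp
  also have "\<dots> = (\<integral>\<^sup>+x. (\<integral>\<^sup>+\<phi>. 1 * ennreal (sin \<phi>) * indicator {0<..<pi} \<phi> \<partial>lborel) * indicator {0..<P} x \<partial>lborel)"
    by (rule nn_integral_mu) auto
  also have "\<dots> \<le> (\<integral>\<^sup>+x. (\<integral>\<^sup>+\<phi>. indicator {0..pi} \<phi> \<partial>lborel) * indicator {0..<P} x \<partial>lborel)"
    by (intro nn_integral_mono mult_right_mono) (auto simp: indicator_def)
  also have "\<dots> = ennreal pi * ennreal P"
    using P_pos by (subst nn_integral_cmult) auto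
  also have "\<dots> < \<infinity>" by (simp add: ennreal_mult_less_top)
  finally show "emeasure mu (space mu) \<noteq> \<infinity>" by simp
qed

lemma integrable_mu:
  fixes F :: "real \<times> real \<Rightarrow> real"
  assumes [measurable]: "F \<in> borel_measurable (borel \<Otimes>\<^sub>M borel)" and "\<And>p. p \<in> \<Omega> \<Longrightarrow> \<bar>F p\<bar> \<le> B"
  shows "integrable mu F"
  using AE_mu assms(2)
  by (intro finite_measure.integrable_const_bound[OF finite_measure_mu, of _ B]) auto

lemma integral_interval_0_P:
  assumes "continuous_on UNIV a"
  shows "(\<integral>x. indicator {0..<P} x * a x \<partial>lborel) = integral {0..P} (a :: real \<Rightarrow> real)"
proof -
  have [measurable]: "a \<in> borel_measurable borel" using assms by (rule borel_measurable_continuous_onI)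
  have "(\<integral>x. indicator {0..<P} x * a x \<partial>lborel) = (\<integral>x. indicator {0..P} x * a x \<partial>lborel)"
    by (intro integral_cong_AE, measurable, rule AE_I[of _ _ "{P}"]) (auto simp: indicator_def)
  also have "\<dots> = (LINT x:{0..P}|lborel. a x)" by (simp add: set_lebesgue_integral_def)
  also have "\<dots> = integral {0..P} a"
    using assms by (intro set_borel_integral_eq_integral(2) borel_integrable_atLeastAtMost' continuous_on_subset[OF assms]) auto
  finally show ?thesis .
qed

lemma integral_interval_0_pi:
  assumes "continuous_on UNIV b"
  shows "(\<integral>x. indicator {0<..<pi} x * b x \<partial>lborel) = integral {0..pi} (b :: real \<Rightarrow> real)"
proof -
  have [measurable]: "b \<in> borel_measurable borel" using assms by (rule borel_measurable_continuous_onI)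
  have "(\<integral>x. indicator {0<..<pi} x * b x \<partial>lborel) = (\<integral>x. indicator {0..pi} x * b x \<partial>lborel)"
    by (intro integral_cong_AE, measurable, rule AE_I[of _ _ "{0, pi}"]) (auto simp: indicator_def emeasure_lborel_countable)
  also have "\<dots> = (LINT x:{0..pi}|lborel. b x)" by (simp add: set_lebesgue_integral_def)
  also have "\<dots> = integral {0..pi} b"
    using assms by (intro set_borel_integral_eq_integral(2) borel_integrable_atLeastAtMost' continuous_on_subset[OF assms]) auto
  finally show ?thesis .
qed

lemma integral_mu_prod:
  fixes a b :: "real \<Rightarrow> real"
  assumes a: "continuous_on UNIV a" "\<And>x. a (x + P) = a x" and b: "continuous_on UNIV b"
  shows "integrable mu (\<lambda>p. a (fst p) * b (snd p))"
    and "(\<integral>p. a (fst p) * b (snd p) \<partial>mu) = integral {0..P} a * integral {0..pi} (\<lambda>\<phi>. b \<phi> * sin \<phi>)"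
proof -
  have [measurable]: "a \<in> borel_measurable borel" "b \<in> borel_measurable borel"
    using a(1) b by (auto intro: borel_measurable_continuous_onI)
  obtain A where A: "0 < A" "\<And>x. norm (a x) \<le> A" using periodic_bounded[OF a] by blast
  have "bounded (b ` {0..pi})"
    by (intro compact_imp_bounded compact_continuous_image continuous_on_subset[OF b]) auto
  then obtain B where B: "0 < B" "\<And>x. x \<in> {0..pi} \<Longrightarrow> norm (b x) \<le> B"
    unfolding bounded_pos by auto
  show int: "integrable mu (\<lambda>p. a (fst p) * b (snd p))"
    using A B by (intro integrable_mu[of _ "A * B"]) (auto simp: abs_mult phase_space_iff intro!: mult_mono)
  let ?w = "\<lambda>p. indicator \<Omega> p * sin (snd p)"
  have w: "AE p in lborel \<Otimes>\<^sub>M lborel. 0 \<le> ?w p"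
    using sin_nonneg_phase_space by (auto simp: indicator_def)
  have int': "integrable (lborel \<Otimes>\<^sub>M lborel) (\<lambda>p. ?w p * (a (fst p) * b (snd p)))"
    using int w unfolding mu_def by (subst (asm) integrable_density) auto
  have "(\<integral>p. a (fst p) * b (snd p) \<partial>mu) = (\<integral>p. ?w p * (a (fst p) * b (snd p)) \<partial>(lborel \<Otimes>\<^sub>M lborel))"
    using w unfolding mu_def by (subst integral_density) auto
  also have "\<dots> = (\<integral>x. \<integral>\<phi>. ?w (x, \<phi>) * (a x * b \<phi>) \<partial>lborel \<partial>lborel)"
    using lborel_pair.integral_fst'[OF int'] by simp
  also have "\<dots> = (\<integral>x. \<integral>\<phi>. (indicator {0..<P} x * a x) * (indicator {0<..<pi} \<phi> * (b \<phi> * sin \<phi>)) \<partial>lborel \<partial>lborel)"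
    by (intro Bochner_Integration.integral_cong refl) (auto simp: phase_space_iff indicator_def)
  also have "\<dots> = (\<integral>x. indicator {0..<P} x * a x \<partial>lborel) * (\<integral>\<phi>. indicator {0<..<pi} \<phi> * (b \<phi> * sin \<phi>) \<partial>lborel)"
    by simp
  also have "\<dots> = integral {0..P} a * integral {0..pi} (\<lambda>\<phi>. b \<phi> * sin \<phi>)"
    by (subst integral_interval_0_P integral_interval_0_pi, (intro a b continuous_intros)+)+ (rule refl)
  finally show "(\<integral>p. a (fst p) * b (snd p) \<partial>mu) = integral {0..P} a * integral {0..pi} (\<lambda>\<phi>. b \<phi> * sin \<phi>)" .
qed

lemma measure_mu_phase_space: "(\<integral>p. 1 \<partial>mu) = 2 * P"
  using integral_mu_prod(2)[of "\<lambda>_. 1" "\<lambda>_. 1"] P_pos by (simp add: integral_sin_0_pi)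

lemma integral_mu_sin: "(\<integral>p. sin (snd p) \<partial>mu) = pi * P / 2"
  using integral_mu_prod(2)[of "\<lambda>_. 1" sin] P_pos continuous_on_sin[OF continuous_on_id, of UNIV] by (simp add: integral_sin2_0_pi mult.commute)

lemma integral_mu_curvature: "(\<integral>p. k (fst p) * sin (snd p) \<partial>mu) = pi / 2 * integral {0..P} k"
  using integral_mu_prod(2)[OF k_cont k_per continuous_on_sin[OF continuous_on_id]] by (simp add: integral_sin2_0_pi)

definition chord :: "real \<times> real \<Rightarrow> real" where
  "chord p = chordL g (fst p) (hit (fst p) (snd p))"

lemma measurable_chord [measurable]: "chord \<in> borel_measurable (borel \<Otimes>\<^sub>M borel)"
  unfolding chord_def by measurable

lemma along_height_inner:
  "along x y * along x z + height x y * height x z = (g y - g x) \<bullet> (g z - g x)"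
proof -
  define u v where "u = g y - g x" and "v = g z - g x"
  have "along x y * along x z + height x y * height x z =
    Re (cnj (t x) * u) * Re (cnj (t x) * v) + (\<sigma> * \<sigma>) * (Im (cnj (t x) * u) * Im (cnj (t x) * v))"
    by (simp only: along_def height_def u_def v_def mult_ac)
  also have "\<dots> = (Re (t x) * Re (t x) + Im (t x) * Im (t x)) * (u \<bullet> v)"
    unfolding sigma by (simp add: inner_complex_def algebra_simps)
  finally show ?thesis unfolding t_components u_def v_def by simp
qed

text \<open>The length of a chord is split into the components, along the chord, of the vectors from its two
  ends to an arbitrary fixed point \<open>g z\<close>; the first depends on \<open>p\<close> only, the second on its image only.\<close>
lemma chord_decomposition:
  assumes p: "p \<in> \<Omega>"
  defines "q \<equiv> billiard_map p"
  shows "chord p = (cos (snd p) * along (fst p) z + sin (snd p) * height (fst p) z)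
    + (sin (snd q) * height (fst q) z - cos (snd q) * along (fst q) z)"
proof -
  define x y L where "x = fst p" and "y = hit (fst p) (snd p)" and "L = chordL g x y"
  have ne: "g x \<noteq> g y" and ang: "snd p = angle x y"
    using hitD[of "snd p" "fst p"] p by (auto simp: phase_space_iff x_def y_def)
  have L: "0 < L" using chord_pos[OF ne] by (simp add: L_def)
  have q: "snd q = pi - angle y x" "along (fst q) z = along y z" "height (fst q) z = height y z"
    using g_cong[OF g_red refl] by (auto simp: q_def billiard_map_def x_def y_def)
  have e: "L * cos (angle x y) = along x y" "L * sin (angle x y) = height x y"
    "L * cos (angle y x) = along y x" "L * sin (angle y x) = height y x"
    using L sin_cos_angle[OF ne] sin_cos_angle[OF ne[symmetric]] by (simp_all add: L_def chord_commute[of y x])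
  have "L * ((cos (snd p) * along x z + sin (snd p) * height x z)
    + (sin (snd q) * height (fst q) z - cos (snd q) * along (fst q) z))
    = ((L * cos (angle x y)) * along x z + (L * sin (angle x y)) * height x z)
    + ((L * cos (angle y x)) * along y z + (L * sin (angle y x)) * height y z)"
    by (simp add: q ang algebra_simps)
  also have "\<dots> = (along x y * along x z + height x y * height x z) + (along y x * along y z + height y x * height y z)"
    unfolding e ..
  also have "\<dots> = (g y - g x) \<bullet> (g y - g x)"
    unfolding along_height_inner by (simp add: inner_diff_left inner_diff_right inner_commute)
  also have "\<dots> = L * L" by (simp add: L_def chordL_def dist_norm norm_minus_commute[of "g x"] power2_norm_eq_inner[symmetric] power2_eq_square)
  finally have "(cos (snd p) * along x z + sin (snd p) * height x z)
    + (sin (snd q) * height (fst q) z - cos (snd q) * along (fst q) z) = L" using L by simp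
  moreover have "chord p = L" by (simp add: chord_def L_def x_def y_def)
  ultimately show ?thesis by (simp add: x_def)
qed

lemma cont_along_height: "continuous_on UNIV (\<lambda>x. along x z)" "continuous_on UNIV (\<lambda>x. height x z)"
  unfolding height_def along_def by (intro continuous_intros cont_g cont_t)+

text \<open>The cosine parts integrate to 0, because cos \<phi> sin \<phi> does so over (0, pi); the
  two height parts contribute pi / 2 times the same integral. The point \<open>z\<close> is
  arbitrary and can later be chosen at will.\<close>

lemma integral_mu_chord: "(\<integral>p. chord p \<partial>mu) = pi * integral {0..P} (\<lambda>x. height x z)"
proof -
  have per: "along (x + P) z = along x z" "height (x + P) z = height x z" for x
    using g_cong[OF g_per refl] by auto
  note cs = integral_mu_prod[OF cont_along_height(1) per(1) continuous_on_cos[OF continuous_on_id]]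
  note sn = integral_mu_prod[OF cont_along_height(2) per(2) continuous_on_sin[OF continuous_on_id]]
  define G H where "G p = along (fst p) z * cos (snd p)" and "H p = height (fst p) z * sin (snd p)" for p :: "real \<times> real"
  have [measurable]: "G \<in> borel_measurable (borel \<Otimes>\<^sub>M borel)" "H \<in> borel_measurable (borel \<Otimes>\<^sub>M borel)"
    unfolding G_def H_def by measurable
  have G: "integrable mu G" "(\<integral>p. G p \<partial>mu) = 0" and H: "integrable mu H" "(\<integral>p. H p \<partial>mu) = pi / 2 * integral {0..P} (\<lambda>x. height x z)"
    using cs sn by (simp_all add: G_def[abs_def] H_def[abs_def] integral_cos_sin_0_pi integral_sin2_0_pi)
  have T: "billiard_map \<in> mu \<rightarrow>\<^sub>M mu"
    using measurable_billiard_map by (simp cong: measurable_cong_sets add: sets_mu)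
  have HG: "integrable mu (\<lambda>p. H (billiard_map p) - G (billiard_map p))"
    using integrable_distr[OF T, of "\<lambda>p. H p - G p"] G H unfolding distr_billiard_map by simp
  have "(\<integral>p. chord p \<partial>mu) = (\<integral>p. (G p + H p) + (H (billiard_map p) - G (billiard_map p)) \<partial>mu)"
    using AE_mu chord_decomposition[of _ z] by (intro integral_cong_AE) (auto simp: G_def H_def mult.commute)
  also have "\<dots> = (\<integral>p. G p + H p \<partial>mu) + (\<integral>p. H (billiard_map p) - G (billiard_map p) \<partial>mu)"
    by (rule Bochner_Integration.integral_add) (use G H HG in auto)
  also have "(\<integral>p. H (billiard_map p) - G (billiard_map p) \<partial>mu) = (\<integral>p. H p - G p \<partial>mu)"
    by (rule integral_mu_billiard_map[of "\<lambda>p. H p - G p"]) measurable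
  finally show ?thesis using G H by simp
qed

section \<open>The integral inequality for m-orbits\<close>

text \<open>The share of one end of a chord in the minorant \<open>low\<close>. Splitting it by ends
  lets invariance of the measure identify the integrals of the two shares.\<close>

definition defect :: "real \<Rightarrow> real \<times> real \<Rightarrow> real" where
  "defect l p = 2 * l * sin (snd p) - k (fst p) * sin (snd p)"

text \<open>A minorant of the second variation in the constant direction, by the inequality
  \<open>u\<^sup>2 / L \<ge> 2 l u - l\<^sup>2 L\<close>; unlike the second variation it is bounded.\<close>
definition low :: "real \<Rightarrow> real \<times> real \<Rightarrow> real" where
  "low l p = defect l p + defect l (billiard_map p) - l\<^sup>2 * chord p"

lemma measurable_defect [measurable]: "defect l \<in> borel_measurable (borel \<Otimes>\<^sub>M borel)"
  unfolding defect_def by measurable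

lemma measurable_low [measurable]: "low l \<in> borel_measurable (borel \<Otimes>\<^sub>M borel)"
  unfolding low_def by measurable

lemma second_var_step:
  assumes "p \<in> \<Omega>"
  shows "second_var (fst p) (fst (billiard_map p)) \<xi> \<eta> =
    (\<xi> * sin (snd p) + \<eta> * sin (snd (billiard_map p)))\<^sup>2 / chord p
     - \<xi>\<^sup>2 * k (fst p) * sin (snd p) - \<eta>\<^sup>2 * k (fst (billiard_map p)) * sin (snd (billiard_map p))"
proof -
  have "snd p = angle (fst p) (fst (billiard_map p))" "snd (billiard_map p) = pi - angle (fst (billiard_map p)) (fst p)"
    using step_billiard_map[OF assms] by (auto simp: step_iff)
  moreover have "chord p = chordL g (fst p) (fst (billiard_map p))"
    by (simp add: chord_def billiard_map_def chordL_def g_red)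
  ultimately show ?thesis by (simp add: second_var_def)
qed

lemma chord_nonneg: "0 \<le> chord p"
  by (simp add: chord_def chordL_def)

lemma low_le_second_var:
  assumes "p \<in> \<Omega>" shows "low l p \<le> second_var (fst p) (fst (billiard_map p)) 1 1"
proof -
  define u where "u = sin (snd p) + sin (snd (billiard_map p))"
  have pos: "0 < chord p"
    using assms hitD[of "snd p" "fst p"] by (auto simp: chord_def phase_space_iff intro!: chord_pos)
  have "0 \<le> (u - l * chord p)\<^sup>2 / chord p" using pos by simp
  also have "\<dots> = u\<^sup>2 / chord p - 2 * l * u + l\<^sup>2 * chord p"
    using pos by (simp add: field_simps power2_eq_square)
  finally show ?thesis
    unfolding second_var_step[OF assms] low_def defect_def u_def by (simp add: algebra_simps)
qed

text \<open>The second variation is tested on the field that is constant on a long segment; its two edge terms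
  are bounded below independently of \<open>N\<close>.\<close>
lemma sum_low_le:
  assumes p: "p \<in> m_orbit_set g P" and K: "\<And>x. k x \<le> K"
  shows "(\<Sum>n<N. low l ((billiard_map ^^ Suc n) p)) \<le> 2 * K"
proof -
  have p\<Omega>: "p \<in> \<Omega>" and m: "m_configuration g (\<lambda>n. fst (orb p n))" using p by (auto simp: m_orbit_set_iff)
  \<comment> \<open>With \<xi> = 1 on 1, ..., N + 1 the N chords numbered 1 to N see the constant
    field, while chords 0 and N + 1 are the edges; the segment therefore ends at N + 2.\<close>
  define \<xi> :: "int \<Rightarrow> real" where "\<xi> n = (if 1 \<le> n \<and> n \<le> int (Suc N) then 1 else 0)" for n
  define V where "V n = second_var (fst (orb p n)) (fst (orb p (n + 1))) (\<xi> n) (\<xi> (n + 1))" for n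
  have orbn: "orb p (int n) = (billiard_map ^^ n) p" for n by (simp add: orb_def)
  have "quad_form (\<lambda>n. fst (orb p n)) 0 (int (Suc (Suc N))) \<xi> < 0"
  proof -
    have "\<xi> 1 \<noteq> 0" by (simp add: \<xi>_def)
    moreover have "\<forall>n. n \<le> 0 \<or> int (Suc (Suc N)) \<le> n \<longrightarrow> \<xi> n = 0" by (auto simp: \<xi>_def)
    ultimately show ?thesis
      using m unfolding m_configuration_quad_form[of "\<lambda>n. fst (orb p n)", OF orb_neq[OF p\<Omega>]] by (meson of_nat_0_less_iff zero_less_Suc)
  qed
  also have "quad_form (\<lambda>n. fst (orb p n)) 0 (int (Suc (Suc N))) \<xi> = (\<Sum>n\<in>{0..<int (Suc (Suc N))}. V n)"
    by (simp add: quad_form_def V_def)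
  also have "\<dots> = (\<Sum>n<Suc (Suc N). V (int n))"
    by (rule sum.reindex_bij_witness[of _ int nat]) auto
  also have "\<dots> = V (int 0) + (\<Sum>n<Suc N. V (int (Suc n)))"
    by (rule sum.lessThan_Suc_shift)
  also have "\<dots> = V 0 + (\<Sum>n<N. V (int (Suc n))) + V (int (Suc N))"
    by (simp only: sum.lessThan_Suc of_nat_0 add.assoc)
  finally have neg: "V 0 + (\<Sum>n<N. V (int (Suc n))) + V (int (Suc N)) < 0" .
  have bnd: "k x * sin \<phi> \<le> K" for x \<phi>
  proof -
    have "k x * sin \<phi> \<le> k x * 1" using k_pos[of x] by (intro mult_left_mono) auto
    then show ?thesis using K[of x] by simp
  qed
  have edge: "- K \<le> second_var (fst q) (fst (billiard_map q)) 0 1" "- K \<le> second_var (fst q) (fst (billiard_map q)) 1 0"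
    if "q \<in> \<Omega>" for q
  proof -
    have nn: "0 \<le> (sin a)\<^sup>2 / chord q" for a using chord_nonneg[of q] by simp
    have "second_var (fst q) (fst (billiard_map q)) 0 1 =
        (sin (snd (billiard_map q)))\<^sup>2 / chord q - k (fst (billiard_map q)) * sin (snd (billiard_map q))"
      "second_var (fst q) (fst (billiard_map q)) 1 0 = (sin (snd q))\<^sup>2 / chord q - k (fst q) * sin (snd q)"
      by (simp_all add: second_var_step[OF that])
    then show "- K \<le> second_var (fst q) (fst (billiard_map q)) 0 1" "- K \<le> second_var (fst q) (fst (billiard_map q)) 1 0"
      using bnd[of "fst q" "snd q"] bnd[of "fst (billiard_map q)" "snd (billiard_map q)"]
        nn[of "snd q"] nn[of "snd (billiard_map q)"] by linarith+
  qed
  have Vorb: "V n = second_var (fst (orb p n)) (fst (billiard_map (orb p n))) (\<xi> n) (\<xi> (n + 1))" for n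
    by (simp add: V_def orb_Suc[OF p\<Omega>])
  have "- K \<le> V 0" "- K \<le> V (int (Suc N))"
    using edge[OF orb_phase_space[OF p\<Omega>, of 0]] edge[OF orb_phase_space[OF p\<Omega>, of "int (Suc N)"]]
    by (simp_all add: Vorb \<xi>_def)
  moreover have "(\<Sum>n<N. low l ((billiard_map ^^ Suc n) p)) \<le> (\<Sum>n<N. V (int (Suc n)))"
  proof (rule sum_mono)
    fix n assume "n \<in> {..<N}"
    then have "\<xi> (int (Suc n)) = 1" "\<xi> (int (Suc n) + 1) = 1" by (auto simp: \<xi>_def)
    then show "low l ((billiard_map ^^ Suc n) p) \<le> V (int (Suc n))"
      unfolding Vorb orbn[symmetric] using low_le_second_var[OF orb_phase_space[OF p\<Omega>, of "int (Suc n)"]] by simp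
  qed
  ultimately show ?thesis using neg by linarith
qed

lemma defect_bounded: obtains B where "\<And>p. \<bar>defect l p\<bar> \<le> B"
proof -
  obtain K where K: "\<And>x. norm (k x) \<le> K" using periodic_bounded[OF k_cont k_per] by blast
  have "\<bar>defect l p\<bar> \<le> 2 * \<bar>l\<bar> + K" for p
  proof -
    have "\<bar>defect l p\<bar> = \<bar>2 * l - k (fst p)\<bar> * \<bar>sin (snd p)\<bar>"
      by (simp add: defect_def abs_mult[symmetric] algebra_simps)
    also have "\<dots> \<le> \<bar>2 * l - k (fst p)\<bar> * 1" by (intro mult_left_mono) auto
    also have "\<dots> \<le> 2 * \<bar>l\<bar> + K" using K[of "fst p"] by (auto simp: abs_if split: if_splits)
    finally show ?thesis .
  qed
  then show thesis by (rule that)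
qed

lemma low_bounded: obtains B where "\<And>p. \<bar>low l p\<bar> \<le> B"
proof -
  obtain D where D: "\<And>p. \<bar>defect l p\<bar> \<le> D" using defect_bounded[of l] by blast
  obtain C where C: "\<And>x y. chordL g x y \<le> C" using chord_bounded by blast
  have "\<bar>low l p\<bar> \<le> D + D + l\<^sup>2 * C" for p
  proof -
    have "\<bar>low l p\<bar> \<le> \<bar>defect l p\<bar> + \<bar>defect l (billiard_map p)\<bar> + \<bar>l\<^sup>2 * chord p\<bar>"
      unfolding low_def by linarith
    also have "\<bar>l\<^sup>2 * chord p\<bar> \<le> l\<^sup>2 * C"
      using C chord_nonneg[of p] by (auto simp: chord_def abs_mult intro!: mult_left_mono)
    finally show ?thesis using D[of p] D[of "billiard_map p"] by linarith
  qed
  then show thesis by (rule that)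
qed

lemma integral_m_orbits_invariant:
  assumes [measurable]: "F \<in> borel_measurable (borel \<Otimes>\<^sub>M borel)"
  shows "(\<integral>p. indicator (m_orbit_set g P) p * F (billiard_map p) \<partial>mu) = (\<integral>p. indicator (m_orbit_set g P) p * (F p :: real) \<partial>mu)"
proof -
  have "(\<integral>p. indicator (m_orbit_set g P) p * F (billiard_map p) \<partial>mu) =
      (\<integral>p. indicator (m_orbit_set g P) (billiard_map p) * F (billiard_map p) \<partial>mu)"
    using AE_mu m_orbit_set_invariant by (intro integral_cong_AE) (auto simp: indicator_def)
  also have "\<dots> = (\<integral>p. indicator (m_orbit_set g P) p * F p \<partial>mu)"
    by (rule integral_mu_billiard_map[of "\<lambda>p. indicator (m_orbit_set g P) p * F p"]) measurable
  finally show ?thesis .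
qed

lemma measurable_billiard_map_funpow [measurable]:
  "billiard_map ^^ n \<in> borel \<Otimes>\<^sub>M borel \<rightarrow>\<^sub>M borel \<Otimes>\<^sub>M borel"
  by (induction n) auto

lemma integral_m_orbits_funpow:
  assumes [measurable]: "F \<in> borel_measurable (borel \<Otimes>\<^sub>M borel)"
  shows "(\<integral>p. indicator (m_orbit_set g P) p * F ((billiard_map ^^ n) p) \<partial>mu) = (\<integral>p. indicator (m_orbit_set g P) p * (F p :: real) \<partial>mu)"
proof (induction n)
  case (Suc n)
  have "(\<integral>p. indicator (m_orbit_set g P) p * F ((billiard_map ^^ Suc n) p) \<partial>mu)
    = (\<integral>p. indicator (m_orbit_set g P) p * F ((billiard_map ^^ n) (billiard_map p)) \<partial>mu)"
    by (simp only: funpow_Suc_right o_apply)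
  also have "\<dots> = (\<integral>p. indicator (m_orbit_set g P) p * F ((billiard_map ^^ n) p) \<partial>mu)"
    by (rule integral_m_orbits_invariant[of "\<lambda>p. F ((billiard_map ^^ n) p)"]) measurable
  finally show ?case using Suc by simp
qed simp

text \<open>By invariance N times the integral is the integral of the sum of \<open>low\<close>
  along N steps. This sum is at most 2 K on m-orbits, and the total mass is 2 P, so N I is at most 4
  K P for every N.\<close>

lemma integral_low_nonpos: "(\<integral>p. indicator (m_orbit_set g P) p * low l p \<partial>mu) \<le> 0"
proof -
  define I where "I = (\<integral>p. indicator (m_orbit_set g P) p * low l p \<partial>mu)"
  obtain K where K: "0 < K" "\<And>x. norm (k x) \<le> K" using periodic_bounded[OF k_cont k_per] by blast
  have K': "k x \<le> K" for x using K(2)[of x] by simp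
  obtain B where B: "\<And>p. \<bar>low l p\<bar> \<le> B" using low_bounded[of l] by blast
  have B0: "0 \<le> B" using B[of undefined] by linarith
  have int: "integrable mu (\<lambda>p. indicator (m_orbit_set g P) p * low l ((billiard_map ^^ n) p))" for n
    using B B0 by (intro integrable_mu[of _ B]) (auto simp: indicator_def)
  have bound: "real N * I \<le> 4 * K * P" for N
  proof -
    have "real N * I = (\<Sum>n<N. \<integral>p. indicator (m_orbit_set g P) p * low l ((billiard_map ^^ Suc n) p) \<partial>mu)"
      unfolding I_def by (subst integral_m_orbits_funpow) auto
    also have "\<dots> = (\<integral>p. (\<Sum>n<N. indicator (m_orbit_set g P) p * low l ((billiard_map ^^ Suc n) p)) \<partial>mu)"
      by (intro Bochner_Integration.integral_sum[symmetric] int)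
    also have "\<dots> \<le> (\<integral>p. 2 * K * 1 \<partial>mu)"
    proof (rule integral_mono)
      show "integrable mu (\<lambda>p. \<Sum>n<N. indicator (m_orbit_set g P) p * low l ((billiard_map ^^ Suc n) p))"
        by (intro Bochner_Integration.integrable_sum int)
      show "integrable mu (\<lambda>p. 2 * K * 1)" by (intro integrable_mu[of _ "2 * K"]) (use K in auto)
      fix p
      show "(\<Sum>n<N. indicator (m_orbit_set g P) p * low l ((billiard_map ^^ Suc n) p)) \<le> 2 * K * 1"
        using sum_low_le[OF _ K', of p l N] K(1) unfolding sum_distrib_left[symmetric] by (auto simp: indicator_def)
    qed
    also have "\<dots> = 2 * K * (\<integral>p. 1 \<partial>mu)" by (rule integral_mult_right_zero)
    also have "\<dots> = 4 * K * P" unfolding measure_mu_phase_space by simp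
    finally show ?thesis .
  qed
  show ?thesis unfolding I_def[symmetric]
  proof (rule ccontr)
    assume "\<not> I \<le> 0"
    then obtain N where "4 * K * P < real N * I" using ex_less_of_nat_mult[of I "4 * K * P"] by auto
    with bound[of N] show False by simp
  qed
qed

text \<open>Invariance of measure and orbit set gives the defects at the two ends of a chord equal
  integrals, so the image point disappears from them.\<close>

lemma m_orbits_inequality:
  "(\<integral>p. indicator (m_orbit_set g P) p * (2 * defect l p - l\<^sup>2 * chord p) \<partial>mu) \<le> 0"
proof -
  obtain D where D: "\<And>p. \<bar>defect l p\<bar> \<le> D" using defect_bounded[of l] by blast
  have D0: "0 \<le> D" using D[of undefined] by linarith
  obtain C where C: "0 < C" "\<And>x y. chordL g x y \<le> C" using chord_bounded by blast
  let ?i = "\<lambda>p. indicator (m_orbit_set g P) p :: real"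
  have i1: "integrable mu (\<lambda>p. ?i p * defect l p)" "integrable mu (\<lambda>p. ?i p * defect l (billiard_map p))"
    using D D0 by (intro integrable_mu[of _ D]; auto simp: indicator_def)+
  have i2: "integrable mu (\<lambda>p. ?i p * (l\<^sup>2 * chord p))"
    using C chord_nonneg by (intro integrable_mu[of _ "l\<^sup>2 * C"]) (auto simp: indicator_def chord_def abs_mult intro!: mult_left_mono)
  have "(\<integral>p. ?i p * low l p \<partial>mu) = (\<integral>p. ?i p * defect l p + ?i p * defect l (billiard_map p) - ?i p * (l\<^sup>2 * chord p) \<partial>mu)"
    by (intro Bochner_Integration.integral_cong refl) (simp add: low_def algebra_simps)
  also have "\<dots> = (\<integral>p. ?i p * defect l p \<partial>mu) + (\<integral>p. ?i p * defect l (billiard_map p) \<partial>mu) - (\<integral>p. ?i p * (l\<^sup>2 * chord p) \<partial>mu)"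
    using i1 i2 by simp
  also have "(\<integral>p. ?i p * defect l (billiard_map p) \<partial>mu) = (\<integral>p. ?i p * defect l p \<partial>mu)"
    by (rule integral_m_orbits_invariant) measurable
  also have "(\<integral>p. ?i p * defect l p \<partial>mu) + (\<integral>p. ?i p * defect l p \<partial>mu) - (\<integral>p. ?i p * (l\<^sup>2 * chord p) \<partial>mu)
    = (\<integral>p. ?i p * defect l p + ?i p * defect l p - ?i p * (l\<^sup>2 * chord p) \<partial>mu)"
    by (subst Bochner_Integration.integral_diff, (intro Bochner_Integration.integrable_add i1 i2)+,
        subst Bochner_Integration.integral_add, (intro i1)+, rule refl)
  also have "\<dots> = (\<integral>p. ?i p * (2 * defect l p - l\<^sup>2 * chord p) \<partial>mu)"
    by (intro Bochner_Integration.integral_cong refl) (simp add: algebra_simps)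
  finally show ?thesis using integral_low_nonpos[of l] by simp
qed


section \<open>The enclosed area\<close>

lemma lowest_point:
  obtains z where "0 \<le> z" "z \<le> P" "Im (t z) = 0" "\<And>y. g y \<noteq> g z \<Longrightarrow> Im (g z) < Im (g y)"
proof -
  obtain z where z: "z \<in> {0..P}" "\<And>y. y \<in> {0..P} \<Longrightarrow> Im (g z) \<le> Im (g y)"
  proof -
    have "continuous_on {0..P} (\<lambda>y. Im (g y))" by (intro continuous_intros cont_g)
    from continuous_attains_inf[OF compact_Icc _ this] P_pos show thesis using that by force
  qed
  have min: "Im (g z) \<le> Im (g y)" for y
    using z(2)[of "red y"] red_bounds[of y] by (simp add: g_red)
  have "((\<lambda>y. Im (g y)) has_real_derivative Im (t z)) (at z)"
    unfolding has_real_derivative_iff_has_vector_derivative by (intro Im_deriv g_deriv)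
  then have t0: "Im (t z) = 0" by (rule DERIV_local_min[of _ _ _ 1]) (use min in auto)
  \<comment> \<open>At equal height the tangent at \<open>g z\<close>, being horizontal, would
    contain \<open>g y\<close>, against \<open>side\<close>.\<close>
  have "Im (g z) < Im (g y)" if "g y \<noteq> g z" for y
    using side[of z y] that min[of y] t0 by (cases "Im (g y) = Im (g z)") auto
  with z t0 show thesis by (intro that[of z]) auto
qed

text \<open>Coordinates \<open>(q, b)\<close> adapted to the lowest point \<open>g z\<close> of the curve: \<open>b\<close> is the height above the
  horizontal tangent and \<open>q\<close> the cotangent (up to sign) of the direction seen from \<open>g z\<close>.\<close>
lemma area_ge:
  obtains z where "integral {0..P} (\<lambda>x. height x z) \<le> 2 * enclosed_area g P"
proof -
  obtain z where z: "0 \<le> z" "z \<le> P" and t0: "Im (t z) = 0"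
    and low: "\<And>y. g y \<noteq> g z \<Longrightarrow> Im (g z) < Im (g y)"
    using lowest_point by blast
  define \<tau> where "\<tau> = Re (t z)"
  have \<tau>2: "\<tau> * \<tau> = 1" using t_components[of z] by (simp add: t0 \<tau>_def)
  have al: "along z y = \<tau> * Re (g y - g z)" and he: "height z y = \<sigma> * \<tau> * Im (g y - g z)" for y
    by (simp_all add: along_def height_def t0 \<tau>_def)
  \<comment> \<open>Both factors are signs. Equality of orientation is read off from one point that
    is higher than \<open>g z\<close>; consequently \<open>height z y\<close> is the plain vertical
    distance.\<close>
  have st: "\<sigma> * \<tau> = 1"
  proof -
    have ne: "g z \<noteq> g (z + P / 2)" using P_pos by (intro g_neq) auto
    have "0 < \<sigma> * \<tau> * Im (g (z + P / 2) - g z)" using height_pos[OF ne] by (simp add: he)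
    then have "0 < \<sigma> * \<tau>" using low[OF ne[symmetric]] by (simp add: zero_less_mult_iff)
    moreover have "(\<sigma> * \<tau>) * (\<sigma> * \<tau>) = 1" using sigma \<tau>2 by (simp add: mult_ac)
    ultimately show ?thesis by (simp add: square_eq_1_iff)
  qed
  define S where "S = inside (g ` {0..P})"
  have comp: "compact (g ` {0..P})" by (intro compact_continuous_image cont_g compact_Icc)
  have S: "open S" "bounded S"
    using open_inside[OF compact_imp_closed[OF comp]] bounded_inside[OF compact_imp_bounded[OF comp]]
    by (simp_all only: S_def)
  have [measurable]: "S \<in> sets borel" using S(1) by auto
  have SA: "emeasure lborel S = ennreal (enclosed_area g P)"
  proof -
    have "S \<in> lmeasurable" using S by (intro lmeasurable_open)
    then have "emeasure lebesgue S = ennreal (measure lebesgue S)" by (simp add: emeasure_eq_measure2)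
    then show ?thesis by (simp add: enclosed_area_def curve_image_def S_def[symmetric])
  qed
  \<comment> \<open>The indicator of the region in the coordinates (q, b), multiplied by their
    Jacobian \<open>b\<close>.\<close>
  define J where "J q b = (indicator S (Complex (Re (g z) - \<tau> * b * q) (Im (g z) + b)) * ennreal b * indicator {0<..} b :: ennreal)" for q b
  have cm: "(\<lambda>(q, b). Complex (Re (g z) - \<tau> * b * q) (Im (g z) + b)) \<in> borel_measurable borel"
    by (intro borel_measurable_continuous_onI) (auto intro!: continuous_intros simp: Complex_eq split_beta)
  have [measurable]: "(\<lambda>(q, b). Complex (Re (g z) - \<tau> * b * q) (Im (g z) + b)) \<in> borel_measurable (lborel \<Otimes>\<^sub>M lborel)"
    using cm by (simp add: lborel_prod)
  have Jm[measurable]: "(\<lambda>(q, b). J q b) \<in> borel_measurable (lborel \<Otimes>\<^sub>M lborel)"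
    unfolding J_def split_beta using measurable_compose[OF \<open>(\<lambda>(q, b). Complex (Re (g z) - \<tau> * b * q) (Im (g z) + b)) \<in> borel_measurable (lborel \<Otimes>\<^sub>M lborel)\<close>, of "indicator S :: complex \<Rightarrow> ennreal" borel]
    by (intro borel_measurable_times_ennreal) (auto simp: split_beta)
  \<comment> \<open>\<open>h y\<close> is the coordinate \<open>q\<close> of the curve point
    \<open>g y\<close>, minus a cotangent and hence increasing in \<open>y\<close>.\<close>
  define h h' where "h y = - (along z y / height z y)" and "h' y = height y z / (height z y)\<^sup>2" for y
  have ne: "g z \<noteq> g y" if "z < y" "y < z + P" for y using that by (rule g_neq)
  have hd: "(h has_real_derivative h' y) (at y)" if y: "z < y" "y < z + P" for y
  proof -
    have pos: "0 < height z y" by (rule height_pos[OF ne[OF y]])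
    have "(h has_real_derivative - ((Re (cnj (t z) * t y) * height z y - along z y * (\<sigma> * Im (cnj (t z) * t y))) / (height z y * height z y))) (at y)"
      unfolding h_def using pos by (intro DERIV_minus DERIV_divide along_deriv height_deriv) auto
    moreover have "- ((Re (cnj (t z) * t y) * height z y - along z y * (\<sigma> * Im (cnj (t z) * t y))) / (height z y * height z y)) = h' y"
    proof -
      have "along z y * (\<sigma> * Im (cnj (t z) * t y)) - Re (cnj (t z) * t y) * height z y
        = \<sigma> * (Re (t z) * Re (t z) + Im (t z) * Im (t z)) * (Re (g y - g z) * Im (t y) - Im (g y - g z) * Re (t y))"
        unfolding along_def height_def by (simp add: algebra_simps)
      also have "\<dots> = height y z" unfolding t_components height_def by (simp add: algebra_simps)
      finally show ?thesis unfolding h'_def power2_eq_square by (simp only: minus_divide_left minus_diff_eq)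
    qed
    ultimately show ?thesis by simp
  qed
  \<comment> \<open>The open chord from \<open>g z\<close> to \<open>g y\<close> lies in the region,
    so in the direction \<open>h y\<close> all heights from 0 to \<open>height z y\<close> occur;
    integrating \<open>b\<close> over them gives half the square.\<close>
  have inner: "ennreal ((height z y)\<^sup>2 / 2) \<le> (\<integral>\<^sup>+b. J (h y) b \<partial>lborel)" if y: "z < y" "y < z + P" for y
  proof -
    define H where "H = height z y"
    have H: "0 < H" using height_pos[OF ne[OF y]] by (simp add: H_def)
    have "ennreal (H\<^sup>2 / 2) = (\<integral>\<^sup>+b. ennreal b * indicator {0<..<H} b \<partial>lborel)"
      using H by (simp add: nn_integral_id_interval)
    also have "\<dots> \<le> (\<integral>\<^sup>+b. J (h y) b \<partial>lborel)"
    proof (rule nn_integral_mono)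
      fix b :: real
      show "ennreal b * indicator {0<..<H} b \<le> J (h y) b"
      proof (cases "b \<in> {0<..<H}")
        case True
        define s where "s = b / H"
        have s: "0 < s" "s < 1" using True H by (auto simp: s_def)
        have b: "b = s * H" using H by (simp add: s_def)
        have "Complex (Re (g z) - \<tau> * b * h y) (Im (g z) + b) = (1 - s) *\<^sub>R g z + s *\<^sub>R g y"
        proof (rule complex_eqI)
          have "\<tau> * b * h y = - s * (\<tau> * along z y)" using H by (simp add: b h_def H_def)
          also have "\<tau> * along z y = (\<tau> * \<tau>) * Re (g y - g z)" unfolding al by (simp only: mult.assoc)
          finally show "Re (Complex (Re (g z) - \<tau> * b * h y) (Im (g z) + b)) = Re ((1 - s) *\<^sub>R g z + s *\<^sub>R g y)"
            unfolding \<tau>2 by (simp add: algebra_simps)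
          show "Im (Complex (Re (g z) - \<tau> * b * h y) (Im (g z) + b)) = Im ((1 - s) *\<^sub>R g z + s *\<^sub>R g y)"
            unfolding b H_def he st by (simp add: algebra_simps)
        qed
        also have "\<dots> \<in> open_segment (g z) (g y)" using s ne[OF y] by (auto simp: in_segment)
        finally have "Complex (Re (g z) - \<tau> * b * h y) (Im (g z) + b) \<in> S"
          using chord_inside[OF ne[OF y]] by (auto simp: S_def)
        then show ?thesis using True by (simp add: J_def)
      qed simp
    qed
    finally show ?thesis by (simp add: H_def)
  qed
  have "ennreal (integral {0..P} (\<lambda>x. height x z / 2)) = ennreal (\<integral>x. indicator {0..<P} x * (height x z / 2) \<partial>lborel)"
    by (subst integral_interval_0_P) (auto intro!: continuous_intros cont_height)
  also have "\<dots> = (\<integral>\<^sup>+x. ennreal (indicator {0..<P} x * (height x z / 2)) \<partial>lborel)"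
  proof (rule nn_integral_eq_integral[symmetric])
    have "set_integrable lborel {0..P} (\<lambda>x. height x z / 2)"
      by (intro borel_integrable_atLeastAtMost' continuous_intros cont_height) auto
    then have "set_integrable lborel {0..<P} (\<lambda>x. height x z / 2)" by (rule set_integrable_subset) auto
    then show "integrable lborel (\<lambda>x. indicator {0..<P} x * (height x z / 2))" by (simp add: set_integrable_def)
  qed (auto simp: height_nonneg)
  also have "\<dots> = (\<integral>\<^sup>+x. ennreal (height x z / 2) * indicator {0..<P} x \<partial>lborel)"
    by (intro nn_integral_cong) (auto simp: indicator_def)
  also have "\<dots> = (\<integral>\<^sup>+y. ennreal (height y z / 2) * indicator {z<..<z+P} y \<partial>lborel)"
    by (rule integral_shift_period[symmetric]) (use z g_cong(2)[OF g_per refl] in auto)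
  also have "\<dots> \<le> (\<integral>\<^sup>+y. (\<integral>\<^sup>+b. J (h y) b \<partial>lborel) * ennreal (h' y) * indicator {z<..<z+P} y \<partial>lborel)"
  proof (rule nn_integral_mono)
    fix y
    show "ennreal (height y z / 2) * indicator {z<..<z+P} y \<le> (\<integral>\<^sup>+b. J (h y) b \<partial>lborel) * ennreal (h' y) * indicator {z<..<z+P} y"
    proof (cases "y \<in> {z<..<z+P}")
      case True
      then have y: "z < y" "y < z + P" by auto
      \<comment> \<open>The factor \<open>h'\<close> cancels the square. What remains is the area of
        the thin triangle with apex \<open>g z\<close> over the arc element at \<open>g y\<close>,
        whose altitude is \<open>height y z\<close>.\<close>
      have "height y z / 2 = (height z y)\<^sup>2 / 2 * h' y"
        using height_pos[OF ne[OF y]] by (simp add: h'_def)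
      then have "ennreal (height y z / 2) = ennreal ((height z y)\<^sup>2 / 2) * ennreal (h' y)"
        using height_nonneg[of y z] by (subst ennreal_mult[symmetric]) (auto simp: h'_def)
      also have "\<dots> \<le> (\<integral>\<^sup>+b. J (h y) b \<partial>lborel) * ennreal (h' y)"
        by (intro mult_right_mono inner y) auto
      finally show ?thesis using True by simp
    qed simp
  qed
  also have "\<dots> = (\<integral>\<^sup>+q. (\<integral>\<^sup>+b. J q b \<partial>lborel) * indicator (h ` {z<..<z+P}) q \<partial>lborel)"
  proof (rule nn_integral_substitution_open_interval[symmetric])
    show "(\<lambda>q. \<integral>\<^sup>+b. J q b \<partial>lborel) \<in> borel_measurable borel"
      using lborel.borel_measurable_nn_integral[OF Jm] by simp
    show "h \<in> borel_measurable borel" "h' \<in> borel_measurable borel" unfolding h_def h'_def by measurable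
    show "continuous_on {z<..<z+P} h'"
      unfolding h'_def
      by (intro continuous_intros cont_height DERIV_continuous_on[OF DERIV_subset[OF height_deriv]])
         (use height_pos[OF ne] in force)+
    show "0 < h' y" if "z < y" "y < z + P" for y
      using height_pos[OF ne[OF that]] height_pos[OF ne[OF that, symmetric]] by (simp add: h'_def)
  qed (use hd P_pos in auto)
  also have "\<dots> \<le> (\<integral>\<^sup>+q. (\<integral>\<^sup>+b. J q b \<partial>lborel) \<partial>lborel)"
    by (intro nn_integral_mono) (auto simp: indicator_def)
  also have "\<dots> = (\<integral>\<^sup>+b. (\<integral>\<^sup>+q. J q b \<partial>lborel) \<partial>lborel)"
    by (rule lborel_pair.Fubini'[OF Jm, symmetric])
  also have "\<dots> \<le> (\<integral>\<^sup>+b. (\<integral>\<^sup>+a. indicator S (Complex a (Im (g z) + b)) \<partial>lborel) \<partial>lborel)"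
  proof (rule nn_integral_mono)
    fix b :: real
    have [measurable]: "(\<lambda>a. Complex a (Im (g z) + b)) \<in> borel_measurable borel" for b
      by (intro borel_measurable_continuous_onI) (auto intro!: continuous_intros simp: Complex_eq)
    show "(\<integral>\<^sup>+q. J q b \<partial>lborel) \<le> (\<integral>\<^sup>+a. indicator S (Complex a (Im (g z) + b)) \<partial>lborel)"
    proof (cases "0 < b")
      case True
      \<comment> \<open>At fixed height \<open>b\<close> the horizontal coordinate is affine in
        \<open>q\<close> with slope of absolute value \<open>b\<close>, which is the factor built
        into \<open>J\<close>.\<close>
      have "\<bar>\<tau>\<bar> = 1" "\<tau> \<noteq> 0" using \<tau>2 by (auto simp: square_eq_1_iff)
      then have c: "- \<tau> * b \<noteq> 0" "\<bar>- \<tau> * b\<bar> = b" using True by (auto simp: abs_mult)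
      have "(\<integral>\<^sup>+a. indicator S (Complex a (Im (g z) + b)) \<partial>lborel)
        = ennreal b * (\<integral>\<^sup>+q. indicator S (Complex (Re (g z) + (- \<tau> * b) * q) (Im (g z) + b)) \<partial>lborel)"
        using nn_integral_real_affine[of "\<lambda>a. indicator S (Complex a (Im (g z) + b))" "- \<tau> * b" "Re (g z)"] c by simp
      also have "\<dots> = (\<integral>\<^sup>+q. ennreal b * indicator S (Complex (Re (g z) + (- \<tau> * b) * q) (Im (g z) + b)) \<partial>lborel)"
      proof (rule nn_integral_cmult[symmetric])
        have "(\<lambda>q. Complex (Re (g z) + (- \<tau> * b) * q) (Im (g z) + b)) \<in> borel_measurable borel"
          by (intro borel_measurable_continuous_onI) (auto intro!: continuous_intros simp: Complex_eq)
        then show "(\<lambda>q. indicator S (Complex (Re (g z) + (- \<tau> * b) * q) (Im (g z) + b)) :: ennreal) \<in> borel_measurable lborel"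
          by measurable
      qed
      finally show ?thesis using True by (simp add: J_def mult.commute)
    qed (simp add: J_def)
  qed
  also have "\<dots> = emeasure lborel S"
  proof -
    have "emeasure lborel S = (\<integral>\<^sup>+b. (\<lambda>b. \<integral>\<^sup>+a. indicator S (Complex a b) \<partial>lborel) b \<partial>lborel)"
      by (rule emeasure_complex_slices) measurable
    also have "\<dots> = ennreal \<bar>1\<bar> * (\<integral>\<^sup>+b. (\<lambda>b. \<integral>\<^sup>+a. indicator S (Complex a b) \<partial>lborel) (Im (g z) + 1 * b) \<partial>lborel)"
    proof (rule nn_integral_real_affine)
      have "(\<lambda>(b, a). Complex a b) \<in> borel_measurable borel"
        by (intro borel_measurable_continuous_onI) (auto intro!: continuous_intros simp: Complex_eq split_beta)
      then have "(\<lambda>(b, a). Complex a b) \<in> borel_measurable (lborel \<Otimes>\<^sub>M lborel)" by (simp add: lborel_prod)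
      then have "(\<lambda>p. indicator S ((\<lambda>(b, a). Complex a b) p) :: ennreal) \<in> borel_measurable (lborel \<Otimes>\<^sub>M lborel)"
        by measurable
      then have "(\<lambda>(b, a). indicator S (Complex a b) :: ennreal) \<in> borel_measurable (lborel \<Otimes>\<^sub>M lborel)"
        by (simp add: split_beta)
      from lborel.borel_measurable_nn_integral[OF this]
      show "(\<lambda>b. \<integral>\<^sup>+a. indicator S (Complex a b) \<partial>lborel) \<in> borel_measurable borel" by simp
    qed simp
    finally show ?thesis by simp
  qed
  also have "\<dots> = ennreal (enclosed_area g P)" by (rule SA)
  finally have "integral {0..P} (\<lambda>x. height x z / 2) \<le> enclosed_area g P"
    by (subst (asm) ennreal_le_iff) (auto simp: enclosed_area_def)
  then have "integral {0..P} (\<lambda>x. height x z) \<le> 2 * enclosed_area g P"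
    using integral_divide[of "{0..P}" "\<lambda>x. height x z" 2] by simp
  then show thesis by (rule that)
qed


section \<open>The lower bounds\<close>

lemma billiard_mu_eq:
  assumes [measurable]: "S \<in> sets (borel \<Otimes>\<^sub>M borel)" and "S \<subseteq> \<Omega>"
  shows "billiard_mu S = (\<integral>p. indicator S p \<partial>mu)"
proof -
  have sets_eq: "sets (lborel \<Otimes>\<^sub>M lborel) = sets (borel \<Otimes>\<^sub>M borel :: (real \<times> real) measure)"
    by (intro sets_pair_measure_cong) auto
  have [measurable]: "S \<in> sets (lborel \<Otimes>\<^sub>M lborel)" by (simp add: sets_eq)
  have "AE p in lborel \<Otimes>\<^sub>M lborel. 0 \<le> indicator \<Omega> p * sin (snd p)"
    using sin_nonneg_phase_space by (auto simp: indicator_def)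
  then have "(\<integral>p. indicator S p \<partial>mu) = (\<integral>p. indicator \<Omega> p * sin (snd p) * indicator S p \<partial>(lborel \<Otimes>\<^sub>M lborel))"
    unfolding mu_def by (subst integral_density) auto
  also have "\<dots> = (\<integral>p. indicator S p *\<^sub>R sin (snd p) \<partial>(lborel \<Otimes>\<^sub>M lborel))"
    using assms(2) by (intro Bochner_Integration.integral_cong refl) (auto simp: indicator_def)
  finally show ?thesis by (simp add: billiard_mu_def set_lebesgue_integral_def lborel_prod)
qed

lemma delta_proportion_eq:
  "delta_proportion g P = (\<integral>p. indicator (\<Omega> - m_orbit_set g P) p \<partial>mu) / (2 * P)"
proof -
  have "billiard_mu \<Omega> = (\<integral>p. indicator \<Omega> p \<partial>mu)" by (rule billiard_mu_eq) auto
  also have "\<dots> = (\<integral>p. 1 \<partial>mu)" using AE_mu by (intro integral_cong_AE) (auto simp: sets_mu)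
  finally show ?thesis
    unfolding delta_proportion_def measure_mu_phase_space by (subst billiard_mu_eq) auto
qed

lemma delta_nonneg: "0 \<le> delta_proportion g P"
  unfolding delta_proportion_eq using P_pos by (intro divide_nonneg_pos integral_nonneg) auto

text \<open>The constant \<open>c\<close> bounds the integrand on the complement of the m-orbits,
  where sin \<phi> is at most 1 and the chord term is nonpositive; 2 P \<delta> is the measure of
  that complement. Total curvature and chord integral enter with a minus sign, so upper bounds for
  them are what is required.\<close>

lemma fundamental_inequality:
  assumes c: "0 \<le> c" "\<And>x. 4 * l - 2 * k x \<le> c"
  shows "2 * pi * P * l - 2 * pi\<^sup>2 - 2 * pi * l\<^sup>2 * enclosed_area g P \<le> 2 * P * c * delta_proportion g P"
proof -
  obtain z where z: "integral {0..P} (\<lambda>x. height x z) \<le> 2 * enclosed_area g P" by (rule area_ge)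
  obtain D where D: "\<And>p. \<bar>defect l p\<bar> \<le> D" using defect_bounded[of l] by blast
  obtain C where C: "\<And>x y. chordL g x y \<le> C" using chord_bounded by blast
  define F where "F p = 2 * defect l p - l\<^sup>2 * chord p" for p
  have [measurable]: "F \<in> borel_measurable (borel \<Otimes>\<^sub>M borel)" unfolding F_def by measurable
  define B where "B = 2 * D + l\<^sup>2 * C"
  have FB: "\<bar>F p\<bar> \<le> B" for p
  proof -
    have "0 \<le> l\<^sup>2 * chord p" "l\<^sup>2 * chord p \<le> l\<^sup>2 * C"
      using C chord_nonneg[of p] by (auto simp: chord_def intro!: mult_left_mono)
    then show ?thesis using D[of p] unfolding F_def B_def by linarith
  qed
  have B0: "0 \<le> B" using FB[of undefined] by linarith
  let ?j = "\<lambda>p. indicator (m_orbit_set g P) p :: real" and ?d = "\<lambda>p. indicator (\<Omega> - m_orbit_set g P) p :: real"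
  have int: "integrable mu (\<lambda>p. ?j p * F p)" "integrable mu (\<lambda>p. ?d p * F p)"
    using FB B0 by (intro integrable_mu[of _ B]; auto simp: indicator_def)+
  have intd: "integrable mu ?d" by (intro integrable_mu[of _ 1]) (auto simp: indicator_def)
  have i1: "integrable mu (\<lambda>p. sin (snd p))" "integrable mu (\<lambda>p. k (fst p) * sin (snd p))"
    using integral_mu_prod(1)[of "\<lambda>_. 1" sin] integral_mu_prod(1)[OF k_cont k_per, of sin]
      continuous_on_sin[OF continuous_on_id, of UNIV] by auto
  have i2: "integrable mu chord"
    using C chord_nonneg by (intro integrable_mu[of _ C]) (auto simp: chord_def)
  have "(\<integral>p. F p \<partial>mu) = (\<integral>p. 4 * l * sin (snd p) - 2 * (k (fst p) * sin (snd p)) - l\<^sup>2 * chord p \<partial>mu)"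
    by (intro Bochner_Integration.integral_cong refl) (simp add: F_def defect_def algebra_simps)
  also have "\<dots> = 4 * l * (\<integral>p. sin (snd p) \<partial>mu) - 2 * (\<integral>p. k (fst p) * sin (snd p) \<partial>mu) - l\<^sup>2 * (\<integral>p. chord p \<partial>mu)"
    using i1 i2 by simp
  also have "\<dots> = 2 * pi * P * l - pi * integral {0..P} k - l\<^sup>2 * (pi * integral {0..P} (\<lambda>x. height x z))"
    unfolding integral_mu_sin integral_mu_curvature integral_mu_chord[of z] by simp
  finally have F_eq: "(\<integral>p. F p \<partial>mu) = \<dots>" .
  have "pi * integral {0..P} k \<le> pi * (2 * pi)" by (intro mult_left_mono total_curvature_le) auto
  have "l\<^sup>2 * (pi * integral {0..P} (\<lambda>x. height x z)) \<le> l\<^sup>2 * (pi * (2 * enclosed_area g P))"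
    by (intro mult_left_mono z) auto
  have lower: "2 * pi * P * l - 2 * pi\<^sup>2 - 2 * pi * l\<^sup>2 * enclosed_area g P \<le> (\<integral>p. F p \<partial>mu)"
  proof -
    have "2 * pi\<^sup>2 = pi * (2 * pi)" "2 * pi * l\<^sup>2 * enclosed_area g P = l\<^sup>2 * (pi * (2 * enclosed_area g P))"
      by (simp_all add: power2_eq_square)
    then show ?thesis unfolding F_eq
      using \<open>pi * integral {0..P} k \<le> pi * (2 * pi)\<close>
        \<open>l\<^sup>2 * (pi * integral {0..P} (\<lambda>x. height x z)) \<le> l\<^sup>2 * (pi * (2 * enclosed_area g P))\<close>
      by linarith
  qed
  have "(\<integral>p. F p \<partial>mu) = (\<integral>p. ?j p * F p + ?d p * F p \<partial>mu)"
    using AE_mu by (intro integral_cong_AE) (auto simp: indicator_def)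
  also have "\<dots> = (\<integral>p. ?j p * F p \<partial>mu) + (\<integral>p. ?d p * F p \<partial>mu)"
    by (rule Bochner_Integration.integral_add[OF int])
  also have "\<dots> \<le> (\<integral>p. ?d p * F p \<partial>mu)"
    using m_orbits_inequality[of l] by (simp add: F_def)
  also have "\<dots> \<le> (\<integral>p. c * ?d p \<partial>mu)"
  proof (rule integral_mono_AE)
    have "F p \<le> c" if p: "p \<in> \<Omega>" for p
    proof -
      have s: "0 \<le> sin (snd p)" "sin (snd p) \<le> 1" using sin_nonneg_phase_space[OF p] by auto
      have "F p \<le> (4 * l - 2 * k (fst p)) * sin (snd p)"
        using chord_nonneg[of p] by (simp add: F_def defect_def algebra_simps)
      also have "\<dots> \<le> c * sin (snd p)" by (intro mult_right_mono c s)
      also have "\<dots> \<le> c * 1" by (intro mult_left_mono c s)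
      finally show ?thesis by simp
    qed
    then show "AE p in mu. ?d p * F p \<le> c * ?d p" by (auto simp: indicator_def)
  qed (use int intd in auto)
  also have "\<dots> = c * (\<integral>p. ?d p \<partial>mu)" by simp
  also have "\<dots> = 2 * P * c * delta_proportion g P"
    using P_pos by (simp add: delta_proportion_eq)
  finally show ?thesis using lower by linarith
qed

text \<open>The interior is open and contains the midpoint of a chord. Positivity makes the value l
  = sqrt (pi / A) legitimate.\<close>

lemma area_pos: "0 < enclosed_area g P"
proof -
  let ?S = "inside (curve_image g P)"
  have comp: "compact (curve_image g P)"
    unfolding curve_image_def by (intro compact_continuous_image cont_g compact_Icc)
  have S: "open ?S" "bounded ?S"
    by (intro open_inside bounded_inside compact_imp_closed compact_imp_bounded comp)+
  have ne: "g 0 \<noteq> g (P / 2)" using P_pos by (intro g_neq) auto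
  then have "midpoint (g 0) (g (P / 2)) \<in> ?S"
    using chord_inside[OF ne] by (auto simp: curve_image_def)
  then have "\<not> negligible ?S" using S(1) open_not_negligible by blast
  moreover have "?S \<in> lmeasurable" using S by (intro lmeasurable_open)
  ultimately have "measure lebesgue ?S \<noteq> 0" by (simp add: negligible_iff_measure)
  then show ?thesis unfolding enclosed_area_def by (simp add: order_less_le)
qed

text \<open>With c = 4 l the inequality reads \<delta> \<ge> pi / 4 - pi (A l + pi / l) / (4 P). The
  right side is largest for A l^2 = pi, that is l = 2 pi / s, and then equals pi (P - s) / (4
  P).\<close>

lemma delta_ge:
  "pi * (P\<^sup>2 - 4 * pi * enclosed_area g P) / (4 * P * (P + sqrt (4 * pi * enclosed_area g P))) \<le> delta_proportion g P"
proof -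
  define A \<delta> s where "A = enclosed_area g P" and "\<delta> = delta_proportion g P" and "s = sqrt (4 * pi * A)"
  have A: "0 < A" using area_pos by (simp add: A_def)
  then have s: "0 < s" "s * s = 4 * pi * A" by (auto simp: s_def)
  have "2 * pi * P * (2 * pi / s) - 2 * pi\<^sup>2 - 2 * pi * (2 * pi / s)\<^sup>2 * A \<le> 2 * P * (4 * (2 * pi / s)) * \<delta>"
    unfolding A_def \<delta>_def by (rule fundamental_inequality) (use s k_pos in \<open>auto intro: less_imp_le\<close>)
  also have "2 * pi * (2 * pi / s)\<^sup>2 * A = 2 * pi\<^sup>2"
  proof -
    have "2 * pi * (2 * pi / s)\<^sup>2 * A = 2 * pi\<^sup>2 * (4 * pi * A) / (s * s)" by (simp add: power2_eq_square)
    then show ?thesis using s A by simp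
  qed
  finally have "2 * pi * P * (2 * pi / s) - 4 * pi\<^sup>2 \<le> 2 * P * (4 * (2 * pi / s)) * \<delta>" by simp
  from mult_right_mono[OF this less_imp_le[OF s(1)]]
  have "(2 * pi * P * (2 * pi / s) - 4 * pi\<^sup>2) * s \<le> 2 * P * (4 * (2 * pi / s)) * \<delta> * s" .
  also have "(2 * pi * P * (2 * pi / s) - 4 * pi\<^sup>2) * s = 4 * pi * (pi * (P - s))"
    using s(1) by (simp add: left_diff_distrib right_diff_distrib power2_eq_square)
  also have "2 * P * (4 * (2 * pi / s)) * \<delta> * s = 4 * pi * (4 * P * \<delta>)"
    using s(1) by simp
  finally have "4 * pi * (pi * (P - s)) \<le> 4 * pi * (4 * P * \<delta>)" .
  then have "pi * (P - s) \<le> 4 * P * \<delta>" by (rule mult_left_le_imp_le) simp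
  then have *: "pi * (P - s) / (4 * P) \<le> \<delta>" using P_pos by (simp add: field_simps)
  have "P\<^sup>2 - 4 * pi * A = (P - s) * (P + s)" using s by (simp add: power2_eq_square algebra_simps)
  then have "pi * (P\<^sup>2 - 4 * pi * A) / (4 * P * (P + s)) = pi * (P - s) / (4 * P)"
    using P_pos s by simp
  with * show ?thesis by (simp add: A_def \<delta>_def s_def)
qed

text \<open>Keeping the curvature on the complement gives c = 8 pi / P - 2 m for l = 2 pi / P. The
  resulting factor 1 / (4 pi - P m) is then replaced by its lower bound P m / (4 pi^2), which is
  linear in m.\<close>

lemma delta_ge_curvature:
  "(P\<^sup>2 - 4 * pi * enclosed_area g P) * (INF x\<in>{0..P}. k x) / (8 * P) \<le> delta_proportion g P"
proof -
  define A \<delta> m where "A = enclosed_area g P" and "\<delta> = delta_proportion g P" and "m = (INF x\<in>{0..P}. k x)"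
  have bdd: "bdd_below (k ` {0..P})" by (intro bdd_belowI2[of _ 0]) (auto intro: less_imp_le k_pos)
  have mk: "m \<le> k x" for x
    using cINF_lower[OF bdd, of "red x"] red_bounds[of x] by (simp add: m_def k_red)
  have m0: "0 \<le> m" unfolding m_def
    using P_pos by (intro cINF_greatest) (auto intro: less_imp_le k_pos)
  \<comment> \<open>Used twice: \<open>c\<close> has to be nonnegative, and 4 pi - P m must be
    positive for the final cancellation.\<close>
  have Pm: "P * m \<le> 2 * pi"
  proof -
    have "integral {0..P} (\<lambda>_. m) \<le> integral {0..P} k"
      by (intro integral_le integrable_continuous_interval continuous_on_subset[OF k_cont] mk) auto
    then show ?thesis using total_curvature_le P_pos by simp
  qed
  have \<delta>0: "0 \<le> \<delta>" using delta_nonneg by (simp add: \<delta>_def)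
  define X where "X = P\<^sup>2 - 4 * pi * A"
  \<comment> \<open>The main estimate multiplies an inequality by \<open>X\<close> and so needs
    \<open>X > 0\<close>; for \<open>X\<close> nonpositive the claim follows from \<delta> \<ge>
    0.\<close>
  have "X * m / (8 * P) \<le> \<delta>"
  proof (cases "X \<le> 0")
    case True
    then have "X * m / (8 * P) \<le> 0" using m0 P_pos by (intro divide_nonpos_pos mult_nonpos_nonneg) auto
    then show ?thesis using \<delta>0 by linarith
  next
    case False
    have "2 * pi * P * (2 * pi / P) - 2 * pi\<^sup>2 - 2 * pi * (2 * pi / P)\<^sup>2 * A \<le> 2 * P * (8 * pi / P - 2 * m) * \<delta>"
      unfolding A_def \<delta>_def
    proof (rule fundamental_inequality)
      have "8 * pi / P - 2 * m = (8 * pi - 2 * (P * m)) / P" using P_pos by (simp add: field_simps)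
      also have "0 \<le> \<dots>" using Pm pi_gt_zero P_pos by (intro divide_nonneg_pos) linarith+
      finally show "0 \<le> 8 * pi / P - 2 * m" .
      show "4 * (2 * pi / P) - 2 * k x \<le> 8 * pi / P - 2 * m" for x using mk[of x] by simp
    qed
    also have "2 * pi * P * (2 * pi / P) - 2 * pi\<^sup>2 - 2 * pi * (2 * pi / P)\<^sup>2 * A = 2 * pi\<^sup>2 * X / P\<^sup>2"
      using P_pos by (simp add: X_def field_simps power2_eq_square)
    also have "2 * P * (8 * pi / P - 2 * m) * \<delta> = 4 * (4 * pi - P * m) * \<delta>"
      using P_pos by (simp add: field_simps)
    finally have 1: "2 * pi\<^sup>2 * X / P\<^sup>2 \<le> 4 * (4 * pi - P * m) * \<delta>" .
    \<comment> \<open>The two numbers P m and 4 pi - P m have sum 4 pi, so their product is at most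
      4 pi^2.\<close>
    have "0 \<le> 2 * (P * m - 2 * pi)\<^sup>2" by simp
    then have "2 * (P * m) * (4 * pi - P * m) \<le> 8 * pi\<^sup>2" by (simp add: power2_eq_square algebra_simps)
    then have "2 * (P * m) * (4 * pi - P * m) * (X / (4 * P\<^sup>2)) \<le> 8 * pi\<^sup>2 * (X / (4 * P\<^sup>2))"
      using False by (intro mult_right_mono) auto
    also have "\<dots> = 2 * pi\<^sup>2 * X / P\<^sup>2" by simp
    also note 1
    also have "2 * (P * m) * (4 * pi - P * m) * (X / (4 * P\<^sup>2)) = 4 * (4 * pi - P * m) * (X * m / (8 * P))"
      using P_pos by (simp add: field_simps power2_eq_square)
    finally have 2: "4 * (4 * pi - P * m) * (X * m / (8 * P)) \<le> 4 * (4 * pi - P * m) * \<delta>" .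
    have "0 < 4 * pi - P * m" using Pm pi_gt_zero by linarith
    then show ?thesis using mult_left_le_imp_le[OF 2] by simp
  qed
  then show ?thesis by (simp add: X_def A_def \<delta>_def m_def)
qed

end

theorem theorem1p1:
  fixes \<gamma> :: "real \<Rightarrow> complex" and P :: real
  assumes P_pos: "P > 0"
    and smooth: "smooth_curve \<gamma>"
    and periodic: "\<forall>x. \<gamma> (x + P) = \<gamma> x"
    and simple: "inj_on \<gamma> {0..<P}"
    and arclength: "\<forall>x. norm (vderivs 1 \<gamma> x) = 1"
    and strictly_convex: "strictly_convex_curve \<gamma> P"
    and curv_pos: "\<forall>x. curvature \<gamma> x > 0"
  shows "delta_proportion \<gamma> P \<ge>
           pi * (P\<^sup>2 - 4 * pi * enclosed_area \<gamma> P)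
             / (4 * P * (P + sqrt (4 * pi * enclosed_area \<gamma> P)))
       \<and> pi * (P\<^sup>2 - 4 * pi * enclosed_area \<gamma> P)
             / (4 * P * (P + sqrt (4 * pi * enclosed_area \<gamma> P)))
           \<ge> pi * (P\<^sup>2 - 4 * pi * enclosed_area \<gamma> P) / (8 * P\<^sup>2)
       \<and> delta_proportion \<gamma> P \<ge>
           (P\<^sup>2 - 4 * pi * enclosed_area \<gamma> P) * (INF x\<in>{0..P}. curvature \<gamma> x) / (8 * P)"
proof -
  obtain \<sigma> where "convex_oval \<gamma> (vderivs 1 \<gamma>) (curvature \<gamma>) \<sigma> P"
    by (rule convex_ovalI[OF assms])
  then interpret convex_oval \<gamma> "vderivs 1 \<gamma>" "curvature \<gamma>" \<sigma> P .
  show ?thesis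
    using delta_ge delta_ge_curvature bound_comparison[OF P_pos, of "4 * pi * enclosed_area \<gamma> P"] area_pos
    by simp
qed

end
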